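(* Let $d\ge 2$ be an integer. Let $E\colon\mathbb{R}\to\mathbb{R}$ be a non-negative bounded function which is continuous on some bounded open interval $I\subset\mathbb{R}$ and vanishes on $\mathbb{R}\setminus I$. Then there exist infinitely many pairs $(u,\mathbf{b})$ of bounded, compactly supported functions $u\colon\mathbb{R}\times\mathbb{R}^d\to\mathbb{R}$ and $\mathbf{b}\colon\mathbb{R}\times\mathbb{R}^d\to\mathbb{R}^d$ which satisfy $$\partial_t u+\operatorname{div}(u\mathbf{b})=0,\qquad \operatorname{div}\mathbf{b}=0$$ in the sense of distributions on $\mathbb{R}\times\mathbb{R}^d$ and such that $$\int_{\mathbb{R}^d}u^2(t,x)\,dx=E(t)\qquad\text{for a.e. }t\in I.$$
   Context: Points of $\mathbb{R}\times\mathbb{R}^d$ are written $(t,x)$, and $\operatorname{div}$ denotes the divergence with respect to $x\in\mathbb{R}^d$ only. Functions are (Lebesgue) measurable and are identified when they agree almost everywhere; in particular, "infinitely many" means infinitely many distinct pairs of a.e.-equivalence classes. *)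

theory Defs
  imports "HOL-Analysis.Analysis"
begin

text \<open>
  Space-time \<open>\<real> \<times> \<real>\<^sup>d\<close> is the type \<open>real \<times> (real^'d)\<close>; Lebesgue measurability and almost
  everywhere refer to \<^const>\<open>lebesgue\<close>, the completed Lebesgue measure on this Euclidean space.
\<close>

primrec C_k :: "nat \<Rightarrow> ('a::euclidean_space \<Rightarrow> real) \<Rightarrow> bool" where
  "C_k 0 f \<longleftrightarrow> continuous_on UNIV f"
| "C_k (Suc k) f \<longleftrightarrow> (\<forall>z. f differentiable (at z)) \<and>
     (\<forall>e\<in>Basis. C_k k (\<lambda>z. frechet_derivative f (at z) e))"

definition compactly_supported :: "('a::topological_space \<Rightarrow> 'b::zero) \<Rightarrow> bool" where
  "compactly_supported f \<longleftrightarrow> compact (closure {z. f z \<noteq> 0})"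

definition test_function :: "('a::euclidean_space \<Rightarrow> real) \<Rightarrow> bool" where
  "test_function \<phi> \<longleftrightarrow> (\<forall>k. C_k k \<phi>) \<and> compactly_supported \<phi>"

definition time_deriv :: "(real \<times> (real^'d::finite) \<Rightarrow> real) \<Rightarrow> real \<times> (real^'d) \<Rightarrow> real" where
  "time_deriv \<phi> z = frechet_derivative \<phi> (at z) (1, 0)"

definition space_grad :: "(real \<times> (real^'d::finite) \<Rightarrow> real) \<Rightarrow> real \<times> (real^'d) \<Rightarrow> real^'d" where
  "space_grad \<phi> z = (\<chi> i. frechet_derivative \<phi> (at z) (0, axis i 1))"

text \<open>
  The next two definitions are \<open>\<partial>\<^sub>t u + div (u b) = 0\<close> and \<open>div b = 0\<close> in the sense of
  distributions on \<open>\<real> \<times> \<real>\<^sup>d\<close>. Test functions depend on both \<open>t\<close> and \<open>x\<close>, and \<open>div\<close> acts in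
  \<open>x\<close> only; the overall sign produced by moving the derivatives to \<open>\<phi>\<close> is dropped. They are
  meant for locally integrable \<open>u\<close>, \<open>u b\<close> and \<open>b\<close>, for which the integrands are integrable.
\<close>

definition distributional_continuity_eq ::
    "(real \<times> (real^'d::finite) \<Rightarrow> real) \<Rightarrow> (real \<times> (real^'d) \<Rightarrow> real^'d) \<Rightarrow> bool" where
  "distributional_continuity_eq u b \<longleftrightarrow>
     (\<forall>\<phi>. test_function \<phi> \<longrightarrow>
        (LINT z|lebesgue. u z * time_deriv \<phi> z + (u z *\<^sub>R b z) \<bullet> space_grad \<phi> z) = 0)"

definition distributional_div_free :: "(real \<times> (real^'d::finite) \<Rightarrow> real^'d) \<Rightarrow> bool" where
  "distributional_div_free b \<longleftrightarrow>
     (\<forall>\<phi>. test_function \<phi> \<longrightarrow> (LINT z|lebesgue. b z \<bullet> space_grad \<phi> z) = 0)"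

definition ae_class ::
    "('a::euclidean_space \<Rightarrow> 'b::euclidean_space) \<Rightarrow> ('a \<Rightarrow> 'b) set" where
  "ae_class f = {g \<in> borel_measurable lebesgue. AE z in lebesgue. g z = f z}"

end

theory Submission
  imports Defs
begin

text \<open>
  The energy is prescribed by geometry: \<open>\<Omega> = {(t, x). t \<in> I, 0 < x\<^sub>i < E t, 0 < x\<^sub>k < 1 for k \<noteq> i}\<close> is
  open, its slice at time \<open>t\<close> has measure \<open>E t\<close>, and one looks for \<open>u\<close> with \<open>u\<^sup>2\<close> equal to the
  indicator of \<open>\<Omega>\<close> almost everywhere. The equations are invariant under
  \<open>(t, x) \<mapsto> (t\<^sub>0 + \<rho> t, x\<^sub>0 + \<rho> x)\<close>, so it suffices to fill \<open>\<Omega>\<close> up to a null set with disjoint scaled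
  copies of a single block: a pair \<open>(u, b)\<close> on \<open>(-1, 1) \<times> (0, 1)\<^sup>d\<close> with \<open>\<bar>u\<bar> = 1\<close> that solves both
  equations on the whole space when extended by zero.

  The block is a perfect mixer in the style of Depauw, acting on two coordinates only. At time 0, \<open>u\<close>
  is \<open>1\<close> on the left half and \<open>-1\<close> on the right half of the square. During half of the remaining
  time, two square vortices exchange the two middle quarters; the four subsquares are then copies of
  the initial state at half the size, and the construction repeats in each of them, twice as fast.
  As the time tends to 1 the density oscillates faster and faster and tends weakly to 0, so no trace
  is left at time 1. Negative times are obtained by reversing time, which cancels the trace at time 0.

  Infinitely many solutions arise by adding multiples of one more block at times outside \<open>I\<close>.
\<close>

section \<open>Weakly divergence-free fields and scaling\<close>

text \<open>Space and time are always scaled by the same factor, so velocities do not change and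
  \<open>b\<close> stays bounded through infinitely many mixing steps, whose durations 1/2, 1/4, ...
  add up to 1. The vortices are square because squares tile the cell up to null sets; round ones
  would leave corners that are never exchanged. The orbits are squares of period 8 run through at
  parameter speed 8, so the half turn that swaps the middle quarters takes exactly time 1/2. The
  field jumps across diagonals and cell walls, so no flow theory for smooth fields applies; the
  transport is computed by hand in coordinates in which the flow is a translation. Both equations
  come from one computation, the transport of a function \<open>H\<close> of the density:
  \<open>H\<close> the identity gives the continuity equation, \<open>H = 1\<close> the conservation
  of volume. The steps accumulate at time 1. Instead of a weak limit there, the proof uses that the
  whole integral identity reproduces itself on subcells. The graph of \<open>E\<close> may be rough,
  but copies of the block are only scaled and translated, never deformed: openness and boundedness
  are all that the filling asks of \<open>\<Omega>\<close>.\<close>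

text \<open>The continuity equation for \<open>(u, b)\<close> and \<open>div b = 0\<close> say that the space-time fields \<open>(u, u b)\<close>
  and \<open>(0, b)\<close> are weakly divergence free.\<close>

definition C1_grad :: "('a::euclidean_space \<Rightarrow> real) \<Rightarrow> ('a \<Rightarrow> 'a) \<Rightarrow> bool" where
  "C1_grad \<phi> G \<longleftrightarrow> (\<forall>z. (\<phi> has_derivative (\<lambda>h. G z \<bullet> h)) (at z)) \<and> continuous_on UNIV G"

text \<open>No compact support is asked of \<open>\<phi>\<close>, since the fields tested here
  vanish outside a bounded set. The class of admissible pairs is thereby closed under rescaling,
  time reflection and restriction to coordinate slices, and contains all smooth test
  functions.\<close>

definition weak_div_free :: "('a::euclidean_space \<Rightarrow> 'a) \<Rightarrow> bool" where
  "weak_div_free V \<longleftrightarrow> (\<forall>\<phi> G. C1_grad \<phi> G \<longrightarrow> (LINT z|lborel. V z \<bullet> G z) = 0)"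

lemma C1_grad_continuous:
  assumes "C1_grad \<phi> G"
  shows "continuous_on UNIV \<phi>" "continuous_on UNIV G"
  using assms unfolding C1_grad_def
  by (auto intro!: has_derivative_continuous continuous_at_imp_continuous_on)

lemma C1_grad_measurable:
  assumes "C1_grad \<phi> G"
  shows "\<phi> \<in> borel_measurable borel" "G \<in> borel_measurable borel"
  using C1_grad_continuous[OF assms] by (auto intro: borel_measurable_continuous_onI)

lemma C1_grad_affine:
  assumes "C1_grad \<phi> G"
  shows "C1_grad (\<lambda>z. \<phi> (c + \<rho> *\<^sub>R z)) (\<lambda>z. \<rho> *\<^sub>R G (c + \<rho> *\<^sub>R z))"
  unfolding C1_grad_def
proof (intro conjI allI)
  fix z
  have 1: "((\<lambda>z. c + \<rho> *\<^sub>R z) has_derivative (\<lambda>h. \<rho> *\<^sub>R h)) (at z)"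
    by (auto intro!: derivative_eq_intros)
  have 2: "(\<phi> has_derivative (\<lambda>h. G (c + \<rho> *\<^sub>R z) \<bullet> h)) (at (c + \<rho> *\<^sub>R z))"
    using assms by (auto simp: C1_grad_def)
  show "((\<lambda>z. \<phi> (c + \<rho> *\<^sub>R z)) has_derivative (\<lambda>h. (\<rho> *\<^sub>R G (c + \<rho> *\<^sub>R z)) \<bullet> h)) (at z)"
    using has_derivative_compose[OF 1 2] by simp
next
  have "continuous_on UNIV (\<lambda>z. c + \<rho> *\<^sub>R z)"
    by (intro continuous_intros)
  from continuous_on_compose2[OF C1_grad_continuous(2)[OF assms] this]
  show "continuous_on UNIV (\<lambda>z. \<rho> *\<^sub>R G (c + \<rho> *\<^sub>R z))"
    by (intro continuous_on_scaleR continuous_on_const) simp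
qed

lemma integrable_bounded_cbox:
  fixes f :: "'a::euclidean_space \<Rightarrow> 'b::euclidean_space"
  assumes "f \<in> borel_measurable borel" "\<And>z. z \<in> cbox a b \<Longrightarrow> norm (f z) \<le> M"
    and "\<And>z. z \<notin> cbox a b \<Longrightarrow> f z = 0"
  shows "integrable lborel f"
  by (rule integrableI_bounded_set[where A="cbox a b" and B=M])
     (use assms emeasure_lborel_cbox_finite[of a b] in auto)

lemma integrable_inner_continuous:
  fixes V G :: "'a::euclidean_space \<Rightarrow> 'b::euclidean_space"
  assumes "V \<in> borel_measurable borel" "\<And>z. norm (V z) \<le> M"
    and "\<And>z. z \<notin> cbox a b \<Longrightarrow> V z = 0" and "continuous_on UNIV G"
  shows "integrable lborel (\<lambda>z. V z \<bullet> G z)"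
proof -
  have "bounded (G ` cbox a b)"
    using assms(4) by (intro compact_imp_bounded compact_continuous_image)
      (auto intro: continuous_on_subset)
  then obtain C where C: "\<And>z. z \<in> cbox a b \<Longrightarrow> norm (G z) \<le> C"
    by (auto simp: bounded_iff)
  have [measurable]: "V \<in> borel_measurable borel" "G \<in> borel_measurable borel"
    using assms by (auto intro: borel_measurable_continuous_onI)
  show ?thesis
  proof (rule integrable_bounded_cbox[where a=a and b=b and M="M * C"])
    fix z assume z: "z \<in> cbox a b"
    have "norm (V z \<bullet> G z) \<le> norm (V z) * norm (G z)"
      by (simp add: Cauchy_Schwarz_ineq2)
    also have "\<dots> \<le> M * C"
      using assms(2)[of z] C[OF z] by (intro mult_mono) (auto intro: order_trans[OF norm_ge_zero])
    finally show "norm (V z \<bullet> G z) \<le> M * C" .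
  qed (use assms(3) in auto)
qed

lemma integral_lborel_affine:
  fixes f :: "'a::euclidean_space \<Rightarrow> real"
  assumes [measurable]: "f \<in> borel_measurable borel" and "\<rho> > 0"
  shows "(LINT z|lborel. f z) = \<rho> ^ DIM('a) * (LINT z|lborel. f (c + \<rho> *\<^sub>R z))"
  using assms(2)
  by (subst lborel_affine[where c=\<rho> and t=c])
     (auto simp: integral_density integral_distr)

section \<open>Filling an open set with scaled copies of a box\<close>

lemma AE_not_in_frontier_cbox: "AE z in lborel. z \<notin> cbox a b - box a b"
proof -
  have "cbox a b - box a b \<in> null_sets lborel"
    using negligible_frontier_interval[of a b]
    by (subst null_sets_completion_iff[symmetric]) (auto simp: negligible_iff_null_sets)
  then show ?thesis by (rule AE_not_in)
qed

text \<open>The dyadic covering lemma subdivides one big box. If that box is homothetic to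
  \<open>box a b\<close>, so is every dyadic piece; the countably many frontiers are null.\<close>

lemma similar_boxes_decomposition:
  fixes a b :: "'a::euclidean_space"
  assumes ab: "box a b \<noteq> {}" and "open \<Omega>" "bounded \<Omega>"
  obtains A :: "nat \<Rightarrow> 'a set" and c \<rho> where
    "\<And>n. \<rho> n > 0" "\<And>n. A n = {} \<or> A n = {z. (1 / \<rho> n) *\<^sub>R (z - c n) \<in> box a b}"
    "\<And>m n. m \<noteq> n \<Longrightarrow> A m \<inter> A n = {}" "\<And>n. A n \<subseteq> \<Omega>"
    "AE z in lborel. z \<in> \<Omega> \<longrightarrow> z \<in> (\<Union>n. A n)"
proof -
  define m where "m = (1/2) *\<^sub>R (a + b)"
  have "m \<in> box a b"
    using ab by (auto simp: m_def mem_box box_ne_empty inner_add_left)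
  then obtain e where e: "e > 0" "ball m e \<subseteq> box a b"
    using open_box openE by blast
  obtain r where r: "r > 0" "\<And>z. z \<in> \<Omega> \<Longrightarrow> norm z < r"
    using \<open>bounded \<Omega>\<close> by (metis bounded_pos_less)
  \<comment> \<open>With this factor the homothetic box about the origin contains the ball of radius
    \<open>r\<close>, because \<open>m + z / R\<close> lies in \<open>ball m e\<close> as soon as
    \<open>norm z < R * e = r\<close>.\<close>
  define R where "R = r / e"
  have R: "R > 0" using e r by (simp add: R_def)
  define a' b' where "a' = R *\<^sub>R (a - m)" and "b' = R *\<^sub>R (b - m)"
  have sub: "\<Omega> \<subseteq> cbox a' b'"
  proof
    fix z assume "z \<in> \<Omega>"
    then have "norm z < R * e" using r e by (simp add: R_def)
    then have "norm ((1/R) *\<^sub>R z) < e" using R by (simp add: field_simps)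
    then have "m + (1/R) *\<^sub>R z \<in> box a b"
      using e(2) by (force simp: dist_norm)
    then show "z \<in> cbox a' b'"
      using R by (auto simp: mem_box a'_def b'_def inner_simps field_simps less_imp_le)
  qed
  have ne: "box a' b' \<noteq> {}"
    using ab R by (auto simp: a'_def b'_def box_ne_empty inner_simps)
  \<comment> \<open>Each piece of the covering is tagged by a point of \<open>\<Omega>\<close>,
    where this gauge equals \<open>\<Omega>\<close>; hence every piece lies inside
    \<open>\<Omega>\<close>.\<close>
  have gauge: "gauge (\<lambda>x. if x \<in> \<Omega> then \<Omega> else UNIV)"
    using \<open>open \<Omega>\<close> by (auto simp: gauge_def)
  obtain \<D> where D: "countable \<D>"
      "\<And>K. K \<in> \<D> \<Longrightarrow> interior K \<noteq> {} \<and> (\<exists>c d. K = cbox c d)"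
      "pairwise (\<lambda>A B. interior A \<inter> interior B = {}) \<D>"
      "\<And>K. K \<in> \<D> \<Longrightarrow> \<exists>x \<in> \<Omega> \<inter> K. K \<subseteq> (if x \<in> \<Omega> then \<Omega> else UNIV)"
      "\<And>u v. cbox u v \<in> \<D> \<Longrightarrow> \<exists>n. \<forall>i \<in> Basis. v \<bullet> i - u \<bullet> i = (b' \<bullet> i - a' \<bullet> i) / 2^n"
      "\<Omega> \<subseteq> \<Union>\<D>"
    by (rule covering_lemma[OF sub ne gauge]) blast
  have "\<exists>c \<rho>. \<rho> > 0 \<and> interior K = {z. (1 / \<rho>) *\<^sub>R (z - c) \<in> box a b}" if KD: "K \<in> \<D>" for K
  proof -
    obtain u v where K: "K = cbox u v" using D(2)[OF KD] by blast
    obtain n where n: "\<And>i. i \<in> Basis \<Longrightarrow> v \<bullet> i - u \<bullet> i = (b' \<bullet> i - a' \<bullet> i) / 2^n"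
      using D(5) KD K by blast
    \<comment> \<open>The big box has \<open>R\<close> times the sides of \<open>box a b\<close>,
      and a piece of level \<open>n\<close> has them divided by \<open>2 ^ n\<close>. Below, the
      translation is \<open>u - \<rho> a\<close> because the corner \<open>a\<close> must go to
      \<open>u\<close>.\<close>
    define \<rho> where "\<rho> = R / 2^n"
    have \<rho>: "\<rho> > 0" using R by (simp add: \<rho>_def)
    have v: "v \<bullet> i = u \<bullet> i + \<rho> * (b \<bullet> i - a \<bullet> i)" if "i \<in> Basis" for i
      using n[OF that] by (simp add: \<rho>_def a'_def b'_def inner_simps field_simps)
    have "interior K = {z. (1 / \<rho>) *\<^sub>R (z - (u - \<rho> *\<^sub>R a)) \<in> box a b}"
    proof (rule set_eqI)
      fix z
      have "(a \<bullet> i < (1/\<rho>) * (z \<bullet> i - (u \<bullet> i - \<rho> * (a \<bullet> i)))) = (u \<bullet> i < z \<bullet> i)"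
           "((1/\<rho>) * (z \<bullet> i - (u \<bullet> i - \<rho> * (a \<bullet> i))) < b \<bullet> i) = (z \<bullet> i < v \<bullet> i)"
        if "i \<in> Basis" for i
        using \<rho> v[OF that] by (auto simp: field_simps)
      then show "z \<in> interior K \<longleftrightarrow> z \<in> {z. (1 / \<rho>) *\<^sub>R (z - (u - \<rho> *\<^sub>R a)) \<in> box a b}"
        by (simp add: K interior_cbox mem_box inner_simps)
    qed
    with \<rho> show ?thesis by blast
  qed
  then obtain c \<rho> where c\<rho>: "\<And>K. K \<in> \<D> \<Longrightarrow> \<rho> K > 0 \<and> interior K = {z. (1 / \<rho> K) *\<^sub>R (z - c K) \<in> box a b}"
    by metis
  \<comment> \<open>All naturals serve as indices; those that number no piece give the empty set,
    whence the alternative \<open>A n = {}\<close> in the conclusion.\<close>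
  define E where "E n = (if n \<in> to_nat_on \<D> ` \<D> then from_nat_into \<D> n else {})" for n
  have E: "E n \<in> \<D>" if "n \<in> to_nat_on \<D> ` \<D>" for n
    using that D(1) by (auto simp: E_def)
  show ?thesis
  proof (rule that[of "\<lambda>n. if E n \<in> \<D> then \<rho> (E n) else 1" "\<lambda>n. interior (E n)" "\<lambda>n. c (E n)"])
    fix n
    show "(if E n \<in> \<D> then \<rho> (E n) else 1) > 0" using c\<rho> by auto
    show "interior (E n) = {} \<or> interior (E n) =
      {z. (1 / (if E n \<in> \<D> then \<rho> (E n) else 1)) *\<^sub>R (z - c (E n)) \<in> box a b}"
      using c\<rho>[of "E n"] E[of n] by (cases "n \<in> to_nat_on \<D> ` \<D>") (auto simp: E_def)
    show "interior (E n) \<subseteq> \<Omega>"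
      using D(4)[OF E[of n]] interior_subset[of "E n"]
      by (cases "n \<in> to_nat_on \<D> ` \<D>") (auto simp: E_def split: if_splits)
  next
    fix m n :: nat assume "m \<noteq> n"
    show "interior (E m) \<inter> interior (E n) = {}"
    proof (cases "m \<in> to_nat_on \<D> ` \<D> \<and> n \<in> to_nat_on \<D> ` \<D>")
      case True
      then have "E m \<noteq> E n" using \<open>m \<noteq> n\<close> D(1) by (auto simp: E_def)
      then show ?thesis using D(3) E[of m] E[of n] True by (auto simp: pairwise_def)
    qed (auto simp: E_def)
  next
    have "AE z in lborel. \<forall>K\<in>\<D>. z \<in> K \<longrightarrow> z \<in> interior K"
      using D(1)
    proof (subst AE_ball_countable, safe)
      fix K assume "K \<in> \<D>"
      then obtain u v where "K = cbox u v" using D(2) by blast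
      then show "AE z in lborel. z \<in> K \<longrightarrow> z \<in> interior K"
        using AE_not_in_frontier_cbox[of u v] by (auto simp: interior_cbox)
    qed
    then show "AE z in lborel. z \<in> \<Omega> \<longrightarrow> z \<in> (\<Union>n. interior (E n))"
    proof eventually_elim
      case (elim z)
      show ?case
      proof
        assume "z \<in> \<Omega>"
        then obtain K where K: "K \<in> \<D>" "z \<in> K" using D(6) by blast
        then have "z \<in> interior (E (to_nat_on \<D> K))"
          using elim D(1) by (auto simp: E_def)
        then show "z \<in> (\<Union>n. interior (E n))" by blast
      qed
    qed
  qed
qed

text \<open>What is copied is the pair \<open>(u, b)\<close>, but the equations concern fluxes such
  as \<open>(u, u b)\<close> that are not linear in it; hence one \<open>W\<close> for all flux maps
  \<open>T\<close>. Each copy contributes a multiple of the integral of the block against a rescaled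
  test function, which is zero, and the contributions are summed by countable additivity.\<close>

lemma fill_with_scaled_copies:
  fixes F :: "'a::euclidean_space \<Rightarrow> 'b::euclidean_space"
  assumes ab: "box a b \<noteq> {}" and \<Omega>: "open \<Omega>" "bounded \<Omega>"
    and F[measurable]: "F \<in> borel_measurable borel"
  obtains W :: "'a \<Rightarrow> 'b" where
    "W \<in> borel_measurable borel" "\<And>z. W z \<in> insert 0 (range F)" "\<And>z. z \<notin> \<Omega> \<Longrightarrow> W z = 0"
    "AE z in lborel. z \<in> \<Omega> \<longrightarrow> W z \<in> F ` box a b"
    "\<And>T :: 'b \<Rightarrow> 'a. \<lbrakk>T \<in> borel_measurable borel; T 0 = 0; bounded (T ` range F);
       weak_div_free (\<lambda>z. indicator (box a b) z *\<^sub>R T (F z))\<rbrakk> \<Longrightarrow> weak_div_free (\<lambda>z. T (W z))"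
proof -
  obtain A c \<rho> where \<rho>: "\<And>n. \<rho> n > 0"
    and A: "\<And>n::nat. A n = {} \<or> A n = {z. (1 / \<rho> n) *\<^sub>R (z - c n) \<in> box a b}"
    and disj: "\<And>m n. m \<noteq> n \<Longrightarrow> A m \<inter> A n = {}" and sub: "\<And>n. A n \<subseteq> \<Omega>"
    and AE: "AE z in lborel. z \<in> \<Omega> \<longrightarrow> z \<in> (\<Union>n. A n)"
    by (rule similar_boxes_decomposition[OF ab \<Omega>]) blast
  have [measurable]: "A n \<in> sets borel" for n
    using A[of n] by (elim disjE; simp)
  define W where "W z = (if \<exists>n. z \<in> A n then
      (let n = (SOME n. z \<in> A n) in F ((1 / \<rho> n) *\<^sub>R (z - c n))) else 0)" for z
  have W: "W z = F ((1 / \<rho> n) *\<^sub>R (z - c n))" if "z \<in> A n" for z n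
  proof -
    have "(SOME n. z \<in> A n) = n" using that disj by (intro some_equality) blast+
    then show ?thesis using that by (auto simp: W_def)
  qed
  have W0: "W z = 0" if "\<And>n. z \<notin> A n" for z using that by (auto simp: W_def)
  have Wm[measurable]: "W \<in> borel_measurable borel"
  proof (rule measurable_piecewise_restrict2[where A="\<lambda>n. case n of 0 \<Rightarrow> - (\<Union>n. A n) | Suc n \<Rightarrow> A n"])
    show "(case n of 0 \<Rightarrow> - (\<Union>n. A n) | Suc n \<Rightarrow> A n) \<in> sets borel" for n
      by (cases n) auto
    have "z \<in> (\<Union>n. case n of 0 \<Rightarrow> - (\<Union>n. A n) | Suc n \<Rightarrow> A n)" for z
    proof (cases "\<exists>n. z \<in> A n")
      case True
      then obtain n where "z \<in> A n" by blast
      then show ?thesis by (intro UN_I[of "Suc n"]) auto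
    next
      case False
      then show ?thesis by (intro UN_I[of "0::nat"]) auto
    qed
    then show "space borel = (\<Union>n. case n of 0 \<Rightarrow> - (\<Union>n. A n) | Suc n \<Rightarrow> A n)" by auto
    show "\<exists>h\<in>borel_measurable borel. \<forall>x\<in>case n of 0 \<Rightarrow> - (\<Union>n. A n) | Suc n \<Rightarrow> A n. W x = h x" for n
    proof (cases n)
      case 0
      then show ?thesis by (intro bexI[of _ "\<lambda>_. 0"]) (auto intro!: W0)
    next
      case (Suc k)
      then show ?thesis
        by (intro bexI[of _ "\<lambda>z. F ((1 / \<rho> k) *\<^sub>R (z - c k))"]) (auto intro!: W)
    qed
  qed
  have Wr: "W z \<in> insert 0 (range F)" for z
    by (cases "\<exists>n. z \<in> A n") (auto simp: W W0)
  show ?thesis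
  proof (rule that[OF Wm Wr])
    show "W z = 0" if "z \<notin> \<Omega>" for z
      using that sub by (intro W0) blast
    show "AE z in lborel. z \<in> \<Omega> \<longrightarrow> W z \<in> F ` box a b"
      using AE
    proof eventually_elim
      case (elim z)
      show ?case
      proof
        assume "z \<in> \<Omega>"
        with elim obtain n where n: "z \<in> A n" by blast
        with A[of n] show "W z \<in> F ` box a b" by (auto simp: W[OF n])
      qed
    qed
  next
    fix T :: "'b \<Rightarrow> 'a"
    assume T[measurable]: "T \<in> borel_measurable borel" and T0: "T 0 = 0" and bT: "bounded (T ` range F)"
      and df: "weak_div_free (\<lambda>z. indicator (box a b) z *\<^sub>R T (F z))"
    obtain M where M: "\<And>z. norm (T (F z)) \<le> M" using bT by (auto simp: bounded_iff)
    have M': "norm (T (W z)) \<le> M" for z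
      using M order_trans[OF norm_ge_zero M] by (cases "\<exists>n. z \<in> A n") (auto simp: W W0 T0)
    obtain l u where lu: "\<Omega> \<subseteq> cbox l u" using bounded_subset_cbox_symmetric[OF \<Omega>(2)] by blast
    have W_out: "T (W z) = 0" if "z \<notin> cbox l u" for z
    proof -
      have "W z = 0" using that lu sub by (intro W0) blast
      then show ?thesis using T0 by simp
    qed
    show "weak_div_free (\<lambda>z. T (W z))"
      unfolding weak_div_free_def
    proof (intro allI impI)
      fix \<phi> and G :: "'a \<Rightarrow> 'a" assume G: "C1_grad \<phi> G"
      note [measurable] = C1_grad_measurable[OF G]
      have int: "integrable lborel (\<lambda>z. T (W z) \<bullet> G z)"
        by (rule integrable_inner_continuous[where M=M and a=l and b=u])
           (use M' C1_grad_continuous[OF G] W_out in auto)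
      have z: "(LINT z:A n|lborel. T (W z) \<bullet> G z) = 0" for n
        using A[of n]
      proof
        assume An: "A n = {z. (1 / \<rho> n) *\<^sub>R (z - c n) \<in> box a b}"
        have "(LINT z:A n|lborel. T (W z) \<bullet> G z) =
           (LINT z|lborel. (indicator (box a b) ((1 / \<rho> n) *\<^sub>R (z - c n)) *\<^sub>R T (F ((1 / \<rho> n) *\<^sub>R (z - c n)))) \<bullet> G z)"
          unfolding set_lebesgue_integral_def using W[of _ n] An
          by (intro Bochner_Integration.integral_cong) (auto simp: indicator_def)
        also have "\<dots> = \<rho> n ^ DIM('a) * (LINT z|lborel. (indicator (box a b) z *\<^sub>R T (F z)) \<bullet> G (c n + \<rho> n *\<^sub>R z))"
          using \<rho>[of n] by (subst integral_lborel_affine[where c="c n" and \<rho>="\<rho> n"]) simp_all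
        \<comment> \<open>One factor \<open>\<rho> n\<close> moves to \<open>G\<close>, so that the
          gradient of the rescaled test function appears.\<close>
        also have "\<dots> = \<rho> n ^ DIM('a) / \<rho> n * (LINT z|lborel. (indicator (box a b) z *\<^sub>R T (F z)) \<bullet> (\<rho> n *\<^sub>R G (c n + \<rho> n *\<^sub>R z)))"
          using \<rho>[of n] by simp
        also have "\<dots> = 0"
          using df[unfolded weak_div_free_def, rule_format, OF C1_grad_affine[OF G, of "c n" "\<rho> n"]]
          by (simp only: mult_zero_right)
        finally show ?thesis .
      qed (simp add: set_lebesgue_integral_def)
      have "(LINT z|lborel. T (W z) \<bullet> G z) = (LINT z:(\<Union>n. A n)|lborel. T (W z) \<bullet> G z)"
        unfolding set_lebesgue_integral_def
        by (intro Bochner_Integration.integral_cong) (auto simp: indicator_def W0 T0)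
      also have "\<dots> = (\<Sum>n. (LINT z:A n|lborel. T (W z) \<bullet> G z))"
      proof (rule lebesgue_integral_countable_add)
        show "set_integrable lborel (\<Union>n. A n) (\<lambda>z. T (W z) \<bullet> G z)"
          unfolding set_integrable_def using int by (intro integrable_mult_indicator) auto
      qed (use disj in auto)
      finally show "(LINT z|lborel. T (W z) \<bullet> G z) = 0" using z by simp
    qed
  qed
qed

section \<open>The square vortex\<close>

text \<open>Here \<open>q\<close> is a label of a particle, \<open>Z (t, q)\<close> its position and
  \<open>f\<close> the density of labels. Fubini reduces the claim to the fundamental theorem of
  calculus along each path; the finite sets \<open>N q\<close> allow for corners.\<close>

lemma integral_along_paths:
  fixes f :: "'q::euclidean_space \<Rightarrow> real" and Z v :: "real \<times> 'q \<Rightarrow> 'a::euclidean_space"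
  assumes \<phi>: "C1_grad \<phi> G"
    and [measurable]: "f \<in> borel_measurable borel" "Z \<in> borel_measurable borel" "v \<in> borel_measurable borel"
    and T: "0 \<le> T"
    and bound: "\<And>t q. t \<in> {0..T} \<Longrightarrow> q \<in> cbox a b \<Longrightarrow> \<bar>f q * (G (Z (t, q)) \<bullet> v (t, q))\<bar> \<le> M"
    and supp: "\<And>q. q \<notin> cbox a b \<Longrightarrow> f q = 0"
    and N: "\<And>q. f q \<noteq> 0 \<Longrightarrow> finite (N q)"
    and cont: "\<And>q. f q \<noteq> 0 \<Longrightarrow> continuous_on {0..T} (\<lambda>t. Z (t, q))"
    and deriv: "\<And>q t. f q \<noteq> 0 \<Longrightarrow> t \<in> {0<..<T} - N q \<Longrightarrow>
      ((\<lambda>t. Z (t, q)) has_vector_derivative v (t, q)) (at t)"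
  shows "(LINT z|lborel. indicator {0..<T} (fst z) * (f (snd z) * (G (Z z) \<bullet> v z))) =
    (LINT q|lborel. f q * (\<phi> (Z (T, q)) - \<phi> (Z (0, q))))"
proof -
  note [measurable] = C1_grad_measurable[OF \<phi>]
  have [measurable]: "Z \<in> borel_measurable (borel \<Otimes>\<^sub>M borel)" "v \<in> borel_measurable (borel \<Otimes>\<^sub>M borel)"
    using assms(3,4) by (simp_all add: borel_prod)
  define F where "F = (\<lambda>t q. indicator {0..<T} t * (f q * (G (Z (t, q)) \<bullet> v (t, q))))"
  have Feq: "(\<lambda>z. indicator {0..<T} (fst z) * (f (snd z) * (G (Z z) \<bullet> v z))) = case_prod F"
    by (auto simp: F_def)
  have int: "integrable lborel (case_prod F)"
  proof (rule integrable_bounded_cbox[where a="(0, a)" and b="(T, b)" and M="\<bar>M\<bar>"])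
    show "case_prod F \<in> borel_measurable borel"
      unfolding Feq[symmetric] borel_prod[symmetric] by measurable
    show "norm (case_prod F z) \<le> \<bar>M\<bar>" if "z \<in> cbox (0, a) (T, b)" for z
      using that bound[of "fst z" "snd z"] by (auto simp: F_def indicator_def cbox_Pair_eq)
    show "case_prod F z = 0" if "z \<notin> cbox (0, a) (T, b)" for z
      using that supp by (auto simp: F_def indicator_def cbox_Pair_eq split: prod.splits)
  qed
  have "(LINT z|lborel. case_prod F z) = (LINT q|lborel. LINT t|lborel. F t q)"
    using int unfolding lborel_prod[symmetric] by (subst lborel_pair.integral_snd) auto
  also have "\<dots> = (LINT q|lborel. f q * (\<phi> (Z (T, q)) - \<phi> (Z (0, q))))"
  proof (rule Bochner_Integration.integral_cong[OF refl])
    fix q show "(LINT t|lborel. F t q) = f q * (\<phi> (Z (T, q)) - \<phi> (Z (0, q)))"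
  proof (cases "f q = 0")
    case False
    then have q: "q \<in> cbox a b" using supp by blast
    define h where "h t = G (Z (t, q)) \<bullet> v (t, q)" for t
    have [measurable]: "h \<in> borel_measurable borel"
      unfolding h_def by measurable
    have "((\<lambda>t. \<phi> (Z (t, q))) has_vector_derivative h t) (at t)" if "t \<in> {0<..<T} - N q" for t
    proof -
      have "(\<phi> has_derivative (\<lambda>h. G (Z (t, q)) \<bullet> h)) (at (Z (t, q)))"
        using \<phi> by (simp add: C1_grad_def)
      from has_derivative_compose[OF deriv[OF False that, unfolded has_vector_derivative_def] this]
      show ?thesis by (simp add: has_vector_derivative_def h_def)
    qed
    moreover have "continuous_on {0..T} (\<lambda>t. \<phi> (Z (t, q)))"
      by (rule continuous_on_compose2[OF C1_grad_continuous(1)[OF \<phi>] cont[OF False]]) simp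
    ultimately have FTC: "(h has_integral (\<phi> (Z (T, q)) - \<phi> (Z (0, q)))) {0..T}"
      by (intro fundamental_theorem_of_calculus_interior_strong[OF N[OF False] T]) auto
    \<comment> \<open>The integrand is only measurable along a path, so this bound is what turns the
      gauge integral of the fundamental theorem into a Lebesgue integral.\<close>
    have hb: "\<bar>h t\<bar> \<le> M / \<bar>f q\<bar>" if "t \<in> {0..T}" for t
      using bound[OF that q] False by (simp add: h_def abs_mult field_simps)
    have "set_integrable lborel {0..T} h"
      unfolding set_integrable_def
      by (rule integrable_bounded_cbox[where a=0 and b=T and M="M / \<bar>f q\<bar>"])
         (use hb in \<open>auto simp: indicator_def\<close>)
    from set_borel_integral_eq_integral(2)[OF this] FTC
    have "(LINT t:{0..T}|lborel. h t) = \<phi> (Z (T, q)) - \<phi> (Z (0, q))"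
      by (simp add: integral_unique)
    moreover have "(LINT t|lborel. F t q) = (LINT t|lborel. f q * (indicator {0..T} t * h t))"
      using AE_lborel_singleton[of T]
      by (intro integral_cong_AE) (auto simp: F_def h_def indicator_def)
    ultimately show ?thesis by (simp add: set_lebesgue_integral_def)
  qed (simp add: F_def)
  qed
  finally show ?thesis by (simp add: Feq)
qed

text \<open>\<open>square_path\<close> runs along the boundary of \<open>[-1, 1]\<^sup>2\<close> with unit speed and period 8; its formula
  is valid only on the interval from \<open>-2\<close> to \<open>12\<close>. The field \<open>square_rotation\<close> transports
  \<open>r *\<^sub>R square_path s\<close> to \<open>r *\<^sub>R square_path (s + t)\<close> for all \<open>r\<close> simultaneously, and \<open>square_angle\<close>
  recovers \<open>s\<close>, in the range from \<open>-1\<close> to \<open>7\<close>.\<close>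

definition trapezoid_wave :: "real \<Rightarrow> real" where
  "trapezoid_wave s = max (-1) (min 1 (max (2 - \<bar>s\<bar>) (2 - \<bar>s - 8\<bar>)))"

definition square_path :: "real \<Rightarrow> real \<times> real" where
  "square_path s = (trapezoid_wave s, trapezoid_wave (s - 2))"

definition square_rotation :: "real \<times> real \<Rightarrow> real \<times> real" where
  "square_rotation p = (if \<bar>snd p\<bar> < \<bar>fst p\<bar> then (0, fst p) else (- snd p, 0))"

definition square_angle :: "real \<times> real \<Rightarrow> real" where
  "square_angle = (\<lambda>(x, y). if \<bar>y\<bar> < x then y / x else if \<bar>x\<bar> \<le> y \<and> 0 < y then 2 - x / y
     else if \<bar>y\<bar> < - x then 4 + y / x else 6 - x / y)"

lemma trapezoid_wave_simps:
  "-1 \<le> s \<Longrightarrow> s \<le> 1 \<Longrightarrow> trapezoid_wave s = 1"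
  "1 \<le> s \<Longrightarrow> s \<le> 3 \<Longrightarrow> trapezoid_wave s = 2 - s"
  "3 \<le> s \<Longrightarrow> s \<le> 5 \<Longrightarrow> trapezoid_wave s = -1"
  "5 \<le> s \<Longrightarrow> s \<le> 7 \<Longrightarrow> trapezoid_wave s = s - 6"
  "7 \<le> s \<Longrightarrow> s \<le> 9 \<Longrightarrow> trapezoid_wave s = 1"
  "9 \<le> s \<Longrightarrow> s \<le> 11 \<Longrightarrow> trapezoid_wave s = 10 - s"
  "-3 \<le> s \<Longrightarrow> s \<le> -1 \<Longrightarrow> trapezoid_wave s = 2 + s"
  by (auto simp: trapezoid_wave_def max_def min_def)

lemma square_path_simps:
  "-1 \<le> s \<Longrightarrow> s \<le> 1 \<Longrightarrow> square_path s = (1, s)"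
  "1 \<le> s \<Longrightarrow> s \<le> 3 \<Longrightarrow> square_path s = (2 - s, 1)"
  "3 \<le> s \<Longrightarrow> s \<le> 5 \<Longrightarrow> square_path s = (-1, 4 - s)"
  "5 \<le> s \<Longrightarrow> s \<le> 7 \<Longrightarrow> square_path s = (s - 6, -1)"
  "7 \<le> s \<Longrightarrow> s \<le> 9 \<Longrightarrow> square_path s = (1, s - 8)"
  "9 \<le> s \<Longrightarrow> s \<le> 11 \<Longrightarrow> square_path s = (10 - s, 1)"
  by (simp_all add: square_path_def trapezoid_wave_simps)

lemma square_path_periodic: "-1 \<le> s \<Longrightarrow> s \<le> 3 \<Longrightarrow> square_path (s + 8) = square_path s"
  by (cases "s \<le> 1") (simp_all add: square_path_simps)

lemma continuous_on_square_path: "continuous_on A square_path"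
  unfolding square_path_def trapezoid_wave_def by (intro continuous_intros)

lemma measurable_square_path[measurable]: "square_path \<in> borel_measurable borel"
  by (intro borel_measurable_continuous_onI continuous_on_square_path)

lemma norm_square_path_le: "norm (square_path s) \<le> 2"
proof -
  have "\<bar>trapezoid_wave s\<bar> \<le> 1" for s
    unfolding trapezoid_wave_def by linarith
  then have "norm (trapezoid_wave s) + norm (trapezoid_wave (s - 2)) \<le> 2"
    by (metis (mono_tags) add_mono one_add_one real_norm_def)
  then show ?thesis
    unfolding square_path_def by (metis norm_Pair_le order_trans)
qed

text \<open>Makes the path an integral curve of the rotation. The excluded parameters are the
  corners, which lie on the diagonals where the field jumps; the range up to 11 admits a start below
  7 followed by a shift of at most 4.\<close>

lemma square_path_deriv:
  assumes "-1 < s" "s < 11" "s \<notin> {1, 3, 5, 7, 9}"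
  shows "(square_path has_vector_derivative square_rotation (square_path s)) (at s)"
proof -
  have *: "(square_path has_vector_derivative square_rotation (square_path s)) (at s)"
    if "l < s" "s < u" "\<And>s. l < s \<Longrightarrow> s < u \<Longrightarrow> square_path s = (a + m * s, b + n * s)"
       "square_rotation (square_path s) = (m, n)" for l u a b m n
  proof (rule has_vector_derivative_transform_within_open[where f="\<lambda>s. (a + m * s, b + n * s)" and S="{l<..<u}"])
    show "((\<lambda>s. (a + m * s, b + n * s)) has_vector_derivative square_rotation (square_path s)) (at s)"
      unfolding that(4) by (auto intro!: derivative_eq_intros)
  qed (use that in auto)
  consider "-1 < s \<and> s < 1" | "1 < s \<and> s < 3" | "3 < s \<and> s < 5" | "5 < s \<and> s < 7" | "7 < s \<and> s < 9" | "9 < s \<and> s < 11"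
    using assms by force
  then show ?thesis
  proof cases
    case 1 then show ?thesis by (intro *[of "-1" 1 1 0 0 1]) (auto simp: square_path_simps square_rotation_def)
  next
    case 2 then show ?thesis by (intro *[of 1 3 2 "-1" 1 0]) (auto simp: square_path_simps square_rotation_def)
  next
    case 3 then show ?thesis by (intro *[of 3 5 "-1" 0 4 "-1"]) (auto simp: square_path_simps square_rotation_def)
  next
    case 4 then show ?thesis by (intro *[of 5 7 "-6" 1 "-1" 0]) (auto simp: square_path_simps square_rotation_def)
  next
    case 5 then show ?thesis by (intro *[of 7 9 1 0 "-8" 1]) (auto simp: square_path_simps square_rotation_def)
  next
    case 6 then show ?thesis by (intro *[of 9 11 10 "-1" 1 0]) (auto simp: square_path_simps square_rotation_def)
  qed
qed

text \<open>Homogeneity of degree one makes all concentric squares turn with the same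
  period.\<close>

lemma square_rotation_scale: "r > 0 \<Longrightarrow> square_rotation (r *\<^sub>R p) = r *\<^sub>R square_rotation p"
  by (cases p) (auto simp: square_rotation_def abs_mult)

lemma square_angle_path:
  assumes "0 < r" "-1 < s" "s < 7" "s \<notin> {1, 3, 5}"
  shows "square_angle (r *\<^sub>R square_path s) = s"
proof -
  consider "-1 < s \<and> s < 1" | "1 < s \<and> s < 3" | "3 < s \<and> s < 5" | "5 < s \<and> s < 7"
    using assms by force
  then show ?thesis
  proof cases
    case 1
    then have "r * \<bar>s\<bar> < r" using assms(1) by auto
    then show ?thesis using 1 assms(1) by (simp add: square_path_simps square_angle_def abs_mult)
  next
    case 2
    then have "r * \<bar>2 - s\<bar> \<le> r" "\<not> r < r * (2 - s)" using assms(1) by auto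
    then show ?thesis using 2 assms(1) by (simp add: square_path_simps square_angle_def abs_mult)
  next
    case 3
    moreover have "0 \<le> r * \<bar>4 - s\<bar>" using assms(1) by simp
    then have "\<not> r * \<bar>4 - s\<bar> < - r" using assms(1) by linarith
    ultimately have "r * \<bar>4 - s\<bar> < r" "\<not> r \<le> r * (4 - s)" "\<not> r * \<bar>4 - s\<bar> < - r"
      using assms(1) by auto
    then show ?thesis using 3 assms(1) by (simp add: square_path_simps square_angle_def abs_mult)
  next
    case 4
    then have "\<not> r < r * (s - 6)" "\<not> r < - (r * (s - 6))" using assms(1) by (auto simp: algebra_simps)
    then show ?thesis using 4 assms(1)
      by (simp add: square_path_simps square_angle_def abs_mult)
  qed
qed

section \<open>Area in square polar coordinates\<close>

lemma measurable_square_rotation[measurable]: "square_rotation \<in> borel_measurable borel"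
  unfolding square_rotation_def borel_prod[symmetric] by measurable

lemma measurable_square_angle[measurable]: "square_angle \<in> borel_measurable borel"
  unfolding square_angle_def borel_prod[symmetric] by measurable

text \<open>The substitution \<open>x = r \<epsilon> (s - m)\<close> on one side of the square of
  half side \<open>r\<close>: \<open>m\<close> is the parameter at the middle of the side,
  \<epsilon> its orientation. The factor \<open>r\<close> is the Jacobian of the polar
  coordinates.\<close>

lemma nn_integral_sector:
  fixes F :: "real \<Rightarrow> ennreal"
  assumes [measurable]: "F \<in> borel_measurable borel" and r: "r > 0" and \<epsilon>: "\<bar>\<epsilon>\<bar> = (1::real)"
  shows "(\<integral>\<^sup>+x. indicator {x. \<bar>x\<bar> < r} x * F x \<partial>lborel) =
    (\<integral>\<^sup>+s. indicator {m - 1<..<m + 1} s * (ennreal r * F (r * (\<epsilon> * (s - m)))) \<partial>lborel)"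
proof -
  have e: "\<bar>r * \<epsilon>\<bar> = r" using r \<epsilon> by (simp add: abs_mult)
  have ind: "\<bar>- (r * \<epsilon> * m) + r * \<epsilon> * s\<bar> < r \<longleftrightarrow> m - 1 < s \<and> s < m + 1" for s
  proof -
    have "- (r * \<epsilon> * m) + r * \<epsilon> * s = (r * \<epsilon>) * (s - m)" by (simp add: algebra_simps)
    then have "\<bar>- (r * \<epsilon> * m) + r * \<epsilon> * s\<bar> = r * \<bar>s - m\<bar>" using e by (simp add: abs_mult)
    then show ?thesis using r by (auto simp: abs_less_iff)
  qed
  have "(\<integral>\<^sup>+x. indicator {x. \<bar>x\<bar> < r} x * F x \<partial>lborel) =
    ennreal \<bar>r * \<epsilon>\<bar> * (\<integral>\<^sup>+s. indicator {x. \<bar>x\<bar> < r} (- (r * \<epsilon> * m) + r * \<epsilon> * s) * F (- (r * \<epsilon> * m) + r * \<epsilon> * s) \<partial>lborel)"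
    using r \<epsilon> by (intro nn_integral_real_affine) auto
  also have "\<dots> = (\<integral>\<^sup>+s. ennreal r * (indicator {x. \<bar>x\<bar> < r} (- (r * \<epsilon> * m) + r * \<epsilon> * s) * F (- (r * \<epsilon> * m) + r * \<epsilon> * s)) \<partial>lborel)"
    unfolding e by (subst nn_integral_cmult) auto
  also have "\<dots> = (\<integral>\<^sup>+s. indicator {m - 1<..<m + 1} s * (ennreal r * F (r * (\<epsilon> * (s - m)))) \<partial>lborel)"
    using ind by (intro nn_integral_cong) (auto simp: indicator_def algebra_simps)
  finally show ?thesis .
qed

lemma AE_hyperplane:
  fixes k :: "'a::euclidean_space"
  assumes "k \<in> Basis"
  shows "AE z in lborel. z \<bullet> k \<noteq> c"
proof -
  have "{z. z \<bullet> k = c} \<in> null_sets lborel"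
    using negligible_standard_hyperplane[OF assms, of c]
    by (subst null_sets_completion_iff[symmetric]) (auto simp: negligible_iff_null_sets)
  then show ?thesis by (rule AE_I') auto
qed

lemma AE_fst_snd_real:
  "AE q in (lborel :: (real \<times> real) measure). fst q \<noteq> c" "AE q in (lborel :: (real \<times> real) measure). snd q \<noteq> c"
  using AE_hyperplane[of "(1, 0) :: real \<times> real" c] AE_hyperplane[of "(0, 1) :: real \<times> real" c]
  by (simp_all add: Basis_prod_def inner_prod_def)

abbreviation "open_square \<equiv> {-1<..<1::real} \<times> {-1<..<1::real}"
abbreviation "polar_rect \<equiv> {0<..<1::real} \<times> {-1..<7::real}"

lemma nn_integral_add4:
  assumes "f \<in> borel_measurable M" "g \<in> borel_measurable M" "h \<in> borel_measurable M" "k \<in> borel_measurable M"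
  shows "(\<integral>\<^sup>+x. f x \<partial>M) + ((\<integral>\<^sup>+x. g x \<partial>M) + ((\<integral>\<^sup>+x. h x \<partial>M) + (\<integral>\<^sup>+x. k x \<partial>M))) =
    (\<integral>\<^sup>+x. f x + (g x + (h x + k x)) \<partial>M)"
  using assms by (simp add: nn_integral_add)

text \<open>The diagonals cut the square into four triangles. In each of them the radius is, up to
  sign, a Cartesian coordinate and the angle an affine function of the other one, so Fubini and the
  substitution on one side suffice.\<close>

lemma nn_integral_square_polar:
  fixes F :: "real \<times> real \<Rightarrow> ennreal"
  assumes F: "F \<in> borel_measurable borel"
  shows "(\<integral>\<^sup>+p. indicator open_square p * F p \<partial>lborel) =
    (\<integral>\<^sup>+q. indicator polar_rect q * (ennreal (fst q) * F (fst q *\<^sub>R square_path (snd q))) \<partial>lborel)"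
proof -
  have [measurable]: "F \<in> borel_measurable (borel \<Otimes>\<^sub>M borel)" "F \<in> borel_measurable borel"
    "square_path \<in> borel \<rightarrow>\<^sub>M borel \<Otimes>\<^sub>M borel"
    using F by (simp_all add: borel_prod)
  have Fm: "F \<in> borel_measurable (lborel \<Otimes>\<^sub>M lborel)" using F by (simp add: lborel_prod)
  \<comment> \<open>The share of the side with midpoint \<open>m\<close> (0, 2, 4, 6 for right, top,
    left, bottom) on the square of half side \<open>r\<close>.\<close>
  define P where "P m r = (\<integral>\<^sup>+s. indicator {m - 1<..<m + 1} s * (ennreal r * F (r *\<^sub>R square_path s)) \<partial>lborel)"
    for m r :: real
  have [measurable]: "P m \<in> borel_measurable borel" for m
    unfolding P_def scaleR_prod_def by measurable
  define J where "J m = (\<integral>\<^sup>+r. indicator {0<..<1} r * P m r \<partial>lborel)" for m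
  have sec: "indicator {0<..<1} r * (\<integral>\<^sup>+x. indicator {x. \<bar>x\<bar> < r} x * F (g x) \<partial>lborel) = indicator {0<..<1} r * P m r"
    if "g \<in> borel \<rightarrow>\<^sub>M borel \<Otimes>\<^sub>M borel" "\<bar>\<epsilon>\<bar> = 1"
      "\<And>s. 0 < r \<Longrightarrow> m - 1 < s \<Longrightarrow> s < m + 1 \<Longrightarrow> g (r * (\<epsilon> * (s - m))) = r *\<^sub>R square_path s" for g m \<epsilon> r
  proof (cases "r \<in> {0<..<1}")
    case True
    have [measurable]: "g \<in> borel \<rightarrow>\<^sub>M borel \<Otimes>\<^sub>M borel" by fact
    have "(\<integral>\<^sup>+x. indicator {x. \<bar>x\<bar> < r} x * F (g x) \<partial>lborel) =
      (\<integral>\<^sup>+s. indicator {m - 1<..<m + 1} s * (ennreal r * F (g (r * (\<epsilon> * (s - m))))) \<partial>lborel)"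
      using that True by (intro nn_integral_sector) auto
    also have "\<dots> = P m r"
      unfolding P_def using that(3) True by (intro nn_integral_cong) (auto simp: indicator_def)
    finally show ?thesis by simp
  qed simp
  have J0: "(\<integral>\<^sup>+p. indicator {p. \<bar>snd p\<bar> < fst p \<and> fst p < 1} p * F p \<partial>lborel) = J 0"
  proof -
    have "(\<integral>\<^sup>+p. indicator {p. \<bar>snd p\<bar> < fst p \<and> fst p < 1} p * F p \<partial>lborel) =
      (\<integral>\<^sup>+x. \<integral>\<^sup>+y. indicator {p. \<bar>snd p\<bar> < fst p \<and> fst p < 1} (x, y) * F (x, y) \<partial>lborel \<partial>lborel)"
      unfolding lborel_prod[symmetric] by (subst lborel.nn_integral_fst[symmetric]) auto
    also have "\<dots> = (\<integral>\<^sup>+x. indicator {0<..<1} x * (\<integral>\<^sup>+y. indicator {y. \<bar>y\<bar> < x} y * F (x, y) \<partial>lborel) \<partial>lborel)"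
      by (intro nn_integral_cong trans[OF _ nn_integral_cmult]) (auto simp: indicator_def)
    also have "\<dots> = J 0"
      unfolding J_def
      by (intro nn_integral_cong sec[where \<epsilon>=1]) (auto simp: square_path_simps)
    finally show ?thesis .
  qed
  have J4: "(\<integral>\<^sup>+p. indicator {p. \<bar>snd p\<bar> < - fst p \<and> - fst p < 1} p * F p \<partial>lborel) = J 4"
  proof -
    have "(\<integral>\<^sup>+p. indicator {p. \<bar>snd p\<bar> < - fst p \<and> - fst p < 1} p * F p \<partial>lborel) =
      (\<integral>\<^sup>+x. \<integral>\<^sup>+y. indicator {p. \<bar>snd p\<bar> < - fst p \<and> - fst p < 1} (x, y) * F (x, y) \<partial>lborel \<partial>lborel)"
      unfolding lborel_prod[symmetric] by (subst lborel.nn_integral_fst[symmetric]) auto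
    \<comment> \<open>Reflecting the left triangle makes the radius positive, as in the right
      one.\<close>
    also have "\<dots> = (\<integral>\<^sup>+x. \<integral>\<^sup>+y. indicator {p. \<bar>snd p\<bar> < - fst p \<and> - fst p < 1} (- x, y) * F (- x, y) \<partial>lborel \<partial>lborel)"
      by (subst nn_integral_real_affine[where c="-1" and t=0]) auto
    also have "\<dots> = (\<integral>\<^sup>+x. indicator {0<..<1} x * (\<integral>\<^sup>+y. indicator {y. \<bar>y\<bar> < x} y * F (- x, y) \<partial>lborel) \<partial>lborel)"
      by (intro nn_integral_cong trans[OF _ nn_integral_cmult]) (auto simp: indicator_def)
    also have "\<dots> = J 4"
      unfolding J_def
      by (intro nn_integral_cong sec[where \<epsilon>="-1"]) (auto simp: square_path_simps)
    finally show ?thesis .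
  qed
  have J2: "(\<integral>\<^sup>+p. indicator {p. \<bar>fst p\<bar> < snd p \<and> snd p < 1} p * F p \<partial>lborel) = J 2"
  proof -
    have "(\<integral>\<^sup>+p. indicator {p. \<bar>fst p\<bar> < snd p \<and> snd p < 1} p * F p \<partial>lborel) =
      (\<integral>\<^sup>+y. \<integral>\<^sup>+x. indicator {p. \<bar>fst p\<bar> < snd p \<and> snd p < 1} (x, y) * F (x, y) \<partial>lborel \<partial>lborel)"
      unfolding lborel_prod[symmetric] by (subst lborel_pair.nn_integral_snd[symmetric]) auto
    also have "\<dots> = (\<integral>\<^sup>+y. indicator {0<..<1} y * (\<integral>\<^sup>+x. indicator {x. \<bar>x\<bar> < y} x * F (x, y) \<partial>lborel) \<partial>lborel)"
      by (intro nn_integral_cong trans[OF _ nn_integral_cmult]) (auto simp: indicator_def)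
    also have "\<dots> = J 2"
      unfolding J_def
      by (intro nn_integral_cong sec[where \<epsilon>="-1"]) (auto simp: square_path_simps)
    finally show ?thesis .
  qed
  have J6: "(\<integral>\<^sup>+p. indicator {p. \<bar>fst p\<bar> < - snd p \<and> - snd p < 1} p * F p \<partial>lborel) = J 6"
  proof -
    have "(\<integral>\<^sup>+p. indicator {p. \<bar>fst p\<bar> < - snd p \<and> - snd p < 1} p * F p \<partial>lborel) =
      (\<integral>\<^sup>+y. \<integral>\<^sup>+x. indicator {p. \<bar>fst p\<bar> < - snd p \<and> - snd p < 1} (x, y) * F (x, y) \<partial>lborel \<partial>lborel)"
      unfolding lborel_prod[symmetric] by (subst lborel_pair.nn_integral_snd[symmetric]) auto
    also have "\<dots> = (\<integral>\<^sup>+y. \<integral>\<^sup>+x. indicator {p. \<bar>fst p\<bar> < - snd p \<and> - snd p < 1} (x, - y) * F (x, - y) \<partial>lborel \<partial>lborel)"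
      by (subst nn_integral_real_affine[where c="-1" and t=0]) auto
    also have "\<dots> = (\<integral>\<^sup>+y. indicator {0<..<1} y * (\<integral>\<^sup>+x. indicator {x. \<bar>x\<bar> < y} x * F (x, - y) \<partial>lborel) \<partial>lborel)"
      by (intro nn_integral_cong trans[OF _ nn_integral_cmult]) (auto simp: indicator_def)
    also have "\<dots> = J 6"
      unfolding J_def
      by (intro nn_integral_cong sec[where \<epsilon>=1]) (auto simp: square_path_simps)
    finally show ?thesis .
  qed
  \<comment> \<open>The four open triangles miss only the diagonals, which are null.\<close>
  have "AE p in (lborel :: (real \<times> real) measure). fst p - snd p \<noteq> 0 \<and> fst p + snd p \<noteq> 0"
  proof -
    have "AE x in lborel. AE y in lborel. x - y \<noteq> 0 \<and> x + y \<noteq> (0::real)"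
    proof (rule AE_I2)
      fix x :: real
      show "AE y in lborel. x - y \<noteq> 0 \<and> x + y \<noteq> 0"
        using AE_lborel_singleton[of x] AE_lborel_singleton[of "-x"] by eventually_elim auto
    qed
    moreover have "open {p :: real \<times> real. fst p - snd p \<noteq> 0 \<and> fst p + snd p \<noteq> 0}"
      by (intro open_Collect_conj open_Collect_neq continuous_intros)
    then have "{p \<in> space (lborel \<Otimes>\<^sub>M lborel). fst p - snd p \<noteq> 0 \<and> fst p + snd p \<noteq> (0::real)}
      \<in> sets (lborel \<Otimes>\<^sub>M lborel)"
      unfolding lborel_prod sets_lborel space_lborel by (intro borel_open) simp
    ultimately show ?thesis
      unfolding lborel_prod[symmetric] by (intro lborel_pair.AE_pair_measure) simp_all
  qed
  then have "AE p in lborel. indicator open_square p * F p =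
      indicator {p. \<bar>snd p\<bar> < fst p \<and> fst p < 1} p * F p + (indicator {p. \<bar>fst p\<bar> < snd p \<and> snd p < 1} p * F p
    + (indicator {p. \<bar>snd p\<bar> < - fst p \<and> - fst p < 1} p * F p + indicator {p. \<bar>fst p\<bar> < - snd p \<and> - snd p < 1} p * F p))"
    by eventually_elim (auto simp: indicator_def)
  moreover have "{p :: real \<times> real. \<bar>snd p\<bar> < fst p \<and> fst p < 1} \<in> sets borel"
     "{p :: real \<times> real. \<bar>fst p\<bar> < snd p \<and> snd p < 1} \<in> sets borel"
     "{p :: real \<times> real. \<bar>snd p\<bar> < - fst p \<and> -1 < fst p} \<in> sets borel"
     "{p :: real \<times> real. \<bar>fst p\<bar> < - snd p \<and> -1 < snd p} \<in> sets borel"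
    by (intro borel_open open_Collect_conj open_Collect_less continuous_intros)+
  ultimately have "(\<integral>\<^sup>+p. indicator open_square p * F p \<partial>lborel) = J 0 + (J 2 + (J 4 + J 6))"
    unfolding J0[symmetric] J2[symmetric] J4[symmetric] J6[symmetric]
    by (subst nn_integral_add4) (auto intro!: nn_integral_cong_AE)
  also have "\<dots> = (\<integral>\<^sup>+r. indicator {0<..<1} r * (P 0 r + (P 2 r + (P 4 r + P 6 r))) \<partial>lborel)"
    unfolding J_def distrib_left by (subst nn_integral_add4) auto
  also have "\<dots> = (\<integral>\<^sup>+r. \<integral>\<^sup>+s. indicator polar_rect (r, s) * (ennreal r * F (r *\<^sub>R square_path s)) \<partial>lborel \<partial>lborel)"
  proof (rule nn_integral_cong)
    fix r :: real
    have [measurable]: "(\<lambda>s. F (r *\<^sub>R square_path s)) \<in> borel_measurable borel"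
      unfolding scaleR_prod_def by measurable
    have "AE s in lborel. s \<notin> {-1, 1, 3, 5, 7::real}"
      using AE_lborel_singleton[of "-1"] AE_lborel_singleton[of 1] AE_lborel_singleton[of 3]
        AE_lborel_singleton[of 5] AE_lborel_singleton[of 7] by eventually_elim auto
    then have "AE s in lborel. indicator {-1..<7} s * (ennreal r * F (r *\<^sub>R square_path s)) =
        indicator {0 - 1<..<0 + 1} s * (ennreal r * F (r *\<^sub>R square_path s)) +
       (indicator {2 - 1<..<2 + 1} s * (ennreal r * F (r *\<^sub>R square_path s)) +
       (indicator {4 - 1<..<4 + 1} s * (ennreal r * F (r *\<^sub>R square_path s)) +
        indicator {6 - 1<..<6 + 1} s * (ennreal r * F (r *\<^sub>R square_path s))))"
      by eventually_elim (auto simp: indicator_def)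
    then have "P 0 r + (P 2 r + (P 4 r + P 6 r)) =
      (\<integral>\<^sup>+s. indicator {-1..<7} s * (ennreal r * F (r *\<^sub>R square_path s)) \<partial>lborel)"
      unfolding P_def by (subst nn_integral_add4) (auto intro!: nn_integral_cong_AE)
    then show "indicator {0<..<1} r * (P 0 r + (P 2 r + (P 4 r + P 6 r))) =
      (\<integral>\<^sup>+s. indicator polar_rect (r, s) * (ennreal r * F (r *\<^sub>R square_path s)) \<partial>lborel)"
      by (cases "r \<in> {0<..<1}") (simp_all add: indicator_times)
  qed
  also have "\<dots> = (\<integral>\<^sup>+q. indicator polar_rect q * (ennreal (fst q) * F (fst q *\<^sub>R square_path (snd q))) \<partial>lborel)"
    unfolding lborel_prod[symmetric] scaleR_prod_def
    by (subst lborel.nn_integral_fst[symmetric]) auto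
  finally show ?thesis .
qed

lemma measurable_scaled_square_path[measurable]:
  "(\<lambda>q. fst q *\<^sub>R square_path (snd q)) \<in> borel \<rightarrow>\<^sub>M (borel :: (real \<times> real) measure)"
proof -
  have [measurable]: "square_path \<in> borel \<rightarrow>\<^sub>M borel \<Otimes>\<^sub>M borel"
    by (simp add: borel_prod)
  show ?thesis
    unfolding borel_prod[symmetric] scaleR_prod_def by measurable
qed

text \<open>Read as an equality of measures, the identity for nonnegative functions says that area
  on the square is the image of \<open>r dr ds\<close>. In that form it passes to signed
  \<open>F\<close> by image and density rules, whatever the integrability of \<open>F\<close>. The
  16 comes from shrinking the square by 4 in both directions.\<close>

lemma integral_square_polar:
  fixes F :: "real \<times> real \<Rightarrow> real"
  assumes [measurable]: "F \<in> borel_measurable borel"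
  shows "(LINT p|lborel. indicator open_square (4 *\<^sub>R (p - c)) * F p) =
    (LINT q|lborel. indicator polar_rect q * (fst q / 16 * F (c + (fst q / 4) *\<^sub>R square_path (snd q))))"
proof -
  define M where "M = density lborel (\<lambda>q. indicator polar_rect q * ennreal (fst q))"
  let ?pol = "\<lambda>q. fst q *\<^sub>R square_path (snd q)"
  have [measurable]: "fst \<in> borel_measurable (borel :: (real \<times> real) measure)"
    "snd \<in> borel_measurable (borel :: (real \<times> real) measure)"
    by (simp_all add: borel_prod[symmetric])
  have [measurable]: "open_square \<in> sets borel" "polar_rect \<in> sets borel"
    by (simp_all add: borel_prod[symmetric])
  have eq: "density lborel (indicator open_square) = distr M borel ?pol"
  proof (rule measure_eqI)
    fix X assume "X \<in> sets (density (lborel :: (real \<times> real) measure) (indicator open_square))"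
    then have [measurable]: "X \<in> sets borel" by simp
    have "emeasure (density lborel (indicator open_square)) X = (\<integral>\<^sup>+p. indicator open_square p * indicator X p \<partial>lborel)"
      by (subst emeasure_density) auto
    also have "\<dots> = (\<integral>\<^sup>+q. indicator polar_rect q * (ennreal (fst q) * indicator X (?pol q)) \<partial>lborel)"
      by (rule nn_integral_square_polar) measurable
    also have "\<dots> = emeasure M (?pol -` X)"
      unfolding M_def using measurable_sets_borel[OF measurable_scaled_square_path, of X]
      by (subst emeasure_density) (auto simp: mult.assoc indicator_def intro!: nn_integral_cong)
    also have "\<dots> = emeasure (distr M borel ?pol) X"
      by (subst emeasure_distr) (auto simp: M_def)
    finally show "emeasure (density lborel (indicator open_square)) X = emeasure (distr M borel ?pol) X" .
  qed simp
  have "(LINT p|lborel. indicator open_square (4 *\<^sub>R (p - c)) * F p) =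
     (1/4)^2 * (LINT p|lborel. indicator open_square p * F (c + (1/4) *\<^sub>R p))"
    by (subst integral_lborel_affine[where c=c and \<rho>="1/4"]) (auto simp: power2_eq_square)
  also have "(LINT p|lborel. indicator open_square p * F (c + (1/4) *\<^sub>R p)) =
    integral\<^sup>L (density lborel (\<lambda>p. ennreal (indicator open_square p))) (\<lambda>p. F (c + (1/4) *\<^sub>R p))"
    by (subst integral_density) auto
  also have "\<dots> = integral\<^sup>L (distr M borel ?pol) (\<lambda>p. F (c + (1/4) *\<^sub>R p))"
    by (simp only: ennreal_indicator eq)
  also have "\<dots> = integral\<^sup>L M (\<lambda>q. F (c + (1/4) *\<^sub>R ?pol q))"
    by (subst integral_distr) (auto simp: M_def)
  also have "M = density lborel (\<lambda>q. ennreal (indicator polar_rect q * fst q))"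
    unfolding M_def by (intro arg_cong2[where f=density]) (auto simp: indicator_def)
  also have "integral\<^sup>L \<dots> (\<lambda>q. F (c + (1/4) *\<^sub>R ?pol q)) =
      (LINT q|lborel. (indicator polar_rect q * fst q) * F (c + (1/4) *\<^sub>R ?pol q))"
    by (subst integral_density) (auto simp: indicator_def)
  also have "(1/4)^2 * \<dots> = (LINT q|lborel. (1/4)^2 * ((indicator polar_rect q * fst q) * F (c + (1/4) *\<^sub>R ?pol q)))"
    by simp
  also have "\<dots> = (LINT q|lborel. indicator polar_rect q * (fst q / 16 * F (c + (fst q / 4) *\<^sub>R square_path (snd q))))"
    by (intro Bochner_Integration.integral_cong) (auto simp: power2_eq_square)
  finally show ?thesis .
qed

text \<open>Translation invariance on a circle of length 8, cut open at \<open>-1\<close>.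
  Periodicity is required only on the stretch that wraps around, because the formula for
  \<open>square_path\<close> is periodic only on a limited range.\<close>

lemma integral_circle_shift:
  fixes f :: "real \<times> real \<Rightarrow> real"
  assumes [measurable]: "f \<in> borel_measurable borel" and \<tau>: "0 \<le> \<tau>" "\<tau> \<le> 4"
    and M: "\<And>r s. 0 < r \<Longrightarrow> r < 1 \<Longrightarrow> -1 \<le> s \<Longrightarrow> s < 7 \<Longrightarrow> \<bar>f (r, s)\<bar> \<le> M"
    and per: "\<And>r s. 0 < r \<Longrightarrow> r < 1 \<Longrightarrow> -1 - \<tau> \<le> s \<Longrightarrow> s < -1 \<Longrightarrow> f (r, s + 8) = f (r, s)"
  shows "(LINT q|lborel. indicator polar_rect q * f (q - (0, \<tau>))) = (LINT q|lborel. indicator polar_rect q * f q)"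
proof -
  have M': "\<bar>f (r, s)\<bar> \<le> M" if "0 < r" "r < 1" "-1 - \<tau> \<le> s" "s < 7" for r s
    using M[of r s] M[of r "s + 8"] per[of r s] \<tau> that by (cases "s < -1") auto
  define g where "g a b q = indicator ({0<..<1} \<times> {a..<b}) q * f q" for a b q
  have [measurable]: "{0<..<1::real} \<times> {a..<b::real} \<in> sets borel" for a b
    by (simp add: borel_prod[symmetric])
  have [measurable]: "g a b \<in> borel_measurable borel" for a b
    unfolding g_def by measurable
  have gi: "integrable lborel (g a b)" if "-1 - \<tau> \<le> a" "b \<le> 7" for a b
    by (rule integrable_bounded_cbox[where a="(0, a)" and b="(1, b)" and M="\<bar>M\<bar>"])
       (use M' that in \<open>auto simp: g_def indicator_def cbox_Pair_eq intro: order_trans[OF M']\<close>)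
  have "(LINT q|lborel. indicator polar_rect q * f (q - (0, \<tau>))) = (LINT q|lborel. g (-1 - \<tau>) (7 - \<tau>) q)"
    by (subst integral_lborel_affine[where c="(0, \<tau>)" and \<rho>=1])
       (auto simp: g_def indicator_def intro!: Bochner_Integration.integral_cong)
  also have "\<dots> = (LINT q|lborel. g (-1 - \<tau>) (-1) q + g (-1) (7 - \<tau>) q)"
    using \<tau> by (intro Bochner_Integration.integral_cong) (auto simp: g_def indicator_def)
  also have "\<dots> = (LINT q|lborel. g (-1 - \<tau>) (-1) q) + (LINT q|lborel. g (-1) (7 - \<tau>) q)"
    using \<tau> by (intro Bochner_Integration.integral_add gi) auto
  \<comment> \<open>A period moves the part below \<open>-1\<close> onto the gap from
    \<open>7 - \<tau>\<close> to 7 that the shift leaves open.\<close>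
  also have "(LINT q|lborel. g (-1 - \<tau>) (-1) q) = (LINT q|lborel. g (7 - \<tau>) 7 q)"
    using \<tau> per by (subst (2) integral_lborel_affine[where c="(0, 8)" and \<rho>=1])
       (auto simp: g_def indicator_def add.commute intro!: Bochner_Integration.integral_cong)
  also have "\<dots> + (LINT q|lborel. g (-1) (7 - \<tau>) q) = (LINT q|lborel. g (7 - \<tau>) 7 q + g (-1) (7 - \<tau>) q)"
    using \<tau> by (intro Bochner_Integration.integral_add[symmetric] gi) auto
  also have "\<dots> = (LINT q|lborel. indicator polar_rect q * f q)"
    using \<tau> by (intro Bochner_Integration.integral_cong) (auto simp: g_def indicator_def)
  finally show ?thesis .
qed

section \<open>The flow of a single vortex\<close>

lemma measurable_fst_snd_borel[measurable]:
  "fst \<in> (borel :: ('a::second_countable_topology \<times> 'b::second_countable_topology) measure) \<rightarrow>\<^sub>M borel"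
  "snd \<in> (borel :: ('a::second_countable_topology \<times> 'b::second_countable_topology) measure) \<rightarrow>\<^sub>M borel"
  by (simp_all add: borel_prod[symmetric])

lemma borel_measurable_Pair_borel[measurable (raw)]:
  fixes f :: "'m \<Rightarrow> 'a::second_countable_topology" and g :: "'m \<Rightarrow> 'b::second_countable_topology"
  assumes "f \<in> M \<rightarrow>\<^sub>M borel" "g \<in> M \<rightarrow>\<^sub>M borel"
  shows "(\<lambda>x. (f x, g x)) \<in> M \<rightarrow>\<^sub>M borel"
  using assms by (simp add: borel_prod[symmetric])

lemma sets_Times_borel[measurable]:
  fixes A :: "'a::second_countable_topology set" and B :: "'b::second_countable_topology set"
  assumes "A \<in> sets borel" "B \<in> sets borel"
  shows "A \<times> B \<in> sets borel"
  using assms by (simp add: borel_prod[symmetric])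

lemma integral_lborel_iterated:
  fixes f :: "'a::euclidean_space \<times> 'b::euclidean_space \<Rightarrow> 'c::euclidean_space"
  assumes "integrable lborel f"
  shows "(LINT z|lborel. f z) = (LINT x|lborel. LINT y|lborel. f (x, y))"
  using lborel_pair.integral_fst'[of f] assms by (simp add: lborel_prod)

lemma norm_square_rotation_le: "norm (square_rotation p) \<le> norm p"
proof (cases p)
  case (Pair x y)
  have "norm (0::real, x) \<le> norm (x, y)" "norm (- y, 0::real) \<le> norm (x, y)"
    by (auto simp: norm_Pair)
  then show ?thesis by (auto simp: Pair square_rotation_def)
qed

lemma norm_swirl_le:
  assumes "norm p \<le> 2"
  shows "norm (1::real, 2 *\<^sub>R square_rotation p) \<le> 5"
proof -
  have "norm (1::real, 2 *\<^sub>R square_rotation p) \<le> norm (1::real) + norm (2 *\<^sub>R square_rotation p)"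
    by (rule norm_Pair_le)
  then show ?thesis using norm_square_rotation_le[of p] assms by simp
qed

lemma norm_open_square_le: "p \<in> open_square \<Longrightarrow> norm p \<le> 2"
  using norm_Pair_le[of "fst p" "snd p"] by (cases p) auto

lemma open_square_near:
  assumes "4 *\<^sub>R (p - c) \<in> open_square"
  shows "p \<in> cbox (c - (1, 1)) (c + (1, 1))"
  using assms by (cases p; cases c) (auto simp: cbox_Pair_eq)

text \<open>In the coordinates \<open>c + (r / 4) *\<^sub>R square_path s\<close> the flow of the vortex is the translation of \<open>s\<close>
  by \<open>8 t\<close>, which preserves the area element \<open>r / 16\<close>. At time \<open>1/2\<close> it has made half a turn.\<close>

lemma integral_vortex:
  fixes c :: "real \<times> real"
  assumes \<phi>: "C1_grad \<phi> G"
    and g[measurable]: "g \<in> borel_measurable borel" and K: "\<And>s. \<bar>g s\<bar> \<le> K"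
    and per: "\<And>s. -5 \<le> s \<Longrightarrow> s < -1 \<Longrightarrow> g (s + 8) = g s"
  defines "V \<equiv> \<lambda>z::real \<times> real \<times> real. (indicator {0..<1/2} (fst z) * indicator open_square (4 *\<^sub>R (snd z - c)) *
      g (square_angle (4 *\<^sub>R (snd z - c)) - 8 * fst z)) *\<^sub>R (1::real, 2 *\<^sub>R square_rotation (4 *\<^sub>R (snd z - c)))"
  shows "integrable lborel (\<lambda>z. V z \<bullet> G z)"
    and "(LINT z|lborel. V z \<bullet> G z) =
     (LINT p|lborel. indicator open_square (4 *\<^sub>R (p - c)) * (g (square_angle (4 *\<^sub>R (p - c)) - 4) * \<phi> (1/2, p))) -
     (LINT p|lborel. indicator open_square (4 *\<^sub>R (p - c)) * (g (square_angle (4 *\<^sub>R (p - c))) * \<phi> (0, p)))"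
proof -
  note [measurable] = C1_grad_measurable[OF \<phi>]
  have K0: "0 \<le> K" using K[of 0] by simp
  have Vm: "V \<in> borel_measurable borel"
    unfolding V_def by measurable
  show int: "integrable lborel (\<lambda>z. V z \<bullet> G z)"
  proof (rule integrable_inner_continuous[where M="K * 5" and a="(0, c - (1, 1))" and b="(1/2, c + (1, 1))", OF Vm _ _ C1_grad_continuous(2)[OF \<phi>]])
    fix z
    show "norm (V z) \<le> K * 5"
    proof (cases "4 *\<^sub>R (snd z - c) \<in> open_square")
      case True
      have "norm (V z) \<le> \<bar>g (square_angle (4 *\<^sub>R (snd z - c)) - 8 * fst z)\<bar> * norm (1::real, 2 *\<^sub>R square_rotation (4 *\<^sub>R (snd z - c)))"
        by (simp add: V_def indicator_def del: scaleR_Pair)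
      also have "\<dots> \<le> K * 5"
        by (intro mult_mono K norm_swirl_le norm_open_square_le True K0) simp
      finally show ?thesis .
    qed (use K0 in \<open>simp add: V_def\<close>)
    show "V z = 0" if "z \<notin> cbox (0, c - (1, 1)) (1/2, c + (1, 1))"
      using that open_square_near[of "snd z" c]
      by (cases z) (auto simp: V_def indicator_def cbox_Pair_eq simp del: scaleR_Pair)
  qed
  have "compact (G ` cball 0 (1 + norm c))"
    by (intro compact_continuous_image continuous_on_subset[OF C1_grad_continuous(2)[OF \<phi>]]) auto
  then obtain C where C: "\<And>z. norm z \<le> 1 + norm c \<Longrightarrow> norm (G z) \<le> C"
    by (fastforce dest: compact_imp_bounded simp: bounded_iff)
  have C0: "0 \<le> C" using C[of 0] by (auto intro: order_trans[OF norm_ge_zero])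
  define pol where "pol q = c + (fst q / 4) *\<^sub>R square_path (snd q)" for q
  \<comment> \<open>Labels \<open>q = (r, s)\<close> are the polar coordinates at time 0;
    \<open>f\<close> is the initial density times the area element, \<open>Z\<close> the position at
    time \<open>t\<close> and \<open>v\<close> the space-time velocity there.\<close>
  define f where "f q = indicator polar_rect q * (fst q / 16 * g (snd q))" for q
  define Z :: "real \<times> real \<times> real \<Rightarrow> real \<times> real \<times> real" where
    "Z z = (fst z, pol (fst (snd z), snd (snd z) + 8 * fst z))" for z
  define v :: "real \<times> real \<times> real \<Rightarrow> real \<times> real \<times> real" where
    "v z = (1, 2 *\<^sub>R square_rotation (fst (snd z) *\<^sub>R square_path (snd (snd z) + 8 * fst z)))" for z
  have [measurable]: "pol \<in> borel_measurable borel" unfolding pol_def by measurable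
  have [measurable]: "f \<in> borel_measurable borel" unfolding f_def by measurable
  have [measurable]: "Z \<in> borel_measurable borel" unfolding Z_def by measurable
  have [measurable]: "v \<in> borel_measurable borel" unfolding v_def by measurable
  \<comment> \<open>The angle can differ from the parameter only at corners, that is on finitely
    many null lines.\<close>
  have AE_angle: "AE q in lborel. q \<in> polar_rect \<longrightarrow> square_angle (4 *\<^sub>R (pol q - c)) = snd q"
    using AE_fst_snd_real(2)[of "-1"] AE_fst_snd_real(2)[of 1] AE_fst_snd_real(2)[of 3] AE_fst_snd_real(2)[of 5]
  proof eventually_elim
    case (elim q)
    then show ?case using square_angle_path[of "fst q" "snd q"] by (auto simp: pol_def)
  qed
  have nrm: "norm ((r / 4) *\<^sub>R square_path s) \<le> 1/2" "norm (r *\<^sub>R square_path s) \<le> 2"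
    if "0 \<le> r" "r \<le> 1" for r s
  proof -
    have "r * norm (square_path s) \<le> 1 * 2"
      using norm_square_path_le[of s] that by (intro mult_mono) auto
    then show "norm ((r / 4) *\<^sub>R square_path s) \<le> 1/2" "norm (r *\<^sub>R square_path s) \<le> 2"
      using that by auto
  qed
  have nrmZ: "norm (t, pol (r, s)) \<le> 1 + norm c" if "0 \<le> t" "t \<le> 1/2" "0 \<le> r" "r \<le> 1" for t r s :: real
  proof -
    have "norm (t, pol (r, s)) \<le> norm t + norm (pol (r, s))" by (rule norm_Pair_le)
    moreover have "norm (pol (r, s)) \<le> norm c + norm ((r / 4) *\<^sub>R square_path s)"
      unfolding pol_def fst_conv snd_conv by (rule norm_triangle_ineq)
    ultimately show ?thesis using nrm[of r s] that by simp
  qed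
  have Db: "\<bar>G (t, pol (r, s)) \<bullet> (1, 2 *\<^sub>R square_rotation (r *\<^sub>R square_path s))\<bar> \<le> C * 5"
    if "0 \<le> t" "t \<le> 1/2" "0 \<le> r" "r \<le> 1" for t r s :: real
  proof -
    have "\<bar>G (t, pol (r, s)) \<bullet> (1, 2 *\<^sub>R square_rotation (r *\<^sub>R square_path s))\<bar> \<le>
      norm (G (t, pol (r, s))) * norm (1::real, 2 *\<^sub>R square_rotation (r *\<^sub>R square_path s))"
      by (rule Cauchy_Schwarz_ineq2)
    also have "\<dots> \<le> C * 5"
      by (intro mult_mono C nrmZ norm_swirl_le nrm that C0) simp
    finally show ?thesis .
  qed
  have "compact (\<phi> ` cball 0 (1 + norm c))"
    by (intro compact_continuous_image continuous_on_subset[OF C1_grad_continuous(1)[OF \<phi>]]) auto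
  then obtain L where L: "\<And>z. norm z \<le> 1 + norm c \<Longrightarrow> \<bar>\<phi> z\<bar> \<le> L"
    by (fastforce dest: compact_imp_bounded simp: bounded_iff)
  have fb: "\<bar>f q\<bar> \<le> K" for q
  proof (cases "q \<in> polar_rect")
    case True
    then have "\<bar>fst q / 16\<bar> * \<bar>g (snd q)\<bar> \<le> 1 * K" by (intro mult_mono K) auto
    with True show ?thesis by (simp add: f_def abs_mult)
  qed (simp add: f_def K0)
  have bound: "\<bar>f q * (G (Z (t, q)) \<bullet> v (t, q))\<bar> \<le> K * (C * 5)" if "t \<in> {0..1/2}" "q \<in> cbox (0, -1) (1, 7)" for t q
    using that unfolding abs_mult Z_def v_def
    by (cases q) (auto simp: cbox_Pair_eq intro!: mult_mono fb Db K0)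
  have supp: "f q = 0" if "q \<notin> cbox (0, -1) (1, 7)" for q
    using that by (cases q) (auto simp: f_def cbox_Pair_eq indicator_def)
  define B where "B z = indicator {0..<1/2} (fst z) * (f (snd z) * (G (Z z) \<bullet> v z))" for z
  have [measurable]: "B \<in> borel_measurable borel" unfolding B_def by measurable
  have Bint: "integrable lborel B"
  proof (rule integrable_bounded_cbox[where a="(0, 0, -1)" and b="(1/2, 1, 7)" and M="K * (C * 5)"])
    fix z :: "real \<times> real \<times> real"
    show "norm (B z) \<le> K * (C * 5)" if "z \<in> cbox (0, 0, - 1) (1 / 2, 1, 7)"
      using that bound[of "fst z" "snd z"] K0 C0 by (cases z) (auto simp: B_def indicator_def cbox_Pair_eq)
    show "B z = 0" if "z \<notin> cbox (0, 0, - 1) (1 / 2, 1, 7)"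
      using that supp[of "snd z"] by (cases z) (auto simp: B_def indicator_def cbox_Pair_eq)
  qed simp
  \<comment> \<open>At a fixed time the integral over positions becomes an integral over labels:
    polar coordinates first, then a turn back by \<open>8 t\<close> around the circle.\<close>
  have inner: "(LINT p|lborel. V (t, p) \<bullet> G (t, p)) = (LINT q|lborel. B (t, q))" for t
  proof (cases "t \<in> {0..<1/2}")
    case t: True
    define D where "D p = G (t, p) \<bullet> (1, 2 *\<^sub>R square_rotation (4 *\<^sub>R (p - c)))" for p
    have [measurable]: "D \<in> borel_measurable borel" unfolding D_def by measurable
    define h where "h q = fst q / 16 * (g (snd q) * D (pol (fst q, snd q + 8 * t)))" for q
    have [measurable]: "h \<in> borel_measurable borel" unfolding h_def by measurable
    have Dpol: "D (pol (r, s)) = G (t, pol (r, s)) \<bullet> (1, 2 *\<^sub>R square_rotation (r *\<^sub>R square_path s))" for r s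
      by (simp add: D_def pol_def)
    have "(LINT p|lborel. V (t, p) \<bullet> G (t, p)) =
      (LINT p|lborel. indicator open_square (4 *\<^sub>R (p - c)) * (g (square_angle (4 *\<^sub>R (p - c)) - 8 * t) * D p))"
      using t by (intro Bochner_Integration.integral_cong)
        (auto simp: V_def D_def inner_commute indicator_def simp del: scaleR_Pair)
    also have "\<dots> = (LINT q|lborel. indicator polar_rect q *
        (fst q / 16 * (g (square_angle (4 *\<^sub>R (pol q - c)) - 8 * t) * D (pol q))))"
      unfolding pol_def by (rule integral_square_polar) measurable
    also have "\<dots> = (LINT q|lborel. indicator polar_rect q * h (q - (0, 8 * t)))"
    proof (rule integral_cong_AE)
      show "AE q in lborel. indicator polar_rect q *
        (fst q / 16 * (g (square_angle (4 *\<^sub>R (pol q - c)) - 8 * t) * D (pol q))) =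
        indicator polar_rect q * h (q - (0, 8 * t))"
        using AE_angle
      proof eventually_elim
        case (elim q)
        then show ?case by (auto simp: h_def indicator_def)
      qed
    qed measurable
    also have "\<dots> = (LINT q|lborel. indicator polar_rect q * h q)"
    proof (rule integral_circle_shift[where M="K * (C * 5)"])
      fix r s :: real assume r: "0 < r" "r < 1"
      have "\<bar>r / 16\<bar> * (\<bar>g s\<bar> * \<bar>D (pol (r, s + 8 * t))\<bar>) \<le> 1 * (K * (C * 5))"
        unfolding Dpol using r t by (intro mult_mono K Db) (auto simp: K0)
      then show "\<bar>h (r, s)\<bar> \<le> K * (C * 5)" by (simp add: h_def abs_mult)
      assume s: "-1 - 8 * t \<le> s" "s < -1"
      \<comment> \<open>Here \<open>s + 8 t\<close> lies between \<open>-1\<close> and 3, the range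
        in which the periodicity of the formula is available.\<close>
      have "square_path (s + 8 * t + 8) = square_path (s + 8 * t)"
        using t s by (intro square_path_periodic) auto
      moreover have "g (s + 8) = g s" using s t by (intro per) auto
      ultimately show "h (r, s + 8) = h (r, s)" by (simp add: h_def pol_def algebra_simps)
    qed (use t in auto)
    also have "\<dots> = (LINT q|lborel. B (t, q))"
      using t by (intro Bochner_Integration.integral_cong)
        (auto simp: B_def f_def h_def Dpol Z_def v_def)
    finally show ?thesis .
  qed (simp add: V_def B_def del: scaleR_Pair)
  have "(LINT z|lborel. V z \<bullet> G z) = (LINT t|lborel. LINT p|lborel. V (t, p) \<bullet> G (t, p))"
    by (rule integral_lborel_iterated[OF int])
  also have "\<dots> = (LINT t|lborel. LINT q|lborel. B (t, q))"
    by (simp only: inner)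
  also have "\<dots> = (LINT z|lborel. B z)"
    by (rule integral_lborel_iterated[OF Bint, symmetric])
  also have "\<dots> = (LINT q|lborel. f q * (\<phi> (Z (1/2, q)) - \<phi> (Z (0, q))))"
    unfolding B_def
  \<comment> \<open>The exceptional times are those at which the path with initial angle
    \<open>snd q\<close> passes a corner.\<close>
  proof (rule integral_along_paths[OF \<phi>, where N="\<lambda>q. (\<lambda>k. (k - snd q) / 8) ` {1, 3, 5, 7, 9}"])
    fix q t assume q: "f q \<noteq> 0" and t: "t \<in> {0<..<1/2} - (\<lambda>k. (k - snd q) / 8) ` {1, 3, 5, 7, 9}"
    define s where "s = snd q + 8 * t"
    have r: "0 < fst q" "-1 \<le> snd q" "snd q < 7"
      using q by (auto simp: f_def indicator_def split: if_splits)
    have s: "-1 < s" "s < 11" "s \<notin> {1, 3, 5, 7, 9}"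
      using r t by (auto simp: s_def field_simps image_iff)
    have "((\<lambda>t. snd q + 8 * t) has_vector_derivative 8) (at t)"
      by (auto intro!: derivative_eq_intros)
    from vector_diff_chain_at[OF this square_path_deriv[OF s, unfolded s_def]]
    have d: "((\<lambda>t. square_path (snd q + 8 * t)) has_vector_derivative
        8 *\<^sub>R square_rotation (square_path s)) (at t)"
      by (simp add: o_def s_def)
    from has_vector_derivative_add[OF has_vector_derivative_const[of c]
        bounded_linear.has_vector_derivative[OF bounded_linear_scaleR_right[of "fst q / 4"] d]]
    have "((\<lambda>t. (t, c + (fst q / 4) *\<^sub>R square_path (snd q + 8 * t))) has_vector_derivative
        (1, (fst q / 4) *\<^sub>R (8 *\<^sub>R square_rotation (square_path s)))) (at t)"
      by (intro has_vector_derivative_Pair has_vector_derivative_id) simp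
    \<comment> \<open>Parameter speed 8 on a square scaled by \<open>r / 4\<close> gives velocity
      \<open>2 r\<close> times the rotation: this is the origin of the factor 2 in the
      field.\<close>
    then show "((\<lambda>t. Z (t, q)) has_vector_derivative v (t, q)) (at t)"
      using r by (simp add: Z_def v_def pol_def square_rotation_scale s_def)
  next
    fix q :: "real \<times> real"
    have "continuous_on UNIV (\<lambda>t. square_path (snd q + 8 * t))"
      by (rule continuous_on_compose2[OF continuous_on_square_path[of UNIV]]) (auto intro!: continuous_intros)
    then show "continuous_on {0..1/2} (\<lambda>t. Z (t, q))"
      unfolding Z_def pol_def
      by (auto intro!: continuous_intros intro: continuous_on_subset)
  qed ((rule bound supp; assumption) | simp)+
  also have "\<dots> = (LINT q|lborel. f q * \<phi> (Z (1/2, q)) - f q * \<phi> (Z (0, q)))"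
    by (simp add: right_diff_distrib)
  also have "\<dots> = (LINT q|lborel. f q * \<phi> (Z (1/2, q))) - (LINT q|lborel. f q * \<phi> (Z (0, q)))"
  proof -
    have "integrable lborel (\<lambda>q. f q * \<phi> (Z (t, q)))" if t: "0 \<le> t" "t \<le> 1/2" for t
    proof (rule integrable_bounded_cbox[where a="(0, -1)" and b="(1, 7)" and M="K * L"])
      fix q :: "real \<times> real" assume "q \<in> cbox (0, - 1) (1, 7)"
      then show "norm (f q * \<phi> (Z (t, q))) \<le> K * L"
        unfolding real_norm_def abs_mult using t
        by (intro mult_mono fb L) (cases q; auto simp: K0 cbox_Pair_eq Z_def intro!: nrmZ)+
    qed (simp_all add: supp)
    then show ?thesis by (intro Bochner_Integration.integral_diff) auto
  qed
  also have "(LINT q|lborel. f q * \<phi> (Z (0, q))) =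
    (LINT q|lborel. indicator polar_rect q * (fst q / 16 * (g (square_angle (4 *\<^sub>R (pol q - c))) * \<phi> (0, pol q))))"
  proof (rule integral_cong_AE)
    show "AE q in lborel. f q * \<phi> (Z (0, q)) =
      indicator polar_rect q * (fst q / 16 * (g (square_angle (4 *\<^sub>R (pol q - c))) * \<phi> (0, pol q)))"
      using AE_angle
    proof eventually_elim
      case (elim q)
      then show ?case by (auto simp: f_def Z_def indicator_def)
    qed
  qed measurable
  also have "\<dots> = (LINT p|lborel. indicator open_square (4 *\<^sub>R (p - c)) * (g (square_angle (4 *\<^sub>R (p - c))) * \<phi> (0, p)))"
    unfolding pol_def by (rule integral_square_polar[symmetric]) measurable
  \<comment> \<open>At the final time the angle has advanced by \<open>8 / 2 = 4\<close>; the same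
    shift of labels is undone.\<close>
  also have "(LINT q|lborel. f q * \<phi> (Z (1/2, q))) =
    (LINT p|lborel. indicator open_square (4 *\<^sub>R (p - c)) * (g (square_angle (4 *\<^sub>R (p - c)) - 4) * \<phi> (1/2, p)))"
  proof -
    define h where "h q = fst q / 16 * (g (snd q) * \<phi> (1/2, pol (fst q, snd q + 4)))" for q
    have [measurable]: "h \<in> borel_measurable borel" unfolding h_def by measurable
    have "(LINT q|lborel. f q * \<phi> (Z (1/2, q))) = (LINT q|lborel. indicator polar_rect q * h q)"
      by (simp add: f_def h_def Z_def mult.assoc)
    also have "\<dots> = (LINT q|lborel. indicator polar_rect q * h (q - (0, 4)))"
    proof (rule integral_circle_shift[where M="K * L", symmetric])
      fix r s :: real assume r: "0 < r" "r < 1"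
      have "\<bar>r / 16\<bar> * (\<bar>g s\<bar> * \<bar>\<phi> (1/2, pol (r, s + 4))\<bar>) \<le> 1 * (K * L)"
        using r by (intro mult_mono K L nrmZ) (auto simp: K0)
      then show "\<bar>h (r, s)\<bar> \<le> K * L" by (simp add: h_def abs_mult)
      assume s: "-1 - 4 \<le> s" "s < -1"
      have "square_path (s + 4 + 8) = square_path (s + 4)"
        using s by (intro square_path_periodic) auto
      moreover have "g (s + 8) = g s" using s by (intro per) auto
      ultimately show "h (r, s + 8) = h (r, s)" by (simp add: h_def pol_def algebra_simps)
    qed auto
    also have "\<dots> = (LINT q|lborel. indicator polar_rect q *
        (fst q / 16 * (g (square_angle (4 *\<^sub>R (pol q - c)) - 4) * \<phi> (1/2, pol q))))"
    proof (rule integral_cong_AE)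
      show "AE q in lborel. indicator polar_rect q * h (q - (0, 4)) = indicator polar_rect q *
        (fst q / 16 * (g (square_angle (4 *\<^sub>R (pol q - c)) - 4) * \<phi> (1/2, pol q)))"
        using AE_angle
      proof eventually_elim
        case (elim q)
        then show ?case by (auto simp: h_def indicator_def)
      qed
    qed measurable
    also have "\<dots> = (LINT p|lborel. indicator open_square (4 *\<^sub>R (p - c)) * (g (square_angle (4 *\<^sub>R (p - c)) - 4) * \<phi> (1/2, p)))"
      unfolding pol_def by (rule integral_square_polar[symmetric]) measurable
    finally show ?thesis .
  qed
  finally show "(LINT z|lborel. V z \<bullet> G z) =
     (LINT p|lborel. indicator open_square (4 *\<^sub>R (p - c)) * (g (square_angle (4 *\<^sub>R (p - c)) - 4) * \<phi> (1/2, p))) -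
     (LINT p|lborel. indicator open_square (4 *\<^sub>R (p - c)) * (g (square_angle (4 *\<^sub>R (p - c))) * \<phi> (0, p)))" .
qed

section \<open>One mixing step\<close>

abbreviation "unit_square \<equiv> {0..<1::real} \<times> {0..<1::real}"

definition stripe :: "real \<times> real \<Rightarrow> real" where
  "stripe p = (if fst p < 1/2 then 1 else -1)"

definition finer_stripe :: "real \<times> real \<Rightarrow> real" where
  "finer_stripe p = (if frac (2 * fst p) < 1/2 then 1 else -1)"

text \<open>The initial density as a function of the angle: angles between 2 and 6 form the left
  half of a vortex. The clause \<open>s < -2\<close> is the same set one period earlier; angles
  above \<open>-1\<close> turned back by at most 4 stay above \<open>-5\<close>, so it can be left
  open below.\<close>

definition rotor_sign :: "real \<Rightarrow> real" where
  "rotor_sign s = (if 2 < s \<and> s < 6 \<or> s < -2 then 1 else -1)"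

text \<open>The vortices are centred at \<open>(1/2, 1/4)\<close> and \<open>(1/2, 3/4)\<close> and have side \<open>1/2\<close>; \<open>cell_local\<close> gives
  the coordinates relative to the nearest of them, with the vortex scaled to \<open>(-1, 1)\<^sup>2\<close>.\<close>

definition cell_local :: "real \<times> real \<Rightarrow> real \<times> real" where
  "cell_local p = (4 * fst p - 2, if snd p < 1/2 then 4 * snd p - 1 else 4 * snd p - 3)"

text \<open>The condition singles out the two middle quarters, the only part that moves. There the
  density is the initial one at the angle turned back by \<open>8 t\<close>.\<close>

definition cell_density :: "real \<times> real \<times> real \<Rightarrow> real" where
  "cell_density z = (if \<bar>fst (cell_local (snd z))\<bar> < 1
     then rotor_sign (square_angle (cell_local (snd z)) - 8 * fst z) else stripe (snd z))"

definition cell_field :: "real \<times> real \<times> real \<Rightarrow> real \<times> real" where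
  "cell_field z = (if \<bar>fst (cell_local (snd z))\<bar> < 1 then 2 *\<^sub>R square_rotation (cell_local (snd z)) else 0)"

lemma measurable_cell[measurable]:
  "stripe \<in> borel_measurable borel" "finer_stripe \<in> borel_measurable borel"
  "rotor_sign \<in> borel_measurable borel" "cell_local \<in> borel_measurable borel"
  "cell_density \<in> borel_measurable borel" "cell_field \<in> borel_measurable borel"
proof -
  show [measurable]: "stripe \<in> borel_measurable borel" "rotor_sign \<in> borel_measurable borel"
    "cell_local \<in> borel_measurable borel"
    unfolding stripe_def rotor_sign_def cell_local_def by measurable
  show "finer_stripe \<in> borel_measurable borel"
    unfolding finer_stripe_def frac_def by measurable
  show "cell_density \<in> borel_measurable borel" "cell_field \<in> borel_measurable borel"
    unfolding cell_density_def cell_field_def by measurable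
qed

lemma square_angle_range:
  "fst P < 0 \<Longrightarrow> 2 < square_angle P \<and> square_angle P < 6"
  "0 < fst P \<Longrightarrow> -1 < square_angle P \<and> square_angle P < 2 \<or> 6 < square_angle P \<and> square_angle P \<le> 7"
  "fst P = 0 \<Longrightarrow> square_angle P = 2 \<or> square_angle P = 6"
proof -
  obtain X Y where P: "P = (X, Y)" by (cases P)
  have "(X < 0 \<longrightarrow> 2 < square_angle P \<and> square_angle P < 6) \<and>
    (0 < X \<longrightarrow> -1 < square_angle P \<and> square_angle P < 2 \<or> 6 < square_angle P \<and> square_angle P \<le> 7) \<and>
    (X = 0 \<longrightarrow> square_angle P = 2 \<or> square_angle P = 6)"
  proof -
    consider "\<bar>Y\<bar> < X" | "\<not> \<bar>Y\<bar> < X" "\<bar>X\<bar> \<le> Y" "0 < Y" | "\<not> \<bar>Y\<bar> < X" "\<not> (\<bar>X\<bar> \<le> Y \<and> 0 < Y)" "\<bar>Y\<bar> < - X"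
      | "\<not> \<bar>Y\<bar> < X" "\<not> (\<bar>X\<bar> \<le> Y \<and> 0 < Y)" "\<not> \<bar>Y\<bar> < - X" by blast
    then show ?thesis
    proof cases
      case 1
      define \<theta> where "\<theta> = Y / X"
      have "square_angle P = \<theta>" using 1 by (simp add: P square_angle_def \<theta>_def)
      moreover have "-1 < \<theta>" "\<theta> < 1" using 1 by (auto simp: field_simps \<theta>_def)
      ultimately show ?thesis using 1 by auto
    next
      case 2
      define \<theta> where "\<theta> = X / Y"
      have "square_angle P = 2 - \<theta>" using 2 by (simp add: P square_angle_def \<theta>_def)
      moreover have "-1 \<le> \<theta>" "\<theta> \<le> 1" "\<theta> < 0 \<longleftrightarrow> X < 0" "0 < \<theta> \<longleftrightarrow> 0 < X"
        using 2 by (auto simp: field_simps \<theta>_def)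
      ultimately show ?thesis by auto
    next
      case 3
      define \<theta> where "\<theta> = Y / X"
      have "square_angle P = 4 + \<theta>" using 3 by (auto simp: P square_angle_def \<theta>_def)
      moreover have "-1 < \<theta>" "\<theta> < 1" using 3 by (auto simp: field_simps \<theta>_def)
      ultimately show ?thesis using 3 by auto
    next
      case 4
      define \<theta> where "\<theta> = X / Y"
      have a: "square_angle P = 6 - \<theta>" using 4 by (auto simp: P square_angle_def \<theta>_def)
      have "X = 0 \<and> Y = 0 \<or> \<bar>X\<bar> \<le> - Y \<and> Y < 0" using 4 by linarith
      then have "-1 \<le> \<theta>" "\<theta> \<le> 1" "\<theta> < 0 \<longleftrightarrow> 0 < X" "0 < \<theta> \<longleftrightarrow> X < 0"
        by (auto simp: field_simps \<theta>_def)
      with a show ?thesis by auto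
    qed
  qed
  then show "fst P < 0 \<Longrightarrow> 2 < square_angle P \<and> square_angle P < 6"
    "0 < fst P \<Longrightarrow> -1 < square_angle P \<and> square_angle P < 2 \<or> 6 < square_angle P \<and> square_angle P \<le> 7"
    "fst P = 0 \<Longrightarrow> square_angle P = 2 \<or> square_angle P = 6"
    by (auto simp: P)
qed

text \<open>A shift by 4 is half a turn and exchanges the left and right halves of a vortex. This is
  the swap of the middle quarters.\<close>

lemma rotor_sign_angle:
  "rotor_sign (square_angle P) = (if fst P < 0 then 1 else -1)"
  "rotor_sign (square_angle P - 4) = (if 0 < fst P then 1 else -1)"
  using square_angle_range[of P]
  by (cases "fst P" "0 :: real" rule: linorder_cases; force simp: rotor_sign_def)+

text \<open>Transport along constant paths. It accounts for the outer quarters of a cell and, later,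
  for the constant flux that is subtracted to isolate \<open>(0, b)\<close>.\<close>

lemma integral_static:
  fixes f :: "real \<times> real \<Rightarrow> real"
  assumes \<phi>: "C1_grad \<phi> G" and [measurable]: "f \<in> borel_measurable borel"
    and fK: "\<And>p. \<bar>f p\<bar> \<le> K" and f0: "\<And>p. p \<notin> cbox (0, 0) (1, 1) \<Longrightarrow> f p = 0"
  defines "W3 \<equiv> \<lambda>z::real \<times> real \<times> real. (indicator {0..<1/2} (fst z) * f (snd z)) *\<^sub>R (1::real, 0::real \<times> real)"
  shows "integrable lborel (\<lambda>z. W3 z \<bullet> G z)"
    and "(LINT z|lborel. W3 z \<bullet> G z) = (LINT p|lborel. f p * \<phi> (1/2, p)) - (LINT p|lborel. f p * \<phi> (0, p))"
proof -
  note [measurable] = C1_grad_measurable[OF \<phi>]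
  have K0: "0 \<le> K" using fK[of 0] by linarith
  have cont: "continuous_on UNIV (\<lambda>p. \<phi> (t, p))" for t
    by (rule continuous_on_compose2[OF C1_grad_continuous(1)[OF \<phi>]]) (auto intro!: continuous_intros)
  have iff0: "integrable lborel (\<lambda>p. f p * \<phi> (t, p))" for t
    using integrable_inner_continuous[of f K "(0, 0)" "(1, 1)" "\<lambda>p. \<phi> (t, p)"] cont fK f0 by simp
  have [measurable]: "W3 \<in> borel_measurable borel" unfolding W3_def by measurable
  show "integrable lborel (\<lambda>z. W3 z \<bullet> G z)"
  proof (rule integrable_inner_continuous[where M=K and a="(0, 0, 0)" and b="(1/2, 1, 1)"])
    show "norm (W3 z) \<le> K" for z
      using fK[of "snd z"] K0 by (simp add: W3_def indicator_def norm_Pair)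
    show "W3 z = 0" if "z \<notin> cbox (0, 0, 0) (1/2, 1, 1)" for z
      using that f0[of "snd z"] by (cases z) (auto simp: W3_def cbox_Pair_eq indicator_def zero_prod_def)
  qed (simp_all add: C1_grad_continuous(2)[OF \<phi>])
  have "(LINT z|lborel. W3 z \<bullet> G z) = (LINT z|lborel. indicator {0..<1/2} (fst z) * (f (snd z) * (G (id z) \<bullet> (1, 0))))"
    by (intro Bochner_Integration.integral_cong) (auto simp: W3_def inner_prod_def)
  also have "\<dots> = (LINT p|lborel. f p * (\<phi> (id (1/2, p)) - \<phi> (id (0, p))))"
  proof -
    have "compact (G ` cbox (0, 0, 0) (1/2, 1, 1))"
      by (intro compact_continuous_image continuous_on_subset[OF C1_grad_continuous(2)[OF \<phi>]]) auto
    then obtain C where C: "\<And>z. z \<in> cbox (0, 0, 0) (1/2, 1, 1) \<Longrightarrow> norm (G z) \<le> C"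
      by (fastforce dest: compact_imp_bounded simp: bounded_iff)
    show ?thesis
    proof (rule integral_along_paths[OF \<phi>, where N="\<lambda>_. {}" and v="\<lambda>_. (1, 0)" and a="(0, 0)" and b="(1, 1)" and M="K * C"])
      fix t :: real and q :: "real \<times> real" assume "t \<in> {0..1/2}" "q \<in> cbox (0, 0) (1, 1)"
      then have "norm (G (t, q)) \<le> C" by (intro C) (cases q; auto simp: cbox_Pair_eq)
      moreover have "\<bar>G (t, q) \<bullet> (1, 0)\<bar> \<le> norm (G (t, q)) * norm (1::real, 0::real \<times> real)"
        by (rule Cauchy_Schwarz_ineq2)
      ultimately have "\<bar>G (t, q) \<bullet> (1, 0)\<bar> \<le> C" by (simp add: norm_Pair)
      then show "\<bar>f q * (G (id (t, q)) \<bullet> (1, 0))\<bar> \<le> K * C"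
        using fK[of q] K0 unfolding abs_mult by (intro mult_mono) auto
    next
      fix t :: real and q :: "real \<times> real"
      show "((\<lambda>t. id (t, q)) has_vector_derivative (1, 0)) (at t)"
        by (auto intro!: has_vector_derivative_Pair has_vector_derivative_id)
      show "continuous_on {0..1/2} (\<lambda>t. id (t, q))"
        by (auto intro!: continuous_intros)
    qed (use f0 in \<open>auto intro!: continuous_intros has_vector_derivative_Pair has_vector_derivative_id\<close>)
  qed
  also have "\<dots> = (LINT p|lborel. f p * \<phi> (1/2, p)) - (LINT p|lborel. f p * \<phi> (0, p))"
    by (simp add: right_diff_distrib Bochner_Integration.integral_diff[OF iff0 iff0])
  finally show "(LINT z|lborel. W3 z \<bullet> G z) = (LINT p|lborel. f p * \<phi> (1/2, p)) - (LINT p|lborel. f p * \<phi> (0, p))" .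
qed

text \<open>A flow transports every function \<open>H\<close> of the density. The cell consists of
  two vortices and a resting part; half a turn changes \<open>stripe\<close> into
  \<open>finer_stripe\<close>.\<close>

lemma integral_cell:
  fixes H :: "real \<Rightarrow> real"
  assumes \<phi>: "C1_grad \<phi> G" and [measurable]: "H \<in> borel_measurable borel"
  defines "V \<equiv> \<lambda>z::real \<times> real \<times> real. (indicator ({0..<1/2} \<times> unit_square) z * H (cell_density z)) *\<^sub>R (1::real, cell_field z)"
  shows "integrable lborel (\<lambda>z. V z \<bullet> G z)"
    and "(LINT z|lborel. V z \<bullet> G z) =
     (LINT p|lborel. indicator unit_square p * (H (finer_stripe p) * \<phi> (1/2, p))) -
     (LINT p|lborel. indicator unit_square p * (H (stripe p) * \<phi> (0, p)))"
proof -
  note [measurable] = C1_grad_measurable[OF \<phi>]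
  define K where "K = \<bar>H 1\<bar> + \<bar>H (-1)\<bar>"
  have K0: "0 \<le> K" by (simp add: K_def)
  have KS: "\<bar>H (stripe p)\<bar> \<le> K" "\<bar>H (rotor_sign s)\<bar> \<le> K" for p s
    by (auto simp: stripe_def rotor_sign_def K_def)
  define g where "g s = H (rotor_sign s)" for s
  have [measurable]: "g \<in> borel_measurable borel" unfolding g_def by measurable
  define c1 c2 :: "real \<times> real" where "c1 = (1/2, 1/4)" and "c2 = (1/2, 3/4)"
  define W where "W c z = (indicator {0..<1/2} (fst z) * indicator open_square (4 *\<^sub>R (snd z - c)) *
      g (square_angle (4 *\<^sub>R (snd z - c)) - 8 * fst z)) *\<^sub>R (1::real, 2 *\<^sub>R square_rotation (4 *\<^sub>R (snd z - c)))"
    for c and z :: "real \<times> real \<times> real"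
  define W1 where "W1 c p = indicator open_square (4 *\<^sub>R (p - c)) * g (square_angle (4 *\<^sub>R (p - c)) - 4)"
    for c :: "real \<times> real" and p
  define W0 where "W0 c p = indicator open_square (4 *\<^sub>R (p - c)) * g (square_angle (4 *\<^sub>R (p - c)))"
    for c :: "real \<times> real" and p
  have [measurable]: "W c \<in> borel_measurable borel" "W0 c \<in> borel_measurable borel" "W1 c \<in> borel_measurable borel" for c
    unfolding W_def W0_def W1_def by measurable
  have Wint: "integrable lborel (\<lambda>z. W c z \<bullet> G z)"
    and Weq: "(LINT z|lborel. W c z \<bullet> G z) = (LINT p|lborel. W1 c p * \<phi> (1/2, p)) - (LINT p|lborel. W0 c p * \<phi> (0, p))" for c
  proof -
    have per: "g (s + 8) = g s" if "-5 \<le> s" "s < -1" for s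
      using that by (auto simp: g_def rotor_sign_def)
    have gm: "g \<in> borel_measurable borel" by measurable
    have gK: "\<bar>g s\<bar> \<le> K" for s by (simp add: g_def KS)
    show "integrable lborel (\<lambda>z. W c z \<bullet> G z)"
      "(LINT z|lborel. W c z \<bullet> G z) = (LINT p|lborel. W1 c p * \<phi> (1/2, p)) - (LINT p|lborel. W0 c p * \<phi> (0, p))"
      using integral_vortex[OF \<phi> gm gK per, of c] unfolding W_def W1_def W0_def mult.assoc by simp_all
  qed
  \<comment> \<open>The two outer quarters, at rest.\<close>
  define R where "R = {p \<in> unit_square. 1 \<le> \<bar>4 * fst p - 2\<bar>}"
  have [measurable]: "R \<in> sets borel" unfolding R_def by measurable
  define f where "f p = indicator R p * H (stripe p)" for p
  have [measurable]: "f \<in> borel_measurable borel" unfolding f_def by measurable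
  have f0: "f p = 0" if "p \<notin> cbox (0, 0) (1, 1)" for p
    using that by (cases p) (auto simp: f_def R_def cbox_Pair_eq indicator_def)
  have fK: "\<bar>f p\<bar> \<le> K" for p using KS K0 by (simp add: f_def indicator_def)
  have cont: "continuous_on UNIV (\<lambda>p. \<phi> (t, p))" for t
    by (rule continuous_on_compose2[OF C1_grad_continuous(1)[OF \<phi>]]) (auto intro!: continuous_intros)
  have W_out: "indicator open_square (4 *\<^sub>R (p - c)) = (0::real)" if "p \<notin> cbox (c - (1, 1)) (c + (1, 1))"
    for p c :: "real \<times> real"
    using open_square_near[of p c] that by (auto simp: indicator_def)
  have i1: "integrable lborel (\<lambda>p. W1 c p * \<phi> (t, p))" for c t
  proof -
    have "integrable lborel (\<lambda>p. W1 c p \<bullet> \<phi> (t, p))"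
    proof (rule integrable_inner_continuous[OF _ _ _ cont])
      show "norm (W1 c p) \<le> K" for p
        by (cases "4 *\<^sub>R (p - c) \<in> open_square") (simp_all add: W1_def g_def KS K0)
      show "W1 c p = 0" if "p \<notin> cbox (c - (1, 1)) (c + (1, 1))" for p
        using W_out[OF that] by (simp add: W1_def)
    qed simp
    then show ?thesis by simp
  qed
  have i0: "integrable lborel (\<lambda>p. W0 c p * \<phi> (t, p))" for c t
  proof -
    have "integrable lborel (\<lambda>p. W0 c p \<bullet> \<phi> (t, p))"
    proof (rule integrable_inner_continuous[OF _ _ _ cont])
      show "norm (W0 c p) \<le> K" for p
        by (cases "4 *\<^sub>R (p - c) \<in> open_square") (simp_all add: W0_def g_def KS K0)
      show "W0 c p = 0" if "p \<notin> cbox (c - (1, 1)) (c + (1, 1))" for p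
        using W_out[OF that] by (simp add: W0_def)
    qed simp
    then show ?thesis by simp
  qed
  have iff0: "integrable lborel (\<lambda>p. f p * \<phi> (t, p))" for t
    using integrable_inner_continuous[of f K "(0, 0)" "(1, 1)" "\<lambda>p. \<phi> (t, p)"] cont fK f0 by simp
  define W3 where "W3 z = (indicator {0..<1/2} (fst z) * f (snd z)) *\<^sub>R (1::real, 0::real \<times> real)"
    for z :: "real \<times> real \<times> real"
  have [measurable]: "W3 \<in> borel_measurable borel" unfolding W3_def by measurable
  have W3int: "integrable lborel (\<lambda>z. W3 z \<bullet> G z)"
    and W3eq: "(LINT z|lborel. W3 z \<bullet> G z) = (LINT p|lborel. f p * \<phi> (1/2, p)) - (LINT p|lborel. f p * \<phi> (0, p))"
    using integral_static[of \<phi> G f K, OF \<phi> _ fK f0] unfolding W3_def by simp_all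
  \<comment> \<open>The open vortex squares miss these two horizontal lines, which are null.\<close>
  have pieces: "indicator unit_square p = (indicator open_square (4 *\<^sub>R (p - c1)) + indicator open_square (4 *\<^sub>R (p - c2)) + indicator R p :: real)"
    if "snd p \<noteq> 0" "snd p \<noteq> 1/2" for p
    using that by (cases p) (auto simp: c1_def c2_def R_def indicator_def abs_if)
  have local1: "cell_local p = 4 *\<^sub>R (p - c1) \<and> \<bar>fst (cell_local p)\<bar> < 1" if "4 *\<^sub>R (p - c1) \<in> open_square" for p
    using that by (cases p) (auto simp: c1_def cell_local_def)
  have local2: "cell_local p = 4 *\<^sub>R (p - c2) \<and> \<bar>fst (cell_local p)\<bar> < 1" if "4 *\<^sub>R (p - c2) \<in> open_square" for p
    using that by (cases p) (auto simp: c2_def cell_local_def)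
  have local3: "\<not> \<bar>fst (cell_local p)\<bar> < 1" if "p \<in> R" for p
    using that by (simp add: R_def cell_local_def)
  have stripe3: "finer_stripe p = stripe p" if "p \<in> R" "fst p \<noteq> 1/4" for p
  proof -
    have "frac (2 * fst p) = (if fst p < 1/2 then 2 * fst p else 2 * fst p - 1)"
      using that by (auto simp: R_def frac_unique_iff)
    with that show ?thesis by (cases p) (auto simp: R_def finer_stripe_def stripe_def abs_if split: if_splits)
  qed
  have VW: "AE z in lborel. V z = W c1 z + W c2 z + W3 z"
  proof -
    have "AE z in (lborel :: (real \<times> real \<times> real) measure). snd (snd z) \<noteq> c" for c
      using AE_hyperplane[of "(0, 0, 1) :: real \<times> real \<times> real" c] by (simp add: Basis_prod_def inner_prod_def)
    from this[of 0] this[of "1/2"] show ?thesis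
    proof eventually_elim
      case (elim z)
      have "V z = ((indicator {0..<1/2} (fst z) * indicator unit_square (snd z)) * H (cell_density z)) *\<^sub>R (1::real, cell_field z)"
        by (simp add: V_def indicator_times)
      also have "\<dots> = W c1 z + W c2 z + W3 z"
        unfolding pieces[OF elim]
        using local1[of "snd z"] local2[of "snd z"] local3[of "snd z"]
        by (auto simp: W_def W3_def f_def g_def cell_density_def cell_field_def algebra_simps indicator_def
              simp del: scaleR_Pair split: if_splits)
      finally show ?case .
    qed
  qed
  have [measurable]: "V \<in> borel_measurable borel" unfolding V_def by measurable
  have AE_VG: "AE z in lborel. V z \<bullet> G z = W c1 z \<bullet> G z + W c2 z \<bullet> G z + W3 z \<bullet> G z"
    using VW by eventually_elim (simp add: inner_add_left)
  have int3: "integrable lborel (\<lambda>z. W c1 z \<bullet> G z + W c2 z \<bullet> G z + W3 z \<bullet> G z)"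
    by (intro Bochner_Integration.integrable_add Wint W3int)
  show "integrable lborel (\<lambda>z. V z \<bullet> G z)"
    by (rule integrable_cong_AE_imp[OF int3 _ AE_VG[THEN AE_symmetric]]) measurable
  have "(LINT z|lborel. V z \<bullet> G z) = (LINT z|lborel. W c1 z \<bullet> G z + W c2 z \<bullet> G z + W3 z \<bullet> G z)"
    by (intro integral_cong_AE AE_VG) measurable
  also have "\<dots> = (LINT z|lborel. W c1 z \<bullet> G z) + (LINT z|lborel. W c2 z \<bullet> G z) + (LINT z|lborel. W3 z \<bullet> G z)"
    by (simp add: Wint W3int)
  also have "\<dots> = ((LINT p|lborel. W1 c1 p * \<phi> (1/2, p)) + (LINT p|lborel. W1 c2 p * \<phi> (1/2, p)) + (LINT p|lborel. f p * \<phi> (1/2, p)))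
     - ((LINT p|lborel. W0 c1 p * \<phi> (0, p)) + (LINT p|lborel. W0 c2 p * \<phi> (0, p)) + (LINT p|lborel. f p * \<phi> (0, p)))"
    by (simp add: Weq W3eq)
  also have "(LINT p|lborel. W1 c1 p * \<phi> (1/2, p)) + (LINT p|lborel. W1 c2 p * \<phi> (1/2, p)) + (LINT p|lborel. f p * \<phi> (1/2, p)) =
      (LINT p|lborel. W1 c1 p * \<phi> (1/2, p) + W1 c2 p * \<phi> (1/2, p) + f p * \<phi> (1/2, p))"
    by (simp add: i1 iff0)
  also have "\<dots> = (LINT p|lborel. indicator unit_square p * (H (finer_stripe p) * \<phi> (1/2, p)))"
  proof (rule integral_cong_AE)
    show "AE p in lborel. W1 c1 p * \<phi> (1/2, p) + W1 c2 p * \<phi> (1/2, p) + f p * \<phi> (1/2, p) =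
      indicator unit_square p * (H (finer_stripe p) * \<phi> (1/2, p))"
      using AE_fst_snd_real(2)[of 0] AE_fst_snd_real(2)[of "1/2"] AE_fst_snd_real(1)[of "1/2"] AE_fst_snd_real(1)[of "1/4"]
    proof eventually_elim
      case (elim p)
      \<comment> \<open>In the middle quarters the finer stripes have the opposite signs of the
        initial ones, as the vortices have after half a turn.\<close>
      have *: "finer_stripe p = (if 0 < 4 * fst p - 2 then 1 else -1)" if "\<bar>4 * fst p - 2\<bar> < 1"
      proof -
        have "frac (2 * fst p) = (if fst p < 1/2 then 2 * fst p else 2 * fst p - 1)"
          using that by (auto simp: frac_unique_iff)
        then show ?thesis using that elim by (auto simp: finer_stripe_def)
      qed
      have "W1 c p = indicator open_square (4 *\<^sub>R (p - c)) * H (finer_stripe p)" if "c = c1 \<or> c = c2" for c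
      proof (cases "4 *\<^sub>R (p - c) \<in> open_square")
        case True
        then have "finer_stripe p = (if 0 < fst (4 *\<^sub>R (p - c)) then 1 else -1)"
          using * that by (cases p) (auto simp: c1_def c2_def abs_if split: if_splits)
        then show ?thesis by (simp add: W1_def g_def rotor_sign_angle)
      qed (simp add: W1_def)
      moreover have "f p = indicator R p * H (finer_stripe p)"
        using stripe3[of p] elim(4) by (cases "p \<in> R") (simp_all add: f_def)
      ultimately show ?case
        unfolding pieces[OF elim(1,2)] by (simp add: distrib_right mult.assoc)
    qed
  qed measurable
  also have "(LINT p|lborel. W0 c1 p * \<phi> (0, p)) + (LINT p|lborel. W0 c2 p * \<phi> (0, p)) + (LINT p|lborel. f p * \<phi> (0, p)) =
      (LINT p|lborel. W0 c1 p * \<phi> (0, p) + W0 c2 p * \<phi> (0, p) + f p * \<phi> (0, p))"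
    by (simp add: i0 iff0)
  also have "\<dots> = (LINT p|lborel. indicator unit_square p * (H (stripe p) * \<phi> (0, p)))"
  proof (rule integral_cong_AE)
    show "AE p in lborel. W0 c1 p * \<phi> (0, p) + W0 c2 p * \<phi> (0, p) + f p * \<phi> (0, p) =
      indicator unit_square p * (H (stripe p) * \<phi> (0, p))"
      using AE_fst_snd_real(2)[of 0] AE_fst_snd_real(2)[of "1/2"]
    proof eventually_elim
      case (elim p)
      have "W0 c p = indicator open_square (4 *\<^sub>R (p - c)) * H (stripe p)" if "c = c1 \<or> c = c2" for c
        using that by (cases p) (auto simp: c1_def c2_def W0_def g_def rotor_sign_angle stripe_def)
      then show ?case
        unfolding pieces[OF elim] by (simp add: f_def distrib_right mult.assoc)
    qed
  qed measurable
  finally show "(LINT z|lborel. V z \<bullet> G z) =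
     (LINT p|lborel. indicator unit_square p * (H (finer_stripe p) * \<phi> (1/2, p))) -
     (LINT p|lborel. indicator unit_square p * (H (stripe p) * \<phi> (0, p)))" .
qed

section \<open>Self-similar iteration\<close>

abbreviation "unit_cube \<equiv> {0..<1::real} \<times> unit_square"

definition stage_index :: "real \<Rightarrow> nat" where
  "stage_index t = nat \<lfloor>- log 2 (1 - t)\<rfloor>"

text \<open>For \<open>1 - t\<close> between \<open>1 / 2 ^ (k + 1)\<close> and \<open>1 / 2 ^ k\<close> the mixing step number \<open>k\<close> takes place, in
  cells of side \<open>1 / 2 ^ k\<close>.\<close>

definition zoom :: "real \<times> real \<times> real \<Rightarrow> real \<times> real \<times> real" where
  "zoom z = (let k = stage_index (fst z) in
     (1 - 2 ^ k * (1 - fst z), frac (2 ^ k * fst (snd z)), frac (2 ^ k * snd (snd z))))"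

lemma measurable_zoom[measurable]: "zoom \<in> borel_measurable borel"
proof -
  have [measurable]: "(\<lambda>z. stage_index (fst z)) \<in> (borel :: (real \<times> real \<times> real) measure) \<rightarrow>\<^sub>M count_space UNIV"
    unfolding stage_index_def by measurable
  have "(\<lambda>z. (2::real) ^ stage_index (fst z)) \<in> borel_measurable (borel :: (real \<times> real \<times> real) measure)"
    by (rule measurable_compose_countable[where f="\<lambda>k z. 2 ^ k"]) measurable
  note [measurable] = this
  show ?thesis unfolding zoom_def Let_def frac_def by measurable
qed

lemma zoom_first_stage:
  assumes "z \<in> {0..<1/2} \<times> unit_square"
  shows "zoom z = z"
proof -
  have t: "0 \<le> fst z" "fst z < 1/2" using assms by auto
  have "log 2 (1 - fst z) \<le> 0" using t by (subst log_le_zero_cancel_iff) auto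
  moreover have "log 2 (1/2) < log 2 (1 - fst z)" using t by (subst log_less_cancel_iff) auto
  moreover have "log 2 (1/2::real) = -1" by (simp add: log_divide)
  ultimately have "\<lfloor>- log 2 (1 - fst z)\<rfloor> = 0" by (simp add: floor_eq_iff)
  then have "stage_index (fst z) = 0" by (simp add: stage_index_def)
  moreover have "frac (fst (snd z)) = fst (snd z)" "frac (snd (snd z)) = snd (snd z)"
    using assms by (auto simp: frac_eq)
  ultimately show ?thesis by (simp add: zoom_def prod_eq_iff)
qed

lemma frac_add_of_nat: "frac (real n + x) = frac x"
  by (simp add: frac_def)

text \<open>Halving the distance to time 1 raises the stage by one. The frequency then doubles,
  which compensates the halving in space and turns the shifts \<open>a / 2\<close> and
  \<open>b / 2\<close> into integers, invisible to \<open>frac\<close>.\<close>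

lemma zoom_self_similar:
  fixes a b :: nat
  assumes "z \<in> unit_cube"
  shows "zoom ((1/2, a / 2, b / 2) + (1/2) *\<^sub>R z) = zoom z"
proof -
  obtain t x y where z: "z = (t, x, y)" by (cases z)
  have t: "0 \<le> t" "t < 1" using assms by (auto simp: z)
  have "log 2 (1 - (1/2 + t/2)) = log 2 ((1 - t) / 2)" by (rule arg_cong[where f="log 2"]) simp
  also have "\<dots> = log 2 (1 - t) - 1" using t by (simp add: log_divide)
  finally have l: "- log 2 (1 - (1/2 + t/2)) = - log 2 (1 - t) + 1" by simp
  have "log 2 (1 - t) \<le> 0" using t by (subst log_le_zero_cancel_iff) auto
  then have "0 \<le> \<lfloor>- log 2 (1 - t)\<rfloor>" by simp
  moreover have "\<lfloor>- log 2 (1 - t) + 1\<rfloor> = \<lfloor>- log 2 (1 - t)\<rfloor> + 1" by linarith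
  ultimately have k: "stage_index (1/2 + t/2) = Suc (stage_index t)"
    unfolding stage_index_def l by linarith
  have "frac (2 * 2 ^ k * (real n / 2 + w / 2)) = frac (2 ^ k * w)" for k n :: nat and w :: real
    using frac_add_of_nat[of "2 ^ k * n" "2 ^ k * w"] by (simp add: algebra_simps)
  then show ?thesis by (simp add: zoom_def z k Let_def algebra_simps)
qed

text \<open>Thanks to the zero mean, the trace of a test function against \<open>stripe\<close> can
  be bounded by its gradient alone, which is what shrinks under rescaling.\<close>

lemma integral_stripe_zero: "(LINT p|lborel. indicator unit_square p * stripe p) = 0"
proof -
  define A where "A = {0..<1/2::real} \<times> {0..<1::real}"
  define A' where "A' = {1/2..<1::real} \<times> {0..<1::real}"
  have [measurable]: "A \<in> sets borel" "A' \<in> sets borel" unfolding A_def A'_def by measurable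
  have i: "integrable lborel (indicator A :: _ \<Rightarrow> real)" "integrable lborel (indicator A' :: _ \<Rightarrow> real)"
    by (rule integrable_bounded_cbox[where a="(0,0)" and b="(1,1)" and M=1];
        force simp: A_def A'_def indicator_def cbox_Pair_eq)+
  have "(LINT p|lborel. indicator unit_square p * stripe p) = (LINT p|lborel. indicator A p - indicator A' p)"
    by (intro Bochner_Integration.integral_cong) (auto simp: A_def A'_def indicator_def stripe_def)
  also have "\<dots> = (LINT p|lborel. indicator A p) - (LINT p|lborel. indicator A' p)"
    by (intro Bochner_Integration.integral_diff i)
  also have "(LINT p|lborel. indicator A' p :: real) = (LINT p|lborel. indicator A p)"
  proof -
    have "(LINT p|lborel. indicator A' p :: real) = 1 ^ DIM(real \<times> real) * (LINT p|lborel. indicator A' ((1/2, 0) + 1 *\<^sub>R p))"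
      by (rule integral_lborel_affine) auto
    moreover have "indicator A' ((1/2, 0) + 1 *\<^sub>R p) = (indicator A p :: real)" for p
      by (cases p) (auto simp: A_def A'_def indicator_def)
    ultimately show ?thesis by (simp only: power_one mult_1)
  qed
  finally show ?thesis by simp
qed

lemma abs_integral_le_cbox:
  fixes h :: "'a::euclidean_space \<Rightarrow> real"
  assumes [measurable]: "h \<in> borel_measurable borel" and b: "\<And>z. z \<in> cbox a b \<Longrightarrow> \<bar>h z\<bar> \<le> C"
    and z: "\<And>z. z \<notin> cbox a b \<Longrightarrow> h z = 0"
  shows "\<bar>LINT z|lborel. h z\<bar> \<le> C * measure lborel (cbox a b)"
proof -
  have h: "integrable lborel h"
    by (rule integrable_bounded_cbox[where a=a and b=b and M=C]) (use b z in auto)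
  have "\<bar>LINT z|lborel. h z\<bar> \<le> (LINT z|lborel. \<bar>h z\<bar>)"
    by (rule integral_abs_bound)
  also have "\<dots> \<le> (LINT z|lborel. C * indicator (cbox a b) z)"
  proof (rule integral_mono)
    show "integrable lborel (\<lambda>z. C * indicator (cbox a b) z)"
      using emeasure_lborel_cbox_finite[of a b] by (intro integrable_mult_right integrable_real_indicator) auto
    show "\<bar>h z\<bar> \<le> C * indicator (cbox a b) z" for z
      using b[of z] z[of z] by (auto simp: indicator_def)
  qed (use h in simp)
  finally show ?thesis by simp
qed

lemma integral_add4:
  fixes f g h k :: "'a \<Rightarrow> real"
  assumes "integrable M f" "integrable M g" "integrable M h" "integrable M k"
  shows "(LINT x|M. f x + g x + (h x + k x)) =
    (LINT x|M. f x) + (LINT x|M. g x) + ((LINT x|M. h x) + (LINT x|M. k x))"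
  using assms by simp

lemma C1_grad_lipschitz:
  assumes \<phi>: "C1_grad \<phi> G" and L: "\<And>z. z \<in> cbox a b \<Longrightarrow> norm (G z) \<le> L"
    and z: "z \<in> cbox a b" "w \<in> cbox a b"
  shows "\<bar>\<phi> z - \<phi> w\<bar> \<le> L * norm (z - w)"
proof -
  have "norm (\<phi> z - \<phi> w) \<le> L * norm (z - w)"
  proof (rule differentiable_bound[where S="cbox a b" and f'="\<lambda>z h. G z \<bullet> h"])
    fix z assume z: "z \<in> cbox a b"
    show "(\<phi> has_derivative (\<lambda>h. G z \<bullet> h)) (at z within cbox a b)"
      using \<phi> by (auto simp: C1_grad_def intro: has_derivative_at_withinI)
    show "onorm (\<lambda>h. G z \<bullet> h) \<le> L"
    proof (rule onorm_bound)
      show "0 \<le> L" using L[OF z] norm_ge_zero order_trans by blast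
      show "norm (G z \<bullet> h) \<le> L * norm h" for h
        using Cauchy_Schwarz_ineq2[of "G z" h] mult_right_mono[OF L[OF z] norm_ge_zero[of h]] by simp
    qed
  qed (use z in auto)
  then show ?thesis by simp
qed

text \<open>The integral defect \<open>I \<phi> G\<close> of the zoomed field is the average of four defects of the test
  function restricted to the cells of half the size, whose gradients are half as large. As the
  defect is bounded by the size of the gradient, it vanishes.\<close>

lemma integral_zoom:
  fixes V :: "real \<times> real \<times> real \<Rightarrow> real \<times> real \<times> real"
  assumes [measurable]: "V \<in> borel_measurable borel" and bV: "\<And>z. snd z \<in> unit_square \<Longrightarrow> norm (V z) \<le> M"
    and cell: "\<And>\<phi> G. C1_grad \<phi> G \<Longrightarrow>
      (LINT z|lborel. indicator ({0..<1/2} \<times> unit_square) z * (V z \<bullet> G z)) =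
      e * ((LINT p|lborel. indicator unit_square p * (finer_stripe p * \<phi> (1/2, p))) -
           (LINT p|lborel. indicator unit_square p * (stripe p * \<phi> (0, p))))"
    and \<phi>: "C1_grad \<phi> G"
  shows "(LINT z|lborel. indicator unit_cube z * (V (zoom z) \<bullet> G z)) =
      - e * (LINT p|lborel. indicator unit_square p * (stripe p * \<phi> (0, p)))"
proof -
  define S where "S \<phi> t = (LINT p|lborel. indicator unit_square p * (stripe p * \<phi> (t, p)))"
    for \<phi> :: "real \<times> real \<times> real \<Rightarrow> real" and t :: real
  \<comment> \<open>The claim is \<open>I \<phi> G = 0\<close>. The factor \<open>e\<close> is 1 for
    the flux of the density and 0 for the field \<open>(0, b)\<close>, which leaves no
    trace.\<close>
  define I where "I \<phi> G = (LINT z|lborel. indicator unit_cube z * (V (zoom z) \<bullet> G z)) + e * S \<phi> 0"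
    for \<phi> and G :: "real \<times> real \<times> real \<Rightarrow> real \<times> real \<times> real"
  define sh :: "nat \<Rightarrow> nat \<Rightarrow> real \<times> real \<times> real" where "sh a b = (1/2, a / 2, b / 2)" for a b
  \<comment> \<open>The test function seen from subcell \<open>(a, b)\<close>: it starts at time 1/2
    and has half the size.\<close>
  define \<Phi> where "\<Phi> a b \<phi> = (\<lambda>z. \<phi> (sh a b + (1/2) *\<^sub>R z))" for a b and \<phi> :: "real \<times> real \<times> real \<Rightarrow> real"
  define \<Gamma> where "\<Gamma> a b G = (\<lambda>z. (1/2) *\<^sub>R G (sh a b + (1/2) *\<^sub>R z))" for a b and G :: "real \<times> real \<times> real \<Rightarrow> real \<times> real \<times> real"
  have C1: "C1_grad (\<Phi> a b \<phi>) (\<Gamma> a b G)" if "C1_grad \<phi> G" for \<phi> G a b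
    unfolding \<Phi>_def \<Gamma>_def by (rule C1_grad_affine[OF that])
  have M: "norm (V (zoom z)) \<le> M" for z
    by (rule bV) (simp add: zoom_def Let_def frac_lt_1)
  then have M0: "0 \<le> M" using norm_ge_zero order_trans by blast
  \<comment> \<open>The initial trace of the first step cancels \<open>e * S \<phi> 0\<close>, and
    its final trace splits into the initial traces of the subcells. Traces scale by
    \<open>(1/2) ^ 2\<close>, space-time integrals by \<open>(1/2) ^ 3\<close> times 2 for the
    halved gradient: both give 1/4.\<close>
  have rec: "I \<phi> G = (1/4) * (I (\<Phi> 0 0 \<phi>) (\<Gamma> 0 0 G) + I (\<Phi> 0 1 \<phi>) (\<Gamma> 0 1 G) + I (\<Phi> 1 0 \<phi>) (\<Gamma> 1 0 G) + I (\<Phi> 1 1 \<phi>) (\<Gamma> 1 1 G))"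
    if \<phi>: "C1_grad \<phi> G" for \<phi> G
  proof -
    note [measurable] = C1_grad_measurable[OF \<phi>]
    have cont: "continuous_on UNIV (\<lambda>p. \<phi> (t, p))" for t
      by (rule continuous_on_compose2[OF C1_grad_continuous(1)[OF \<phi>]]) (auto intro!: continuous_intros)
    define Q where "Q a b = {z. (z - sh a b) /\<^sub>R (1/2) \<in> unit_cube}" for a b
    define P :: "nat \<Rightarrow> nat \<Rightarrow> (real \<times> real) set" where "P a b = {p. (p - (a / 2, b / 2)) /\<^sub>R (1/2) \<in> unit_square}" for a b
    have [measurable]: "Q a b \<in> sets borel" "P a b \<in> sets borel" for a b
      unfolding Q_def P_def by measurable
    have Vint: "integrable lborel (\<lambda>z. indicator X z * (V (zoom z) \<bullet> G z))"
      if "X \<in> sets borel" "X \<subseteq> cbox (-1, -1, -1) (2, 2, 2)" for X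
    proof -
      note [measurable] = that(1)
      have "integrable lborel (\<lambda>z. (indicator X z *\<^sub>R V (zoom z)) \<bullet> G z)"
        using that M M0
        by (intro integrable_inner_continuous[where M=M and a="(-1, -1, -1)" and b="(2, 2, 2)"] C1_grad_continuous(2)[OF \<phi>])
           (auto simp: indicator_def)
      then show ?thesis by simp
    qed
    have Qsub: "Q a b \<subseteq> cbox (-1, -1, -1) (2, 2, 2)" if "a \<le> 1" "b \<le> 1" for a b
      using that by (auto simp: Q_def sh_def cbox_Pair_eq)
    have QV: "integrable lborel (\<lambda>z. indicator (Q a b) z * (V (zoom z) \<bullet> G z))" if "a \<le> 1" "b \<le> 1" for a b
      by (intro Vint Qsub that) measurable
    have Qi: "(LINT z|lborel. indicator (Q a b) z * (V (zoom z) \<bullet> G z)) =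
       (1/4) * (LINT z|lborel. indicator unit_cube z * (V (zoom z) \<bullet> \<Gamma> a b G z))" for a b
    proof -
      have "(LINT z|lborel. indicator (Q a b) z * (V (zoom z) \<bullet> G z)) =
        (1/2) ^ 3 * (LINT z|lborel. indicator (Q a b) (sh a b + (1/2) *\<^sub>R z) *
          (V (zoom (sh a b + (1/2) *\<^sub>R z)) \<bullet> G (sh a b + (1/2) *\<^sub>R z)))"
        by (subst integral_lborel_affine[where c="sh a b" and \<rho>="1/2"]) (simp_all add: eval_nat_numeral)
      also have "(LINT z|lborel. indicator (Q a b) (sh a b + (1/2) *\<^sub>R z) *
          (V (zoom (sh a b + (1/2) *\<^sub>R z)) \<bullet> G (sh a b + (1/2) *\<^sub>R z))) =
          (LINT z|lborel. 2 * (indicator unit_cube z * (V (zoom z) \<bullet> \<Gamma> a b G z)))"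
      proof (rule Bochner_Integration.integral_cong[OF refl])
        fix z
        show "indicator (Q a b) (sh a b + (1/2) *\<^sub>R z) *
          (V (zoom (sh a b + (1/2) *\<^sub>R z)) \<bullet> G (sh a b + (1/2) *\<^sub>R z)) =
          2 * (indicator unit_cube z * (V (zoom z) \<bullet> \<Gamma> a b G z))"
          using zoom_self_similar[of z a b]
          by (cases "z \<in> unit_cube") (auto simp: Q_def sh_def \<Gamma>_def)
      qed
      finally show ?thesis by (simp add: eval_nat_numeral)
    qed
    have Pi: "(LINT p|lborel. indicator (P a b) p * (finer_stripe p * \<phi> (1/2, p))) = (1/4) * S (\<Phi> a b \<phi>) 0" for a b
    proof -
      have "(LINT p|lborel. indicator (P a b) p * (finer_stripe p * \<phi> (1/2, p))) =
        (1/2) ^ 2 * (LINT p|lborel. indicator (P a b) ((a / 2, b / 2) + (1/2) *\<^sub>R p) *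
          (finer_stripe ((a / 2, b / 2) + (1/2) *\<^sub>R p) * \<phi> (1/2, (a / 2, b / 2) + (1/2) *\<^sub>R p)))"
        by (subst integral_lborel_affine[where c="(a / 2, b / 2)" and \<rho>="1/2"]) (simp_all add: eval_nat_numeral)
      also have "(LINT p|lborel. indicator (P a b) ((a / 2, b / 2) + (1/2) *\<^sub>R p) *
          (finer_stripe ((a / 2, b / 2) + (1/2) *\<^sub>R p) * \<phi> (1/2, (a / 2, b / 2) + (1/2) *\<^sub>R p))) = S (\<Phi> a b \<phi>) 0"
        unfolding S_def
      proof (rule Bochner_Integration.integral_cong[OF refl])
        fix p :: "real \<times> real"
        have "finer_stripe ((a / 2, b / 2) + (1/2) *\<^sub>R p) = stripe p" if "p \<in> unit_square"
          using frac_add_of_nat[of a "fst p"] that by (auto simp: finer_stripe_def stripe_def frac_eq)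
        then show "indicator (P a b) ((a / 2, b / 2) + (1/2) *\<^sub>R p) *
          (finer_stripe ((a / 2, b / 2) + (1/2) *\<^sub>R p) * \<phi> (1/2, (a / 2, b / 2) + (1/2) *\<^sub>R p)) =
          indicator unit_square p * (stripe p * \<Phi> a b \<phi> (0, p))"
          by (cases p; cases "p \<in> unit_square") (auto simp: P_def \<Phi>_def sh_def)
      qed
      finally show ?thesis by (simp add: eval_nat_numeral)
    qed
    have "(LINT z|lborel. indicator unit_cube z * (V (zoom z) \<bullet> G z)) =
      (LINT z|lborel. indicator ({0..<1/2} \<times> unit_square) z * (V (zoom z) \<bullet> G z) +
        (indicator (Q 0 0) z * (V (zoom z) \<bullet> G z) + indicator (Q 0 1) z * (V (zoom z) \<bullet> G z) +
         (indicator (Q 1 0) z * (V (zoom z) \<bullet> G z) + indicator (Q 1 1) z * (V (zoom z) \<bullet> G z))))"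
    proof (rule Bochner_Integration.integral_cong[OF refl])
      fix z :: "real \<times> real \<times> real"
      have "indicator unit_cube z = (indicator ({0..<1/2} \<times> unit_square) z +
        (indicator (Q 0 0) z + indicator (Q 0 1) z + (indicator (Q 1 0) z + indicator (Q 1 1) z)) :: real)"
        by (cases z) (auto simp: Q_def sh_def indicator_def)
      then show "indicator unit_cube z * (V (zoom z) \<bullet> G z) = indicator ({0..<1/2} \<times> unit_square) z * (V (zoom z) \<bullet> G z) +
        (indicator (Q 0 0) z * (V (zoom z) \<bullet> G z) + indicator (Q 0 1) z * (V (zoom z) \<bullet> G z) +
         (indicator (Q 1 0) z * (V (zoom z) \<bullet> G z) + indicator (Q 1 1) z * (V (zoom z) \<bullet> G z)))"
        by (simp only: distrib_right)
    qed
    also have "\<dots> = (LINT z|lborel. indicator ({0..<1/2} \<times> unit_square) z * (V (zoom z) \<bullet> G z)) +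
        ((LINT z|lborel. indicator (Q 0 0) z * (V (zoom z) \<bullet> G z)) + (LINT z|lborel. indicator (Q 0 1) z * (V (zoom z) \<bullet> G z)) +
         ((LINT z|lborel. indicator (Q 1 0) z * (V (zoom z) \<bullet> G z)) + (LINT z|lborel. indicator (Q 1 1) z * (V (zoom z) \<bullet> G z))))"
      by (subst Bochner_Integration.integral_add, rule Vint, measurable, force simp: cbox_Pair_eq,
          intro Bochner_Integration.integrable_add QV; simp?)
         (subst integral_add4, (rule QV; simp)+, simp)
    also have "(LINT z|lborel. indicator ({0..<1/2} \<times> unit_square) z * (V (zoom z) \<bullet> G z)) =
      (LINT z|lborel. indicator ({0..<1/2} \<times> unit_square) z * (V z \<bullet> G z))"
      using zoom_first_stage by (intro Bochner_Integration.integral_cong) (auto simp: indicator_def)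
    also have "\<dots> = e * ((LINT p|lborel. indicator unit_square p * (finer_stripe p * \<phi> (1/2, p))) - S \<phi> 0)"
      unfolding S_def by (rule cell[OF \<phi>])
    also have "(LINT p|lborel. indicator unit_square p * (finer_stripe p * \<phi> (1/2, p))) =
      (LINT p|lborel. indicator (P 0 0) p * (finer_stripe p * \<phi> (1/2, p)) + indicator (P 0 1) p * (finer_stripe p * \<phi> (1/2, p)) +
         (indicator (P 1 0) p * (finer_stripe p * \<phi> (1/2, p)) + indicator (P 1 1) p * (finer_stripe p * \<phi> (1/2, p))))"
    proof (rule Bochner_Integration.integral_cong[OF refl])
      fix p :: "real \<times> real"
      have "indicator unit_square p = (indicator (P 0 0) p + indicator (P 0 1) p + (indicator (P 1 0) p + indicator (P 1 1) p) :: real)"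
        by (cases p) (auto simp: P_def indicator_def)
      then show "indicator unit_square p * (finer_stripe p * \<phi> (1/2, p)) =
        indicator (P 0 0) p * (finer_stripe p * \<phi> (1/2, p)) + indicator (P 0 1) p * (finer_stripe p * \<phi> (1/2, p)) +
         (indicator (P 1 0) p * (finer_stripe p * \<phi> (1/2, p)) + indicator (P 1 1) p * (finer_stripe p * \<phi> (1/2, p)))"
        by (simp only: distrib_right)
    qed
    also have "\<dots> = (1/4) * S (\<Phi> 0 0 \<phi>) 0 + (1/4) * S (\<Phi> 0 1 \<phi>) 0 + ((1/4) * S (\<Phi> 1 0 \<phi>) 0 + (1/4) * S (\<Phi> 1 1 \<phi>) 0)"
    proof -
      have Pint: "integrable lborel (\<lambda>p. indicator (P a b) p * (finer_stripe p * \<phi> (1/2, p)))" if "a \<le> 1" "b \<le> 1" for a b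
      proof -
        have "integrable lborel (\<lambda>p. (indicator (P a b) p * finer_stripe p) \<bullet> \<phi> (1/2, p))"
        proof (rule integrable_inner_continuous[OF _ _ _ cont])
          show "norm (indicator (P a b) p * finer_stripe p) \<le> 1" for p
            by (simp add: indicator_def finer_stripe_def)
          show "indicator (P a b) p * finer_stripe p = 0" if "p \<notin> cbox (-1, -1) (2, 2)" for p
          proof -
            have "p \<notin> P a b" using that \<open>a \<le> 1\<close> \<open>b \<le> 1\<close> by (cases p) (auto simp: P_def cbox_Pair_eq)
            then show ?thesis by simp
          qed
        qed measurable
        then show ?thesis by (simp add: mult.assoc)
      qed
      show ?thesis
        unfolding Pi[symmetric] by (rule integral_add4; rule Pint; simp)
    qed
    finally show ?thesis unfolding I_def Qi by (simp add: algebra_simps)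
  qed
  have bd: "\<bar>I \<phi> G\<bar> \<le> (M + \<bar>e\<bar> * 2) * L"
    if \<phi>: "C1_grad \<phi> G" and L: "\<And>z. z \<in> cbox (0, 0, 0) (1, 1, 1) \<Longrightarrow> norm (G z) \<le> L" for \<phi> G L
  proof -
    note [measurable] = C1_grad_measurable[OF \<phi>]
    have L0: "0 \<le> L" using L[of 0] by (force intro: order_trans[OF norm_ge_zero] simp: zero_prod_def cbox_Pair_eq)
    have "\<bar>LINT z|lborel. indicator unit_cube z * (V (zoom z) \<bullet> G z)\<bar> \<le>
        M * L * measure lborel (cbox (0, 0, 0) (1, 1, 1) :: (real \<times> real \<times> real) set)"
    proof (rule abs_integral_le_cbox)
      fix z :: "real \<times> real \<times> real" assume "z \<in> cbox (0, 0, 0) (1, 1, 1)"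
      then have "\<bar>V (zoom z) \<bullet> G z\<bar> \<le> M * L"
        using Cauchy_Schwarz_ineq2[of "V (zoom z)" "G z"] mult_mono[OF M L M0 norm_ge_zero, of z z]
        by linarith
      then show "\<bar>indicator unit_cube z * (V (zoom z) \<bullet> G z)\<bar> \<le> M * L"
        using M0 L0 by (auto simp: indicator_def)
    qed (auto simp: indicator_def cbox_Pair_eq)
    then have 1: "\<bar>LINT z|lborel. indicator unit_cube z * (V (zoom z) \<bullet> G z)\<bar> \<le> M * L"
      by (simp add: content_Pair)
    have cont: "continuous_on UNIV (\<lambda>p. \<phi> (0, p))"
      by (rule continuous_on_compose2[OF C1_grad_continuous(1)[OF \<phi>]]) (auto intro!: continuous_intros)
    have int: "integrable lborel (\<lambda>p. (indicator unit_square p * stripe p) * f p)" if "continuous_on UNIV f" for f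
    proof -
      have "integrable lborel (\<lambda>p. (indicator unit_square p * stripe p) \<bullet> f p)"
        using that
        by (intro integrable_inner_continuous[where M=1 and a="(0, 0)" and b="(1, 1)"])
           (auto simp: indicator_def cbox_Pair_eq stripe_def)
      then show ?thesis by simp
    qed
    \<comment> \<open>By the zero mean the constant \<open>\<phi> 0\<close> may be subtracted; the
      remaining difference is controlled by the Lipschitz bound, with 2 bounding the norm on the
      unit square.\<close>
    have "(LINT p|lborel. (indicator unit_square p * stripe p) * \<phi> 0) = 0"
      using integral_stripe_zero by simp
    then have "S \<phi> 0 = (LINT p|lborel. (indicator unit_square p * stripe p) * \<phi> (0, p)) - (LINT p|lborel. (indicator unit_square p * stripe p) * \<phi> 0)"
      by (simp add: S_def mult.assoc)
    also have "\<dots> = (LINT p|lborel. indicator unit_square p * stripe p * (\<phi> (0, p) - \<phi> 0))"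
      by (subst Bochner_Integration.integral_diff[symmetric], rule int[OF cont], rule int[OF continuous_on_const])
         (simp only: right_diff_distrib)
    finally have "\<bar>S \<phi> 0\<bar> = \<bar>LINT p|lborel. indicator unit_square p * stripe p * (\<phi> (0, p) - \<phi> 0)\<bar>" by simp
    also have "\<dots> \<le> L * 2 * measure lborel (cbox (0, 0) (1, 1) :: (real \<times> real) set)"
    proof (rule abs_integral_le_cbox)
      fix p :: "real \<times> real" assume p: "p \<in> cbox (0, 0) (1, 1)"
      have "\<bar>\<phi> (0, p) - \<phi> (0, 0, 0)\<bar> \<le> L * norm ((0::real, p) - (0, 0, 0))"
      proof (rule C1_grad_lipschitz[where a="(0, 0, 0)" and b="(1, 1, 1)", OF \<phi>])
        show "(0, p) \<in> cbox (0, 0, 0) (1 :: real, 1, 1)" "(0, 0, 0) \<in> cbox (0, 0, 0) (1 :: real, 1 :: real, 1 :: real)"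
          using p by (auto simp: cbox_Pair_eq)
      qed (rule L)
      also have "norm ((0::real, p) - (0, 0, 0)) \<le> 2"
        using p norm_Pair_le[of "fst p" "snd p"] by (cases p) (auto simp: norm_Pair cbox_Pair_eq)
      finally have "\<bar>\<phi> (0, p) - \<phi> 0\<bar> \<le> L * 2" using L0 by (simp add: zero_prod_def mult_left_mono)
      then show "\<bar>indicator unit_square p * stripe p * (\<phi> (0, p) - \<phi> 0)\<bar> \<le> L * 2"
        using L0 by (auto simp: indicator_def stripe_def abs_minus_commute)
    qed (auto simp: indicator_def cbox_Pair_eq)
    finally have "\<bar>S \<phi> 0\<bar> \<le> L * 2" by (simp add: content_Pair)
    then have "\<bar>e * S \<phi> 0\<bar> \<le> \<bar>e\<bar> * (L * 2)" unfolding abs_mult by (rule mult_left_mono) simp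
    with 1 show ?thesis unfolding I_def by (simp add: algebra_simps)
  qed
  \<comment> \<open>Averaging does not increase the bound, while each level halves the
    gradient.\<close>
  have dec: "\<bar>I \<phi> G\<bar> \<le> (M + \<bar>e\<bar> * 2) * L / 2 ^ n"
    if "C1_grad \<phi> G" and "\<And>z. z \<in> cbox (0, 0, 0) (1, 1, 1) \<Longrightarrow> norm (G z) \<le> L" for \<phi> G L n
    using that
  proof (induction n arbitrary: \<phi> G L)
    case 0
    then show ?case using bd by simp
  next
    case (Suc n)
    have "\<bar>I (\<Phi> a b \<phi>) (\<Gamma> a b G)\<bar> \<le> (M + \<bar>e\<bar> * 2) * (L / 2) / 2 ^ n" if "a \<le> 1" "b \<le> 1" for a b
    proof (rule Suc.IH[OF C1[OF Suc.prems(1)]])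
      fix z :: "real \<times> real \<times> real" assume "z \<in> cbox (0, 0, 0) (1, 1, 1)"
      then have "sh a b + (1/2) *\<^sub>R z \<in> cbox (0, 0, 0) (1, 1, 1)"
        using that by (cases z) (auto simp: sh_def cbox_Pair_eq)
      from Suc.prems(2)[OF this] show "norm (\<Gamma> a b G z) \<le> L / 2" by (simp add: \<Gamma>_def)
    qed
    note b = this
    have avg: "\<bar>(1/4) * (w + x + y + z)\<bar> \<le> B" if "\<bar>w\<bar> \<le> B" "\<bar>x\<bar> \<le> B" "\<bar>y\<bar> \<le> B" "\<bar>z\<bar> \<le> B"
      for w x y z B :: real
      using that unfolding abs_le_iff by (simp add: field_simps)
    have "(M + \<bar>e\<bar> * 2) * L / 2 ^ Suc n = (M + \<bar>e\<bar> * 2) * (L / 2) / 2 ^ n" by simp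
    then show ?case
      unfolding rec[OF Suc.prems(1)] by (simp only:) (intro avg b; simp)
  qed
  have "compact (G ` cbox (0, 0, 0) (1, 1, 1))"
    by (intro compact_continuous_image continuous_on_subset[OF C1_grad_continuous(2)[OF \<phi>]]) auto
  then obtain L where L: "\<And>z. z \<in> cbox (0, 0, 0) (1, 1, 1) \<Longrightarrow> norm (G z) \<le> L"
    by (fastforce dest: compact_imp_bounded simp: bounded_iff)
  have "(\<lambda>n. (M + \<bar>e\<bar> * 2) * L / 2 ^ n) \<longlonglongrightarrow> 0"
    by (rule LIMSEQ_divide_realpow_zero) simp
  then have "\<bar>I \<phi> G\<bar> \<le> 0"
    using dec[OF \<phi> L] by (intro LIMSEQ_le_const) auto
  then show ?thesis by (simp add: I_def S_def)
qed

section \<open>The mixing block\<close>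

lemma box_Times: "box (a, b) (c, d) = box a c \<times> box b d"
  by (force simp: box_def Basis_prod_def)

section \<open>Reflection in time\<close>

definition time_reflect :: "real \<times> 'a \<Rightarrow> real \<times> 'a" where
  "time_reflect z = (- fst z, snd z)"

lemma time_reflect_time_reflect[simp]: "time_reflect (time_reflect z) = z"
  by (simp add: time_reflect_def)

lemma measurable_time_reflect[measurable]:
  "time_reflect \<in> (borel :: (real \<times> 'a::euclidean_space) measure) \<rightarrow>\<^sub>M borel"
  unfolding time_reflect_def by measurable

lemma lborel_time_reflect: "distr lborel borel time_reflect = (lborel :: (real \<times> 'a::euclidean_space) measure)"
proof -
  have id: "distr lborel borel (\<lambda>x. x) = (lborel :: 'a measure)"
    by (rule distr_id2) simp
  have "(lborel :: (real \<times> 'a) measure) = distr lborel borel uminus \<Otimes>\<^sub>M distr lborel borel (\<lambda>x. x)"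
    by (simp add: lborel_distr_uminus id lborel_prod)
  also have "\<dots> = distr (lborel \<Otimes>\<^sub>M lborel) (borel \<Otimes>\<^sub>M borel) (\<lambda>(t, x). (- t, x))"
    by (rule pair_measure_distr) (auto simp: id sigma_finite_lborel)
  also have "\<dots> = distr lborel borel time_reflect"
    unfolding lborel_prod borel_prod by (rule distr_cong) (auto simp: time_reflect_def)
  finally show ?thesis by simp
qed

lemma integral_time_reflect:
  fixes f :: "real \<times> 'a::euclidean_space \<Rightarrow> real"
  assumes [measurable]: "f \<in> borel_measurable borel"
  shows "(LINT z|lborel. f (time_reflect z)) = (LINT z|lborel. f z)"
  by (subst (2) lborel_time_reflect[symmetric], subst integral_distr) auto

lemma C1_grad_time_reflect:
  fixes \<phi> :: "real \<times> 'a::euclidean_space \<Rightarrow> real"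
  assumes "C1_grad \<phi> G"
  shows "C1_grad (\<lambda>z. \<phi> (time_reflect z)) (\<lambda>z. time_reflect (G (time_reflect z)))"
  unfolding C1_grad_def
proof (intro conjI allI)
  fix z :: "real \<times> 'a"
  have 1: "(time_reflect has_derivative time_reflect) (at z)"
    unfolding time_reflect_def by (auto intro!: derivative_eq_intros)
  have 2: "(\<phi> has_derivative (\<lambda>h. G (time_reflect z) \<bullet> h)) (at (time_reflect z))"
    using assms unfolding C1_grad_def by blast
  show "((\<lambda>z. \<phi> (time_reflect z)) has_derivative (\<lambda>h. time_reflect (G (time_reflect z)) \<bullet> h)) (at z)"
    using has_derivative_compose[OF 1 2] by (simp add: time_reflect_def inner_prod_def)
next
  have c: "continuous_on UNIV (time_reflect :: real \<times> 'a \<Rightarrow> _)"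
    unfolding time_reflect_def by (intro continuous_intros)
  from continuous_on_compose2[OF C1_grad_continuous(2)[OF assms] c]
  have "continuous_on UNIV (\<lambda>z. G (time_reflect z))" by simp
  from continuous_on_compose2[OF c this]
  show "continuous_on UNIV (\<lambda>z. time_reflect (G (time_reflect z)))" by simp
qed

definition mix_density :: "real \<times> real \<times> real \<Rightarrow> real" where
  "mix_density z = cell_density (zoom (\<bar>fst z\<bar>, snd z))"

text \<open>Running a flow backwards reverses its velocity, so the field is odd in time while the
  density is even.\<close>

definition mix_field :: "real \<times> real \<times> real \<Rightarrow> real \<times> real" where
  "mix_field z = (if 0 \<le> fst z then 1 else -1) *\<^sub>R cell_field (zoom (\<bar>fst z\<bar>, snd z))"

lemma measurable_mix[measurable]:
  "mix_density \<in> borel_measurable borel" "mix_field \<in> borel_measurable borel"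
  unfolding mix_density_def mix_field_def by measurable

lemma cell_density_cases: "cell_density z = 1 \<or> cell_density z = -1"
  by (auto simp: cell_density_def rotor_sign_def stripe_def)

lemma mix_density_cases: "mix_density z = 1 \<or> mix_density z = -1"
  unfolding mix_density_def by (rule cell_density_cases)

lemma norm_cell_field_le:
  assumes "snd z \<in> unit_square"
  shows "norm (cell_field z) \<le> 4"
proof (cases "\<bar>fst (cell_local (snd z))\<bar> < 1")
  case True
  have "norm (cell_local (snd z)) \<le> \<bar>fst (cell_local (snd z))\<bar> + \<bar>snd (cell_local (snd z))\<bar>"
    using norm_Pair_le[of "fst (cell_local (snd z))" "snd (cell_local (snd z))"] by simp
  moreover have "\<bar>snd (cell_local (snd z))\<bar> \<le> 1"
    using assms by (auto simp: cell_local_def)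
  ultimately show ?thesis
    using True norm_square_rotation_le[of "cell_local (snd z)"] by (simp add: cell_field_def)
qed (simp add: cell_field_def)

lemma snd_zoom_unit_square: "snd (zoom z) \<in> unit_square"
  by (simp add: zoom_def Let_def frac_lt_1)

lemma norm_mix_field_le: "norm (mix_field z) \<le> 4"
  using norm_cell_field_le[OF snd_zoom_unit_square] by (simp add: mix_field_def)

text \<open>Time reversal takes a flux \<open>(u, u b)\<close> to \<open>(u, - u b)\<close>, that is
  to \<open>- time_reflect\<close> of it at the reflected point. The two halves leave traces at time
  0 of opposite sign, and these cancel because reflection fixes the slice at time 0.\<close>

lemma integral_zoom_symmetrized:
  fixes V :: "real \<times> real \<times> real \<Rightarrow> real \<times> real \<times> real"
  assumes Vm[measurable]: "V \<in> borel_measurable borel" and bV: "\<And>z. snd z \<in> unit_square \<Longrightarrow> norm (V z) \<le> M"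
    and cell: "\<And>\<phi> G. C1_grad \<phi> G \<Longrightarrow>
      (LINT z|lborel. indicator ({0..<1/2} \<times> unit_square) z * (V z \<bullet> G z)) =
      e * ((LINT p|lborel. indicator unit_square p * (finer_stripe p * \<phi> (1/2, p))) -
           (LINT p|lborel. indicator unit_square p * (stripe p * \<phi> (0, p))))"
    and W: "\<And>z. 0 \<le> fst z \<Longrightarrow> W z = V (zoom z)" "\<And>z. fst z < 0 \<Longrightarrow> W z = - time_reflect (V (zoom (time_reflect z)))"
  shows "weak_div_free (\<lambda>z. indicator (box (-1, 0, 0) (1, 1, 1)) z *\<^sub>R W z)"
  unfolding weak_div_free_def
proof (intro allI impI)
  fix \<phi> G assume \<phi>: "C1_grad \<phi> (G :: real \<times> real \<times> real \<Rightarrow> _)"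
  let ?\<psi> = "\<lambda>z. \<phi> (time_reflect z)" and ?H = "\<lambda>z. time_reflect (G (time_reflect z))"
  note \<psi> = C1_grad_time_reflect[OF \<phi>]
  note [measurable] = C1_grad_measurable[OF \<phi>] C1_grad_measurable[OF \<psi>]
  define f where "f z = indicator unit_cube z * (V (zoom z) \<bullet> G z)" for z
  define h where "h z = indicator unit_cube z * (V (zoom z) \<bullet> ?H z)" for z
  have Wm[measurable]: "W \<in> borel_measurable borel"
  proof -
    have "W = (\<lambda>z. if 0 \<le> fst z then V (zoom z) else - time_reflect (V (zoom (time_reflect z))))"
      using W by (auto simp: fun_eq_iff)
    then show ?thesis by simp
  qed
  have int: "integrable lborel (\<lambda>z. indicator unit_cube z * (V (zoom z) \<bullet> K z))"
    if "continuous_on UNIV K" for K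
  proof -
    have "integrable lborel (\<lambda>z. (indicator unit_cube z *\<^sub>R V (zoom z)) \<bullet> K z)"
    proof (rule integrable_inner_continuous[OF _ _ _ that])
      show "norm (indicator unit_cube z *\<^sub>R V (zoom z)) \<le> \<bar>M\<bar>" for z
        using bV[OF snd_zoom_unit_square, of z] by (auto simp: indicator_def)
      show "indicator unit_cube z *\<^sub>R V (zoom z) = 0" if "z \<notin> cbox (0, 0, 0) (1, 1, 1)" for z
        using that by (cases z) (auto simp: indicator_def cbox_Pair_eq)
    qed measurable
    then show ?thesis by simp
  qed
  have fi: "integrable lborel f" and hi: "integrable lborel h"
    unfolding f_def h_def by (intro int C1_grad_continuous(2)[OF \<phi>] C1_grad_continuous(2)[OF \<psi>])+
  have hri: "integrable lborel (\<lambda>z. h (time_reflect z))"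
    by (rule integrable_distr[where M'=borel and T=time_reflect]) (auto simp: lborel_time_reflect hi)
  have "AE z in (lborel :: (real \<times> real \<times> real) measure). fst z \<noteq> 0 \<and> fst (snd z) \<noteq> 0 \<and> snd (snd z) \<noteq> 0"
    using AE_hyperplane[of "(1, 0, 0) :: real \<times> real \<times> real" 0] AE_hyperplane[of "(0, 1, 0) :: real \<times> real \<times> real" 0]
      AE_hyperplane[of "(0, 0, 1) :: real \<times> real \<times> real" 0] by (simp add: Basis_prod_def inner_prod_def zero_prod_def)
  \<comment> \<open>The box is open and the cube half-open; they are compared off the coordinate
    planes.\<close>
  then have "AE z in lborel. (indicator (box (-1, 0, 0) (1, 1, 1)) z *\<^sub>R W z) \<bullet> G z = f z - h (time_reflect z)"
  proof eventually_elim
    case (elim z)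
    have "z \<in> box (-1, 0, 0) (1, 1, 1) \<longleftrightarrow> z \<in> unit_cube \<or> time_reflect z \<in> unit_cube"
      using elim by (cases z) (auto simp: box_Times time_reflect_def)
    moreover have "\<not> (z \<in> unit_cube \<and> time_reflect z \<in> unit_cube)"
      using elim by (cases z) (auto simp: time_reflect_def)
    moreover have "fst z < 0" if "time_reflect z \<in> unit_cube"
      using elim that by (cases z) (auto simp: time_reflect_def)
    moreover have "(- time_reflect a) \<bullet> b = - (a \<bullet> time_reflect b)" for a b :: "real \<times> real \<times> real"
      by (simp add: time_reflect_def inner_prod_def)
    ultimately show ?case
      by (auto simp: f_def h_def indicator_def W)
  qed
  then have "(LINT z|lborel. (indicator (box (-1, 0, 0) (1, 1, 1)) z *\<^sub>R W z) \<bullet> G z) = (LINT z|lborel. f z - h (time_reflect z))"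
    using fi hri by (intro integral_cong_AE) auto
  also have "\<dots> = (LINT z|lborel. f z) - (LINT z|lborel. h (time_reflect z))"
    by (rule Bochner_Integration.integral_diff[OF fi hri])
  also have "(LINT z|lborel. h (time_reflect z)) = (LINT z|lborel. h z)"
    using hi by (intro integral_time_reflect) auto
  also have "(LINT z|lborel. f z) = - e * (LINT p|lborel. indicator unit_square p * (stripe p * \<phi> (0, p)))"
    unfolding f_def by (rule integral_zoom[OF Vm bV cell \<phi>])
  also have "(LINT z|lborel. h z) = - e * (LINT p|lborel. indicator unit_square p * (stripe p * ?\<psi> (0, p)))"
    unfolding h_def by (rule integral_zoom[OF Vm bV cell \<psi>])
  also have "- e * (LINT p|lborel. indicator unit_square p * (stripe p * \<phi> (0, p))) - \<dots> = 0"
    by (simp add: time_reflect_def)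
  finally show "(LINT z|lborel. (indicator (box (-1, 0, 0) (1, 1, 1)) z *\<^sub>R W z) \<bullet> G z) = 0" .
qed

lemma weak_div_free_mix:
  "weak_div_free (\<lambda>z. indicator (box (-1, 0, 0) (1, 1, 1)) z *\<^sub>R (mix_density z, mix_density z *\<^sub>R mix_field z))"
  "weak_div_free (\<lambda>z. indicator (box (-1, 0, 0) (1, 1, 1)) z *\<^sub>R (0, mix_field z))"
proof -
  show "weak_div_free (\<lambda>z. indicator (box (-1, 0, 0) (1, 1, 1)) z *\<^sub>R (mix_density z, mix_density z *\<^sub>R mix_field z))"
  proof (rule integral_zoom_symmetrized[where V="\<lambda>z. cell_density z *\<^sub>R (1, cell_field z)" and M=5 and e=1])
    fix z :: "real \<times> real \<times> real" assume "snd z \<in> unit_square"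
    then have "norm (1::real, cell_field z) \<le> 5"
      using norm_Pair_le[of "1::real" "cell_field z"] norm_cell_field_le[of z] by simp
    then show "norm (cell_density z *\<^sub>R (1::real, cell_field z)) \<le> 5"
      using cell_density_cases[of z] by (auto simp del: scaleR_Pair)
  next
    fix \<phi> and G :: "real \<times> real \<times> real \<Rightarrow> real \<times> real \<times> real" assume "C1_grad \<phi> G"
    from integral_cell(2)[OF this, of "\<lambda>x. x"]
    show "(LINT z|lborel. indicator ({0..<1/2} \<times> unit_square) z * ((cell_density z *\<^sub>R (1, cell_field z)) \<bullet> G z)) =
      1 * ((LINT p|lborel. indicator unit_square p * (finer_stripe p * \<phi> (1/2, p))) -
           (LINT p|lborel. indicator unit_square p * (stripe p * \<phi> (0, p))))"
      by (simp add: mult.assoc del: scaleR_Pair)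
  qed (auto simp: mix_density_def mix_field_def time_reflect_def)
  show "weak_div_free (\<lambda>z. indicator (box (-1, 0, 0) (1, 1, 1)) z *\<^sub>R (0, mix_field z))"
  proof (rule integral_zoom_symmetrized[where V="\<lambda>z. (0, cell_field z)" and M=4 and e=0])
    show "norm (0::real, cell_field z) \<le> 4" if "snd z \<in> unit_square" for z
      using norm_cell_field_le[OF that] by (simp add: norm_Pair)
  next
    fix \<phi> and G :: "real \<times> real \<times> real \<Rightarrow> real \<times> real \<times> real" assume \<phi>: "C1_grad \<phi> G"
    note [measurable] = C1_grad_measurable[OF \<phi>]
    have ind: "indicator unit_square p = (0::real)" if "p \<notin> cbox (0, 0) (1, 1)" for p :: "real \<times> real"
      using that by (cases p) (auto simp: cbox_Pair_eq indicator_def)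
    have 1: "indicator unit_square \<in> borel_measurable (borel :: (real \<times> real) measure)" by measurable
    have 2: "\<bar>indicator unit_square p\<bar> \<le> (1::real)" for p :: "real \<times> real" by (simp add: indicator_def)
    note c = integral_cell[OF \<phi>, of "\<lambda>x. 1", OF borel_measurable_const]
    have s: "integrable lborel (\<lambda>z. ((indicator {0..<1/2} (fst z) * indicator unit_square (snd z)) *\<^sub>R (1::real, 0::real \<times> real)) \<bullet> G z)"
      "(LINT z|lborel. ((indicator {0..<1/2} (fst z) * indicator unit_square (snd z)) *\<^sub>R (1::real, 0::real \<times> real)) \<bullet> G z) =
        (LINT p|lborel. indicator unit_square p * \<phi> (1/2, p)) - (LINT p|lborel. indicator unit_square p * \<phi> (0, p))"
      by (rule integral_static[OF \<phi> 1 2]; rule ind; assumption)+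
    \<comment> \<open>The flux \<open>(0, b)\<close> is \<open>(1, b)\<close> minus
      \<open>(1, 0)\<close>. By the case \<open>H = 1\<close> both have the same end traces, which
      expresses that the flow preserves area.\<close>
    have "(LINT z|lborel. indicator ({0..<1/2} \<times> unit_square) z * ((0, cell_field z) \<bullet> G z)) =
      (LINT z|lborel. ((indicator ({0..<1/2} \<times> unit_square) z * 1) *\<^sub>R (1, cell_field z)) \<bullet> G z -
         ((indicator {0..<1/2} (fst z) * indicator unit_square (snd z)) *\<^sub>R (1, 0)) \<bullet> G z)"
      by (intro Bochner_Integration.integral_cong) (auto simp: indicator_def inner_prod_def algebra_simps)
    also have "\<dots> = 0"
      unfolding Bochner_Integration.integral_diff[OF c(1) s(1)] c(2) s(2) by simp
    finally show "(LINT z|lborel. indicator ({0..<1/2} \<times> unit_square) z * ((0, cell_field z) \<bullet> G z)) =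
      0 * ((LINT p|lborel. indicator unit_square p * (finer_stripe p * \<phi> (1/2, p))) -
           (LINT p|lborel. indicator unit_square p * (stripe p * \<phi> (0, p))))"
      by simp
  qed (auto simp: mix_field_def time_reflect_def)
qed

section \<open>Lifting the planar block to higher space dimension\<close>

definition coords :: "'d::finite \<Rightarrow> 'd \<Rightarrow> real \<times> (real^'d) \<Rightarrow> real \<times> real \<times> real" where
  "coords i j z = (fst z, snd z $ i, snd z $ j)"

definition lift_vec :: "'d::finite \<Rightarrow> 'd \<Rightarrow> real \<times> real \<Rightarrow> real^'d" where
  "lift_vec i j p = fst p *\<^sub>R axis i 1 + snd p *\<^sub>R axis j 1"

text \<open>Reassembles a point from its time, its coordinates \<open>i\<close> and
  \<open>j\<close>, and the remaining ones. The values of \<open>f\<close> at \<open>i\<close> and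
  \<open>j\<close> are masked, since points of the product over \<open>UNIV - {i, j}\<close> are
  undefined there.\<close>

definition fill_coords :: "'d::finite \<Rightarrow> 'd \<Rightarrow> (real \<times> real \<times> real) \<times> ('d \<Rightarrow> real) \<Rightarrow> real \<times> (real^'d)" where
  "fill_coords i j = (\<lambda>(z, f). (fst z, lift_vec i j (snd z) + (\<chi> k. if k \<in> {i, j} then 0 else f k)))"

lemma lift_vec_nth: "i \<noteq> j \<Longrightarrow> lift_vec i j p $ k = (if k = i then fst p else if k = j then snd p else 0)"
  by (auto simp: lift_vec_def axis_def)

lemma norm_lift_vec_le: "norm (lift_vec i j p) \<le> 2 * norm p"
proof -
  have "norm (lift_vec i j p) \<le> \<bar>fst p\<bar> + \<bar>snd p\<bar>"
    unfolding lift_vec_def by (rule order_trans[OF norm_triangle_ineq]) (simp add: norm_axis_1)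
  moreover have "\<bar>fst p\<bar> \<le> norm p" "\<bar>snd p\<bar> \<le> norm p"
    using norm_fst_le[of "fst p" "snd p"] norm_snd_le[of "snd p" "fst p"] by simp_all
  ultimately show ?thesis by linarith
qed

lemma lift_vec_scaleR: "lift_vec i j (c *\<^sub>R p) = c *\<^sub>R lift_vec i j p"
  by (simp add: lift_vec_def scaleR_add_right)

lemma fill_coords_nth:
  "i \<noteq> j \<Longrightarrow> snd (fill_coords i j (z, f)) $ k = (if k = i then fst (snd z) else if k = j then snd (snd z) else f k)"
  by (simp add: fill_coords_def lift_vec_nth)

lemma all_three_cases:
  assumes "i \<noteq> j"
  shows "(\<forall>k. P k (if k = i then a else if k = j then b else f k)) \<longleftrightarrow> P i a \<and> P j b \<and> (\<forall>k. k \<notin> {i, j} \<longrightarrow> P k (f k))"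
    (is "(\<forall>k. ?Q k) \<longleftrightarrow> _")
proof
  assume "\<forall>k. ?Q k"
  then have *: "?Q k" for k by blast
  show "P i a \<and> P j b \<and> (\<forall>k. k \<notin> {i, j} \<longrightarrow> P k (f k))"
  proof (intro conjI allI impI)
    show "P i a" using *[of i] by simp
    show "P j b" using *[of j] assms by simp
    show "P k (f k)" if "k \<notin> {i, j}" for k using *[of k] that by simp
  qed
qed auto

lemma coords_fill_coords: "i \<noteq> j \<Longrightarrow> coords i j (fill_coords i j (z, f)) = z"
  by (simp add: coords_def fill_coords_nth) (simp add: fill_coords_def)

lemma emeasure_lborel_box_Times:
  fixes a c :: "'a::euclidean_space" and b d :: "'b::euclidean_space"
  shows "emeasure lborel (box (a, b) (c, d)) = emeasure lborel (box a c) * emeasure lborel (box b d)"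
  by (simp add: box_Times lborel_prod[symmetric] lborel.emeasure_pair_measure_Times)

lemma emeasure_lborel_box_vec:
  fixes l u :: "real^'d::finite"
  assumes "\<And>k. l $ k \<le> u $ k"
  shows "emeasure lborel (box l u) = (\<Prod>k\<in>UNIV. ennreal (u $ k - l $ k))"
proof -
  have B: "(Basis :: (real^'d) set) = (\<lambda>k. axis k 1) ` UNIV"
    by (auto simp: Basis_vec_def)
  have "emeasure lborel (box l u) = ennreal (\<Prod>b\<in>Basis. (u - l) \<bullet> b)"
    by (rule emeasure_lborel_box) (use assms in \<open>auto simp: B inner_axis\<close>)
  also have "(\<Prod>b\<in>Basis. (u - l) \<bullet> b) = (\<Prod>k\<in>UNIV. u $ k - l $ k)"
    unfolding B by (subst prod.reindex) (auto simp: inj_on_def axis_eq_axis inner_axis)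
  finally show ?thesis using assms by (simp add: prod_ennreal)
qed

lemma measurable_fill_coords[measurable]:
  fixes i j :: "'d::finite"
  assumes "i \<noteq> j"
  shows "fill_coords i j \<in> lborel \<Otimes>\<^sub>M (\<Pi>\<^sub>M k\<in>UNIV - {i, j}. lborel) \<rightarrow>\<^sub>M borel"
proof -
  have comp: "(\<lambda>w. snd w k) \<in> borel_measurable (lborel \<Otimes>\<^sub>M (\<Pi>\<^sub>M k\<in>UNIV - {i, j}. lborel))" if "k \<noteq> i" "k \<noteq> j" for k
  proof -
    have "(\<lambda>f. f k) \<in> (\<Pi>\<^sub>M k\<in>UNIV - {i, j}. lborel) \<rightarrow>\<^sub>M lborel"
      using that by (intro measurable_component_singleton) auto
    from measurable_compose[OF measurable_snd this] show ?thesis by simp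
  qed
  have "(\<lambda>w. snd (fill_coords i j w)) \<in> borel_measurable (lborel \<Otimes>\<^sub>M (\<Pi>\<^sub>M k\<in>UNIV - {i, j}. lborel))"
  proof (subst borel_measurable_euclidean_space, intro ballI)
    fix e :: "real^'d" assume "e \<in> Basis"
    then obtain k where e: "e = axis k 1" by (auto simp: Basis_vec_def)
    have "(\<lambda>w. snd (fill_coords i j w) \<bullet> e) =
      (\<lambda>w. if k = i then fst (snd (fst w)) else if k = j then snd (snd (fst w)) else snd w k)"
    proof
      fix w show "snd (fill_coords i j w) \<bullet> e =
        (if k = i then fst (snd (fst w)) else if k = j then snd (snd (fst w)) else snd w k)"
        using fill_coords_nth[OF assms, of "fst w" "snd w" k] by (simp add: e inner_axis)
    qed
    also have "\<dots> \<in> borel_measurable (lborel \<Otimes>\<^sub>M (\<Pi>\<^sub>M k\<in>UNIV - {i, j}. lborel))"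
    proof (cases "k = i \<or> k = j")
      case True
      then show ?thesis using assms by (elim disjE) simp_all
    next
      case False
      then show ?thesis using comp by simp
    qed
    finally show "(\<lambda>w. snd (fill_coords i j w) \<bullet> e) \<in> borel_measurable (lborel \<Otimes>\<^sub>M (\<Pi>\<^sub>M k\<in>UNIV - {i, j}. lborel))" .
  qed
  moreover have "(\<lambda>w. fst (fill_coords i j w)) \<in> borel_measurable (lborel \<Otimes>\<^sub>M (\<Pi>\<^sub>M k\<in>UNIV - {i, j}. lborel))"
    by (simp add: fill_coords_def case_prod_beta)
  ultimately have "(\<lambda>w. (fst (fill_coords i j w), snd (fill_coords i j w))) \<in>
      borel_measurable (lborel \<Otimes>\<^sub>M (\<Pi>\<^sub>M k\<in>UNIV - {i, j}. lborel))"
    by (rule borel_measurable_Pair_borel[rotated])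
  then show ?thesis by simp
qed

text \<open>Lebesgue measure is determined by its values on boxes, and the preimage of a box is a
  three-dimensional box times a product of intervals.\<close>

lemma lborel_fill_coords:
  fixes i j :: "'d::finite"
  assumes ij: "i \<noteq> j"
  shows "(lborel :: (real \<times> (real^'d)) measure) =
    distr (lborel \<Otimes>\<^sub>M (\<Pi>\<^sub>M k\<in>UNIV - {i, j}. lborel)) borel (fill_coords i j)"
proof (rule lborel_eqI)
  let ?N = "\<Pi>\<^sub>M k\<in>UNIV - {i, j}. (lborel :: real measure)"
  interpret P: product_sigma_finite "\<lambda>_::'d. lborel :: real measure" ..
  interpret N: sigma_finite_measure ?N by (rule P.sigma_finite) simp
  fix l u :: "real \<times> (real^'d)" assume le: "\<And>b. b \<in> Basis \<Longrightarrow> l \<bullet> b \<le> u \<bullet> b"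
  obtain l0 lv u0 uv where lu: "l = (l0, lv)" "u = (u0, uv)" by (cases l; cases u)
  have lev: "lv $ k \<le> uv $ k" for k
    using le[of "(0, axis k 1)"] by (simp add: lu Basis_prod_def axis_in_Basis_iff inner_axis)
  let ?X = "box (l0, lv $ i, lv $ j) (u0, uv $ i, uv $ j) \<times> (\<Pi>\<^sub>E k\<in>UNIV - {i, j}. {lv $ k<..<uv $ k})"
  have "fill_coords i j -` box l u \<inter> space (lborel \<Otimes>\<^sub>M ?N) = ?X"
  proof (rule set_eqI)
    fix w :: "(real \<times> real \<times> real) \<times> ('d \<Rightarrow> real)"
    obtain t a b f where w: "w = ((t, a, b), f)" by (metis prod.exhaust)
    have "fill_coords i j w \<in> box l u \<longleftrightarrow> l0 < t \<and> t < u0 \<and>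
        (\<forall>k. lv $ k < snd (fill_coords i j w) $ k \<and> snd (fill_coords i j w) $ k < uv $ k)"
    proof -
      have "fill_coords i j w = (t, snd (fill_coords i j w))" by (simp add: w fill_coords_def)
      then have "fill_coords i j w \<in> box l u \<longleftrightarrow> (t, snd (fill_coords i j w)) \<in> box l0 u0 \<times> box lv uv"
        by (simp only: lu box_Times)
      then show ?thesis by (simp add: mem_box_cart)
    qed
    also have "(\<forall>k. lv $ k < snd (fill_coords i j w) $ k \<and> snd (fill_coords i j w) $ k < uv $ k) \<longleftrightarrow>
      lv $ i < a \<and> a < uv $ i \<and> lv $ j < b \<and> b < uv $ j \<and> (\<forall>k. k \<notin> {i, j} \<longrightarrow> lv $ k < f k \<and> f k < uv $ k)"
      unfolding w fill_coords_nth[OF ij] all_three_cases[OF ij, where P="\<lambda>k x. lv $ k < x \<and> x < uv $ k"]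
      by simp
    finally show "w \<in> fill_coords i j -` box l u \<inter> space (lborel \<Otimes>\<^sub>M ?N) \<longleftrightarrow> w \<in> ?X"
      by (auto simp: w box_Times space_pair_measure space_PiM PiE_iff)
  qed
  then have "emeasure (distr (lborel \<Otimes>\<^sub>M ?N) borel (fill_coords i j)) (box l u) = emeasure (lborel \<Otimes>\<^sub>M ?N) ?X"
    using ij by (subst emeasure_distr) auto
  also have "\<dots> = emeasure lborel (box (l0, lv $ i, lv $ j) (u0, uv $ i, uv $ j)) *
      emeasure ?N (\<Pi>\<^sub>E k\<in>UNIV - {i, j}. {lv $ k<..<uv $ k})"
    by (intro N.emeasure_pair_measure_Times sets_PiM_I_finite) auto
  also have "emeasure ?N (\<Pi>\<^sub>E k\<in>UNIV - {i, j}. {lv $ k<..<uv $ k}) = (\<Prod>k\<in>UNIV - {i, j}. ennreal (uv $ k - lv $ k))"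
    using lev by (subst P.emeasure_PiM) auto
  also have "emeasure lborel (box (l0, lv $ i, lv $ j) (u0, uv $ i, uv $ j)) =
      emeasure lborel (box l0 u0) * (ennreal (uv $ i - lv $ i) * ennreal (uv $ j - lv $ j))"
    using lev by (simp add: emeasure_lborel_box_Times)
  also have "\<dots> * (\<Prod>k\<in>UNIV - {i, j}. ennreal (uv $ k - lv $ k)) =
      emeasure lborel (box l0 u0) * (\<Prod>k\<in>UNIV. ennreal (uv $ k - lv $ k))"
  proof -
    have "(\<Prod>k\<in>UNIV. ennreal (uv $ k - lv $ k)) =
      ennreal (uv $ i - lv $ i) * (\<Prod>k\<in>UNIV - {i}. ennreal (uv $ k - lv $ k))"
      by (rule prod.remove) auto
    also have "(\<Prod>k\<in>UNIV - {i}. ennreal (uv $ k - lv $ k)) =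
      ennreal (uv $ j - lv $ j) * (\<Prod>k\<in>UNIV - {i} - {j}. ennreal (uv $ k - lv $ k))"
      using ij by (intro prod.remove) auto
    also have "UNIV - {i} - {j} = UNIV - {i, j}" by auto
    finally show ?thesis by (simp add: mult.assoc)
  qed
  also have "\<dots> = emeasure lborel (box l u)"
    using lev by (simp add: lu emeasure_lborel_box_Times emeasure_lborel_box_vec)
  also have "\<dots> = (\<Prod>b\<in>Basis. (u - l) \<bullet> b)"
    by (rule emeasure_lborel_box[OF le])
  finally show "emeasure (distr (lborel \<Otimes>\<^sub>M ?N) borel (fill_coords i j)) (box l u) = (\<Prod>b\<in>Basis. (u - l) \<bullet> b)" .
qed simp

lemma integral_zero_by_fibres:
  fixes F :: "real \<times> (real^'d::finite) \<Rightarrow> real"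
  assumes ij: "i \<noteq> j" and F: "integrable lborel F"
    and fibre: "\<And>f. (LINT z|lborel. F (fill_coords i j (z, f))) = 0"
  shows "(LINT z|lborel. F z) = 0"
proof -
  let ?N = "\<Pi>\<^sub>M k\<in>UNIV - {i, j}. (lborel :: real measure)"
  interpret P: product_sigma_finite "\<lambda>_::'d. lborel :: real measure" ..
  interpret N: sigma_finite_measure ?N by (rule P.sigma_finite) simp
  interpret Q: pair_sigma_finite "lborel :: (real \<times> real \<times> real) measure" ?N ..
  note [measurable] = measurable_fill_coords[OF ij] borel_measurable_integrable[OF F]
  have [measurable]: "F \<in> borel_measurable borel" using borel_measurable_integrable[OF F] by simp
  have "integrable (lborel \<Otimes>\<^sub>M ?N) (\<lambda>w. F (fill_coords i j w))"
    using F by (subst (asm) lborel_fill_coords[OF ij]) (rule integrable_distr[OF measurable_fill_coords[OF ij]])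
  then have int: "integrable (lborel \<Otimes>\<^sub>M ?N) (\<lambda>(z, f). F (fill_coords i j (z, f)))"
    by (simp add: case_prod_beta')
  have "(LINT z|lborel. F z) = (LINT w|(lborel \<Otimes>\<^sub>M ?N). F (fill_coords i j w))"
    by (subst lborel_fill_coords[OF ij], subst integral_distr) auto
  also have "\<dots> = (LINT f|?N. LINT z|lborel. F (fill_coords i j (z, f)))"
    using Q.integral_snd[OF int] by (simp add: case_prod_beta')
  finally show ?thesis by (simp add: fibre)
qed

lemma C1_grad_fibre:
  fixes \<phi> :: "real \<times> (real^'d::finite) \<Rightarrow> real"
  assumes "C1_grad \<phi> G"
  shows "C1_grad (\<lambda>z. \<phi> (fill_coords i j (z, f))) (\<lambda>z. coords i j (G (fill_coords i j (z, f))))"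
  unfolding C1_grad_def
proof (intro conjI allI)
  fix z :: "real \<times> real \<times> real"
  have 1: "((\<lambda>z. fill_coords i j (z, f)) has_derivative (\<lambda>h. (fst h, lift_vec i j (snd h)))) (at z)"
    unfolding fill_coords_def lift_vec_def by (auto intro!: derivative_eq_intros)
  have 2: "(\<phi> has_derivative (\<lambda>h. G (fill_coords i j (z, f)) \<bullet> h)) (at (fill_coords i j (z, f)))"
    using assms unfolding C1_grad_def by blast
  have 3: "g \<bullet> (fst h, lift_vec i j (snd h)) = coords i j g \<bullet> h" for g h
    by (simp add: coords_def inner_prod_def lift_vec_def inner_add_right inner_axis mult.commute)
  show "((\<lambda>z. \<phi> (fill_coords i j (z, f))) has_derivative
      (\<lambda>h. coords i j (G (fill_coords i j (z, f))) \<bullet> h)) (at z)"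
    using has_derivative_compose[OF 1 2] by (simp add: 3)
next
  have "continuous_on UNIV (\<lambda>z. fill_coords i j (z, f))"
    unfolding fill_coords_def lift_vec_def by (auto intro!: continuous_intros)
  from continuous_on_compose2[OF C1_grad_continuous(2)[OF assms] this]
  show "continuous_on UNIV (\<lambda>z. coords i j (G (fill_coords i j (z, f))))"
    unfolding coords_def by (auto intro!: continuous_intros)
qed

lemma measurable_coords[measurable]: "coords i j \<in> borel_measurable borel"
  unfolding coords_def by (intro borel_measurable_continuous_onI continuous_intros)

lemma measurable_lift_vec[measurable]: "lift_vec i j \<in> borel_measurable borel"
  unfolding lift_vec_def by (intro borel_measurable_continuous_onI continuous_intros)

text \<open>The lifted field has no component in the remaining directions and, within the box, does
  not depend on them. On each slice it therefore meets only the planar part of the gradient, which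
  is the gradient of the restricted test function; Fubini finishes.\<close>

lemma weak_div_free_lift:
  fixes V :: "real \<times> real \<times> real \<Rightarrow> real \<times> real \<times> real" and i j :: "'d::finite"
  assumes ij: "i \<noteq> j" and [measurable]: "V \<in> borel_measurable borel" and V: "\<And>z. norm (V z) \<le> M"
    and df: "weak_div_free (\<lambda>z. indicator (box (-1, 0, 0) (1, 1, 1)) z *\<^sub>R V z)"
  shows "weak_div_free (\<lambda>z. indicator (box (-1, 0) (1, 1)) z *\<^sub>R
    (fst (V (coords i j z)), lift_vec i j (snd (V (coords i j z)))))"
  unfolding weak_div_free_def
proof (intro allI impI)
  fix \<phi> and G :: "real \<times> (real^'d) \<Rightarrow> real \<times> (real^'d)" assume \<phi>: "C1_grad \<phi> G"
  note [measurable] = C1_grad_measurable[OF \<phi>]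
  let ?W = "\<lambda>z::real \<times> (real^'d). (fst (V (coords i j z)), lift_vec i j (snd (V (coords i j z))))"
  have W: "norm (?W z) \<le> 3 * M" for z
  proof -
    have "norm (lift_vec i j p) \<le> 2 * norm p" for p by (rule norm_lift_vec_le)
    moreover have "norm (?W z) \<le> norm (fst (V (coords i j z))) + norm (lift_vec i j (snd (V (coords i j z))))"
      by (rule norm_Pair_le)
    moreover have "norm (fst v) \<le> norm v" "norm (snd v) \<le> norm v" for v :: "real \<times> real \<times> real"
      using norm_fst_le[of "fst v" "snd v"] norm_snd_le[of "snd v" "fst v"] by simp_all
    ultimately have "norm (?W z) \<le> norm (V (coords i j z)) + 2 * norm (V (coords i j z))"
      by (meson add_mono mult_left_mono order_trans zero_le_numeral)
    then show ?thesis using V[of "coords i j z"] by simp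
  qed
  have M0: "0 \<le> M" using V[of 0] norm_ge_zero order_trans by blast
  show "(LINT z|lborel. (indicator (box (-1, 0) (1, 1)) z *\<^sub>R ?W z) \<bullet> G z) = 0"
  proof (rule integral_zero_by_fibres[OF ij])
    show "integrable lborel (\<lambda>z. (indicator (box (-1, 0) (1, 1)) z *\<^sub>R ?W z) \<bullet> G z)"
    proof (rule integrable_inner_continuous[OF _ _ _ C1_grad_continuous(2)[OF \<phi>]])
      show "norm (indicator (box (-1, 0) (1, 1)) z *\<^sub>R ?W z) \<le> 3 * M" for z
        using W[of z] M0 by (simp add: indicator_def del: scaleR_Pair)
      show "indicator (box (-1, 0) (1, 1)) z *\<^sub>R ?W z = 0" if "z \<notin> cbox (-1, 0) (1, 1)" for z
        using that box_subset_cbox[of "(-1, 0)" "(1, 1)"] by (auto simp: indicator_def simp del: scaleR_Pair)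
    qed measurable
  next
    fix f :: "'d \<Rightarrow> real"
    \<comment> \<open>On a slice the box is either absent or the full planar box; this constant
      tells which.\<close>
    define \<chi>f :: real where "\<chi>f = (if \<forall>k. k \<notin> {i, j} \<longrightarrow> 0 < f k \<and> f k < 1 then 1 else 0)"
    have ind: "indicator (box (-1, 0) (1, 1)) (fill_coords i j (z, f)) = \<chi>f * indicator (box (-1, 0, 0) (1, 1, 1)) z" for z
    proof -
      have "fill_coords i j (z, f) \<in> box (-1, 0) (1, 1) \<longleftrightarrow>
        -1 < fst z \<and> fst z < 1 \<and> (\<forall>k. 0 < snd (fill_coords i j (z, f)) $ k \<and> snd (fill_coords i j (z, f)) $ k < 1)"
      proof -
        have "fill_coords i j (z, f) = (fst z, snd (fill_coords i j (z, f)))" by (simp add: fill_coords_def)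
        then have "fill_coords i j (z, f) \<in> box (-1, 0) (1, 1) \<longleftrightarrow>
            (fst z, snd (fill_coords i j (z, f))) \<in> box (-1) 1 \<times> box 0 1"
          by (simp only: box_Times)
        then show ?thesis by (simp add: mem_box_cart)
      qed
      also have "(\<forall>k. 0 < snd (fill_coords i j (z, f)) $ k \<and> snd (fill_coords i j (z, f)) $ k < 1) \<longleftrightarrow>
        0 < fst (snd z) \<and> fst (snd z) < 1 \<and> 0 < snd (snd z) \<and> snd (snd z) < 1 \<and> (\<forall>k. k \<notin> {i, j} \<longrightarrow> 0 < f k \<and> f k < 1)"
        unfolding fill_coords_nth[OF ij] all_three_cases[OF ij, where P="\<lambda>k x. 0 < x \<and> x < 1"] by simp
      finally show ?thesis by (cases z) (auto simp: \<chi>f_def indicator_def box_Times)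
    qed
    have "(LINT z|lborel. (indicator (box (-1, 0) (1, 1)) (fill_coords i j (z, f)) *\<^sub>R ?W (fill_coords i j (z, f))) \<bullet> G (fill_coords i j (z, f))) =
      (LINT z|lborel. \<chi>f * ((indicator (box (-1, 0, 0) (1, 1, 1)) z *\<^sub>R V z) \<bullet> coords i j (G (fill_coords i j (z, f)))))"
    proof (rule Bochner_Integration.integral_cong[OF refl])
      fix z
      have "(fst v, lift_vec i j (snd v)) \<bullet> g = v \<bullet> coords i j g" for v g
        by (simp add: coords_def inner_prod_def lift_vec_def inner_add_left inner_axis' mult.commute)
      then show "(indicator (box (-1, 0) (1, 1)) (fill_coords i j (z, f)) *\<^sub>R ?W (fill_coords i j (z, f))) \<bullet> G (fill_coords i j (z, f)) =
        \<chi>f * ((indicator (box (-1, 0, 0) (1, 1, 1)) z *\<^sub>R V z) \<bullet> coords i j (G (fill_coords i j (z, f))))"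
        by (simp add: ind coords_fill_coords[OF ij] del: scaleR_Pair)
    qed
    also have "\<dots> = 0"
      using df C1_grad_fibre[OF \<phi>, of i j f] unfolding weak_div_free_def by (simp del: inner_scaleR_left)
    finally show "(LINT z|lborel. (indicator (box (-1, 0) (1, 1)) (fill_coords i j (z, f)) *\<^sub>R ?W (fill_coords i j (z, f))) \<bullet> G (fill_coords i j (z, f))) = 0" .
  qed
qed

section \<open>Solutions with prescribed energy\<close>

lemma weak_div_free_add_scaled:
  fixes V W :: "'a::euclidean_space \<Rightarrow> 'a"
  assumes V: "weak_div_free V" and W: "weak_div_free W"
    and [measurable]: "V \<in> borel_measurable borel" "W \<in> borel_measurable borel"
    and bdd: "bounded (range V)" "bounded (range W)"
    and supp: "\<And>z. z \<notin> cbox a b \<Longrightarrow> V z = 0" "\<And>z. z \<notin> cbox a b \<Longrightarrow> W z = 0"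
  shows "weak_div_free (\<lambda>z. V z + c *\<^sub>R W z)"
  unfolding weak_div_free_def
proof (intro allI impI)
  fix \<phi> and G :: "'a \<Rightarrow> 'a" assume \<phi>: "C1_grad \<phi> G"
  obtain M N where M: "\<And>z. norm (V z) \<le> M" "\<And>z. norm (W z) \<le> N"
    using bdd by (auto simp: bounded_iff)
  have i: "integrable lborel (\<lambda>z. V z \<bullet> G z)" "integrable lborel (\<lambda>z. W z \<bullet> G z)"
    using integrable_inner_continuous[OF _ M(1) supp(1) C1_grad_continuous(2)[OF \<phi>]]
      integrable_inner_continuous[OF _ M(2) supp(2) C1_grad_continuous(2)[OF \<phi>]] by simp_all
  then show "(LINT z|lborel. (V z + c *\<^sub>R W z) \<bullet> G z) = 0"
    using V W \<phi> by (simp add: inner_add_left weak_div_free_def)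
qed

lemma weak_div_free_translate:
  fixes V :: "'a::euclidean_space \<Rightarrow> 'a"
  assumes V: "weak_div_free V" and [measurable]: "V \<in> borel_measurable borel"
  shows "weak_div_free (\<lambda>z. V (z - c))"
  unfolding weak_div_free_def
proof (intro allI impI)
  fix \<phi> and G :: "'a \<Rightarrow> 'a" assume \<phi>: "C1_grad \<phi> G"
  note [measurable] = C1_grad_measurable[OF \<phi>]
  have "(LINT z|lborel. V (z - c) \<bullet> G z) = 1 ^ DIM('a) * (LINT z|lborel. V (c + 1 *\<^sub>R z - c) \<bullet> G (c + 1 *\<^sub>R z))"
    by (rule integral_lborel_affine) auto
  also have "\<dots> = (LINT z|lborel. V z \<bullet> (1 *\<^sub>R G (c + 1 *\<^sub>R z)))" by simp
  also have "\<dots> = 0"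
    using V C1_grad_affine[OF \<phi>, of c 1] unfolding weak_div_free_def by blast
  finally show "(LINT z|lborel. V (z - c) \<bullet> G z) = 0" .
qed

section \<open>From weak divergence-freeness to the distributional equations\<close>

lemma C1_grad_test_function:
  fixes \<phi> :: "real \<times> (real^'d::finite) \<Rightarrow> real"
  assumes "test_function \<phi>"
  shows "C1_grad \<phi> (\<lambda>z. (time_deriv \<phi> z, space_grad \<phi> z))"
  unfolding C1_grad_def
proof (intro conjI allI)
  have C: "C_k (Suc 0) \<phi>" using assms by (simp only: test_function_def)
  have t: "(1, 0) \<in> (Basis :: (real \<times> (real^'d)) set)" by (simp add: Basis_prod_def)
  have x: "(0, axis k 1) \<in> (Basis :: (real \<times> (real^'d)) set)" for k
    by (simp add: Basis_prod_def axis_in_Basis_iff)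
  have c: "continuous_on UNIV (\<lambda>z. frechet_derivative \<phi> (at z) e)" if "e \<in> Basis" for e
    using C that by simp
  show "continuous_on UNIV (\<lambda>z. (time_deriv \<phi> z, space_grad \<phi> z))"
    unfolding time_deriv_def space_grad_def
    by (intro continuous_on_Pair continuous_on_vec_lambda c t x)
  fix z
  have d: "(\<phi> has_derivative frechet_derivative \<phi> (at z)) (at z)"
    using C unfolding C_k.simps frechet_derivative_works by blast
  have lin: "linear (frechet_derivative \<phi> (at z))"
    using d has_derivative_linear by blast
  have "frechet_derivative \<phi> (at z) = (\<lambda>h. (time_deriv \<phi> z, space_grad \<phi> z) \<bullet> h)"
  proof (rule ext)
    fix h :: "real \<times> (real^'d)"
    have "snd h = (\<Sum>k\<in>UNIV. (snd h $ k) *\<^sub>R axis k 1)"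
      by (simp add: vec_eq_iff axis_def if_distrib[where f="\<lambda>x. _ * x"] cong: if_cong)
    then have "h = fst h *\<^sub>R (1, 0) + (\<Sum>k\<in>UNIV. (snd h $ k) *\<^sub>R (0, axis k 1))"
      by (simp add: prod_eq_iff fst_sum snd_sum)
    then have "frechet_derivative \<phi> (at z) h =
      frechet_derivative \<phi> (at z) (fst h *\<^sub>R (1, 0) + (\<Sum>k\<in>UNIV. (snd h $ k) *\<^sub>R (0, axis k 1)))"
      by simp
    also have "\<dots> = fst h * time_deriv \<phi> z + (\<Sum>k\<in>UNIV. (snd h $ k) * frechet_derivative \<phi> (at z) (0, axis k 1))"
      by (simp only: linear_add[OF lin] linear_sum[OF lin] linear_scale[OF lin] time_deriv_def real_scaleR_def)
    also have "\<dots> = (time_deriv \<phi> z, space_grad \<phi> z) \<bullet> h"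
      by (simp add: inner_prod_def inner_vec_def space_grad_def mult.commute)
    finally show "frechet_derivative \<phi> (at z) h = (time_deriv \<phi> z, space_grad \<phi> z) \<bullet> h" .
  qed
  with d show "(\<phi> has_derivative (\<lambda>h. (time_deriv \<phi> z, space_grad \<phi> z) \<bullet> h)) (at z)"
    by simp
qed

lemma distributional_continuity_eq_if_weak_div_free:
  fixes u :: "real \<times> (real^'d::finite) \<Rightarrow> real" and b :: "real \<times> (real^'d) \<Rightarrow> real^'d"
  assumes [measurable]: "u \<in> borel_measurable borel" "b \<in> borel_measurable borel"
    and df: "weak_div_free (\<lambda>z. (u z, u z *\<^sub>R b z))"
  shows "distributional_continuity_eq u b"
  unfolding distributional_continuity_eq_def
proof (intro allI impI)
  fix \<phi> :: "real \<times> (real^'d) \<Rightarrow> real" assume "test_function \<phi>"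
  note \<phi> = C1_grad_test_function[OF this]
  note [measurable] = C1_grad_measurable[OF \<phi>]
  let ?f = "\<lambda>z. (u z, u z *\<^sub>R b z) \<bullet> (time_deriv \<phi> z, space_grad \<phi> z)"
  have "(LINT z|lebesgue. u z * time_deriv \<phi> z + (u z *\<^sub>R b z) \<bullet> space_grad \<phi> z) = (LINT z|lebesgue. ?f z)"
    by (simp add: inner_prod_def)
  also have "\<dots> = (LINT z|lborel. ?f z)"
    by (rule integral_completion) measurable
  also have "\<dots> = 0" using df \<phi> unfolding weak_div_free_def by blast
  finally show "(LINT z|lebesgue. u z * time_deriv \<phi> z + (u z *\<^sub>R b z) \<bullet> space_grad \<phi> z) = 0" .
qed

lemma distributional_div_free_if_weak_div_free:
  fixes b :: "real \<times> (real^'d::finite) \<Rightarrow> real^'d"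
  assumes [measurable]: "b \<in> borel_measurable borel" and df: "weak_div_free (\<lambda>z. (0, b z))"
  shows "distributional_div_free b"
  unfolding distributional_div_free_def
proof (intro allI impI)
  fix \<phi> :: "real \<times> (real^'d) \<Rightarrow> real" assume "test_function \<phi>"
  note \<phi> = C1_grad_test_function[OF this]
  note [measurable] = C1_grad_measurable[OF \<phi>]
  let ?f = "\<lambda>z. (0, b z) \<bullet> (time_deriv \<phi> z, space_grad \<phi> z)"
  have "(LINT z|lebesgue. b z \<bullet> space_grad \<phi> z) = (LINT z|lebesgue. ?f z)"
    by (simp add: inner_prod_def)
  also have "\<dots> = (LINT z|lborel. ?f z)"
    by (rule integral_completion) measurable
  also have "\<dots> = 0" using df \<phi> unfolding weak_div_free_def by blast
  finally show "(LINT z|lebesgue. b z \<bullet> space_grad \<phi> z) = 0" .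
qed

section \<open>Assembling the solutions\<close>

lemma compactly_supported_if_zero_outside:
  fixes f :: "'a::euclidean_space \<Rightarrow> 'b::zero"
  assumes "\<And>z. z \<notin> cbox a b \<Longrightarrow> f z = 0"
  shows "compactly_supported f"
proof -
  have "{z. f z \<noteq> 0} \<subseteq> cbox a b" using assms by blast
  then have "bounded {z. f z \<noteq> 0}" by (rule bounded_subset[OF bounded_cbox])
  then show ?thesis by (simp add: compactly_supported_def compact_closure)
qed

text \<open>The dimension bound enters here: it supplies two distinct coordinates for the planar
  mixer.\<close>

lemma mixing_block:
  assumes "CARD('d::finite) \<ge> 2"
  obtains u :: "real \<times> (real^'d) \<Rightarrow> real" and b :: "real \<times> (real^'d) \<Rightarrow> real^'d" and M
  where "u \<in> borel_measurable borel" "b \<in> borel_measurable borel"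
    "\<And>z. u z = 1 \<or> u z = -1" "\<And>z. norm (b z) \<le> M"
    "weak_div_free (\<lambda>z. indicator (box (-1, 0) (1, 1)) z *\<^sub>R (u z, u z *\<^sub>R b z))"
    "weak_div_free (\<lambda>z. indicator (box (-1, 0) (1, 1)) z *\<^sub>R (0, b z))"
proof -
  have "\<not> (\<forall>i j :: 'd. i = j)"
    using card_le_Suc0_iff_eq[of "UNIV :: 'd set"] assms by auto
  then obtain i j :: 'd where ij: "i \<noteq> j" by blast
  define u :: "real \<times> (real^'d) \<Rightarrow> real" where "u z = mix_density (coords i j z)" for z
  define b :: "real \<times> (real^'d) \<Rightarrow> real^'d" where "b z = lift_vec i j (mix_field (coords i j z))" for z
  have bV: "norm (mix_density z, mix_density z *\<^sub>R mix_field z) \<le> 5" "norm (0::real, mix_field z) \<le> 5" for z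
  proof -
    have "norm (mix_density z, mix_density z *\<^sub>R mix_field z) \<le> \<bar>mix_density z\<bar> + \<bar>mix_density z\<bar> * norm (mix_field z)"
      using norm_Pair_le[of "mix_density z" "mix_density z *\<^sub>R mix_field z"] by simp
    moreover have "\<bar>mix_density z\<bar> = 1" using mix_density_cases[of z] by auto
    ultimately show "norm (mix_density z, mix_density z *\<^sub>R mix_field z) \<le> 5"
      using norm_mix_field_le[of z] by simp
    show "norm (0::real, mix_field z) \<le> 5"
      using norm_mix_field_le[of z] by (simp add: norm_Pair)
  qed
  show ?thesis
  proof (rule that[of u b 8])
    show "u \<in> borel_measurable borel" "b \<in> borel_measurable borel"
      unfolding u_def b_def by measurable
    show "u z = 1 \<or> u z = -1" for z
      unfolding u_def by (rule mix_density_cases)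
    show "norm (b z) \<le> 8" for z
      using norm_lift_vec_le[of i j "mix_field (coords i j z)"] norm_mix_field_le[of "coords i j z"] by (simp add: b_def)
    show "weak_div_free (\<lambda>z. indicator (box (-1, 0) (1, 1)) z *\<^sub>R (u z, u z *\<^sub>R b z))"
      using weak_div_free_lift[OF ij _ bV(1) weak_div_free_mix(1)]
      by (simp add: u_def b_def lift_vec_scaleR del: scaleR_Pair)
    show "weak_div_free (\<lambda>z. indicator (box (-1, 0) (1, 1)) z *\<^sub>R (0, b z))"
      using weak_div_free_lift[OF ij _ bV(2) weak_div_free_mix(2)]
      by (simp add: b_def del: scaleR_Pair)
  qed
qed

text \<open>Continuity of \<open>E\<close> on \<open>I\<close> makes the condition
  \<open>x $ i < E t\<close> open. A time with \<open>E t = 0\<close> has an empty slice, in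
  accordance with its energy.\<close>

lemma energy_domain:
  fixes E :: "real \<Rightarrow> real" and i :: "'d::finite"
  assumes I: "open I" "bounded I" and E: "\<And>t. 0 \<le> E t" "bounded (range E)" "continuous_on I E"
  defines "\<Omega> \<equiv> {z :: real \<times> (real^'d). fst z \<in> I \<and> snd z \<in> box 0 (\<chi> k. if k = i then E (fst z) else 1)}"
  shows "open \<Omega>" "bounded \<Omega>" "\<And>t. t \<in> I \<Longrightarrow> has_bochner_integral lborel (\<lambda>x. indicator \<Omega> (t, x)) (E t)"
proof -
  obtain C where "\<And>t. \<bar>E t\<bar> \<le> C" using E(2) by (auto simp: bounded_iff)
  then have C: "E t \<le> C" for t by (rule order_trans[OF abs_ge_self])
  \<comment> \<open>A fixed bounded box containing all slices, since \<open>E\<close> is at most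
    \<open>C\<close>; within \<open>I \<times> D\<close> the single condition
    \<open>x $ i < E t\<close> cuts out \<open>\<Omega>\<close>.\<close>
  define D :: "(real^'d) set" where "D = box 0 (\<chi> k. if k = i then C + 1 else 1)"
  have "open (I \<times> UNIV :: (real \<times> (real^'d)) set)" using I by (intro open_Times) auto
  moreover have "continuous_on (I \<times> UNIV) (\<lambda>z :: real \<times> (real^'d). E (fst z) - snd z $ i)"
    by (intro continuous_intros continuous_on_compose2[OF E(3)]) auto
  ultimately have "open ((I \<times> UNIV) \<inter> (\<lambda>z :: real \<times> (real^'d). E (fst z) - snd z $ i) -` {0<..})"
    by (intro continuous_open_preimage) auto
  moreover have "open (UNIV \<times> D)" unfolding D_def by (intro open_Times open_UNIV open_box)
  moreover have \<Omega>_eq: "\<Omega> = ((I \<times> UNIV) \<inter> (\<lambda>z :: real \<times> (real^'d). E (fst z) - snd z $ i) -` {0<..}) \<inter> (UNIV \<times> D)"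
  proof (rule set_eqI)
    fix z :: "real \<times> (real^'d)"
    obtain t x where z: "z = (t, x)" by (cases z)
    have "x \<in> box 0 (\<chi> k. if k = i then E t else 1) \<longleftrightarrow> x $ i < E t \<and> x \<in> D"
    proof
      assume "x \<in> box 0 (\<chi> k. if k = i then E t else 1)"
      then have *: "0 < x $ k \<and> x $ k < (if k = i then E t else 1)" for k by (simp add: mem_box_cart)
      have "0 < x $ k \<and> x $ k < (if k = i then C + 1 else 1)" for k
        using *[of k] C[of t] by (cases "k = i") auto
      then show "x $ i < E t \<and> x \<in> D" using *[of i] by (simp add: D_def mem_box_cart)
    next
      assume x: "x $ i < E t \<and> x \<in> D"
      then have *: "0 < x $ k \<and> x $ k < (if k = i then C + 1 else 1)" for k by (simp add: D_def mem_box_cart)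
      have "0 < x $ k \<and> x $ k < (if k = i then E t else 1)" for k
        using *[of k] x by (cases "k = i") auto
      then show "x \<in> box 0 (\<chi> k. if k = i then E t else 1)" by (simp add: mem_box_cart)
    qed
    then show "z \<in> \<Omega> \<longleftrightarrow> z \<in> ((I \<times> UNIV) \<inter> (\<lambda>z :: real \<times> (real^'d). E (fst z) - snd z $ i) -` {0<..}) \<inter> (UNIV \<times> D)"
      by (simp only: \<Omega>_def z mem_Collect_eq fst_conv snd_conv) auto
  qed
  ultimately show "open \<Omega>" by auto
  have "\<Omega> \<subseteq> I \<times> D" unfolding \<Omega>_eq by auto
  then show "bounded \<Omega>"
    by (rule bounded_subset[rotated]) (simp add: D_def bounded_Times I)
  fix t assume t: "t \<in> I"
  let ?B = "box 0 (\<chi> k. if k = i then E t else 1) :: (real^'d) set"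
  have "emeasure lborel ?B = (\<Prod>k\<in>UNIV. ennreal ((\<chi> k. if k = i then E t else 1) $ k - (0 :: real^'d) $ k))"
    by (rule emeasure_lborel_box_vec) (simp add: E)
  also have "\<dots> = ennreal (E t)"
    by (simp add: prod.remove[of UNIV i] if_distrib[of ennreal] prod.neutral)
  finally have m: "emeasure lborel ?B = ennreal (E t)" .
  have "has_bochner_integral lborel (indicator ?B) (measure lborel ?B)"
    by (rule has_bochner_integral_real_indicator) (simp_all add: m)
  moreover have "measure lborel ?B = E t" using m by (simp add: measure_def E)
  moreover have "(\<lambda>x. indicator \<Omega> (t, x)) = (indicator ?B :: _ \<Rightarrow> real)"
    using t by (simp only: \<Omega>_def indicator_def mem_Collect_eq fst_conv snd_conv) auto
  ultimately show "has_bochner_integral lborel (\<lambda>x. indicator \<Omega> (t, x)) (E t)" by simp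
qed

theorem theorem2:
  fixes E :: "real \<Rightarrow> real" and I :: "real set"
  assumes "CARD('d::finite) \<ge> 2"
    and "is_interval I" and "open I" and "bounded I"
    and "\<And>t. 0 \<le> E t" and "bounded (range E)"
    and "continuous_on I E" and "\<And>t. t \<notin> I \<Longrightarrow> E t = 0"
  shows "infinite {(ae_class u, ae_class b) |
      (u :: real \<times> (real^'d) \<Rightarrow> real) (b :: real \<times> (real^'d) \<Rightarrow> real^'d).
        u \<in> borel_measurable lebesgue \<and> b \<in> borel_measurable lebesgue \<and>
        bounded (range u) \<and> bounded (range b) \<and>
        compactly_supported u \<and> compactly_supported b \<and>
        distributional_continuity_eq u b \<and> distributional_div_free b \<and>
        (AE t in lebesgue. t \<in> I \<longrightarrow>
           has_bochner_integral lebesgue (\<lambda>x. (u (t, x))\<^sup>2) (E t))}"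
    (is "infinite ?S")
proof -
  obtain u0 :: "real \<times> (real^'d) \<Rightarrow> real" and b0 :: "real \<times> (real^'d) \<Rightarrow> real^'d" and M where
    block[measurable]: "u0 \<in> borel_measurable borel" "b0 \<in> borel_measurable borel"
    and u0: "\<And>z. u0 z = 1 \<or> u0 z = -1" and b0: "\<And>z. norm (b0 z) \<le> M"
    and df0: "weak_div_free (\<lambda>z. indicator (box (-1, 0) (1, 1)) z *\<^sub>R (u0 z, u0 z *\<^sub>R b0 z))"
      "weak_div_free (\<lambda>z. indicator (box (-1, 0) (1, 1)) z *\<^sub>R (0, b0 z))"
    by (rule mixing_block[OF assms(1)]) blast
  obtain i :: 'd where True by blast
  define \<Omega> where "\<Omega> = {z :: real \<times> (real^'d). fst z \<in> I \<and> snd z \<in> box 0 (\<chi> k. if k = i then E (fst z) else 1)}"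
  note \<Omega> = energy_domain[OF assms(3-7), where i=i, folded \<Omega>_def]
  let ?K = "box (-1, 0) (1, 1) :: (real \<times> (real^'d)) set"
  have K: "?K \<noteq> {}"
  proof -
    have "(0, \<chi> k. 1/2) \<in> ?K" by (simp add: box_Times mem_box_cart)
    then show ?thesis by blast
  qed
  define F where "F z = (u0 z, b0 z)" for z
  have Fm[measurable]: "F \<in> borel_measurable borel" unfolding F_def by measurable
  obtain W :: "real \<times> (real^'d) \<Rightarrow> real \<times> (real^'d)" where Wm[measurable]: "W \<in> borel_measurable borel"
    and Wr: "\<And>z. W z \<in> insert 0 (range F)" and W0: "\<And>z. z \<notin> \<Omega> \<Longrightarrow> W z = 0"
    and W1: "AE z in lborel. z \<in> \<Omega> \<longrightarrow> W z \<in> F ` ?K"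
    and WT: "\<And>T :: real \<times> (real^'d) \<Rightarrow> real \<times> (real^'d). \<lbrakk>T \<in> borel_measurable borel; T 0 = 0; bounded (T ` range F);
       weak_div_free (\<lambda>z. indicator ?K z *\<^sub>R T (F z))\<rbrakk> \<Longrightarrow> weak_div_free (\<lambda>z. T (W z))"
  proof (rule fill_with_scaled_copies[OF K \<Omega>(1,2) Fm], goal_cases)
    case (1 W)
    show ?case by (rule 1(1)[OF 1(2-6)])
  qed
  define u b where "u z = fst (W z)" and "b z = snd (W z)" for z
  have [measurable]: "u \<in> borel_measurable borel" "b \<in> borel_measurable borel"
    unfolding u_def b_def by measurable
  have M0: "0 \<le> M" using b0[of 0] norm_ge_zero order_trans by blast
  have ub: "\<bar>u z\<bar> \<le> 1 \<and> norm (b z) \<le> M" for z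
  proof -
    consider "W z = 0" | y where "W z = F y" using Wr[of z] by blast
    then show ?thesis
    proof cases
      case 1
      then show ?thesis using M0 by (simp add: u_def b_def)
    next
      case (2 y)
      then show ?thesis using u0[of y] b0[of y] by (auto simp: u_def b_def F_def)
    qed
  qed
  have flux: "norm (a, a *\<^sub>R v) \<le> 1 + M" "norm (0 :: real, v) \<le> 1 + M" if "\<bar>a\<bar> \<le> 1" "norm v \<le> M" for a :: real and v :: "real^'d"
  proof -
    have "\<bar>a\<bar> * norm v \<le> 1 * M" using that by (intro mult_mono) auto
    then show "norm (a, a *\<^sub>R v) \<le> 1 + M"
      using norm_Pair_le[of a "a *\<^sub>R v"] that by simp
    show "norm (0 :: real, v) \<le> 1 + M" using that by (simp add: norm_Pair)
  qed
  have bounded_flux: "bounded (range (\<lambda>z. (v z, v z *\<^sub>R w z)))" "bounded (range (\<lambda>z. (0 :: real, w z)))"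
    if vw: "\<And>z. \<bar>v z\<bar> \<le> 1 \<and> norm (w z) \<le> M"
    for v :: "real \<times> (real^'d) \<Rightarrow> real" and w :: "real \<times> (real^'d) \<Rightarrow> real^'d"
  proof -
    have "norm (v z, v z *\<^sub>R w z) \<le> 1 + M" "norm (0 :: real, w z) \<le> 1 + M" for z
      using flux[of "v z" "w z"] vw[of z] by auto
    then show "bounded (range (\<lambda>z. (v z, v z *\<^sub>R w z)))" "bounded (range (\<lambda>z. (0 :: real, w z)))"
      unfolding bounded_iff by blast+
  qed
  have F_flux: "norm (u0 z, u0 z *\<^sub>R b0 z) \<le> 1 + M" "norm (0 :: real, b0 z) \<le> 1 + M" for z
    using flux[of "u0 z" "b0 z"] u0[of z] b0[of z] by auto
  \<comment> \<open>The two equations are the flux maps \<open>(a, v) \<mapsto> (a, a v)\<close> and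
    \<open>(a, v) \<mapsto> (0, v)\<close> applied to the filling; both vanish at 0, as the
    extension by zero demands.\<close>
  have df: "weak_div_free (\<lambda>z. (u z, u z *\<^sub>R b z))" "weak_div_free (\<lambda>z. (0, b z))"
  proof -
    show "weak_div_free (\<lambda>z. (u z, u z *\<^sub>R b z))"
      unfolding u_def b_def
      using df0(1) F_flux(1)
      by (intro WT[of "\<lambda>w. (fst w, fst w *\<^sub>R snd w)"]) (auto simp: F_def zero_prod_def bounded_iff simp del: scaleR_Pair)
    show "weak_div_free (\<lambda>z. (0, b z))"
      unfolding b_def
      using df0(2) F_flux(2)
      by (intro WT[of "\<lambda>w. (0, snd w)"]) (auto simp: F_def zero_prod_def bounded_iff simp del: scaleR_Pair)
  qed
  obtain R where R: "\<And>t. t \<in> I \<Longrightarrow> \<bar>t\<bar> \<le> R"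
    using assms(4) by (auto simp: bounded_iff)
  define c :: "real \<times> (real^'d)" where "c = (\<bar>R\<bar> + 1, 0)"
  have away: "fst z \<notin> I" if "z - c \<in> ?K" for z
    using that R[of "fst z"] by (cases z) (auto simp: c_def box_Times)
  then have away': "z \<notin> \<Omega>" if "z - c \<in> ?K" for z
    using that by (auto simp: \<Omega>_def)
  define u1 where "u1 z = indicator ?K (z - c) * u0 (z - c)" for z
  define b1 where "b1 z = indicator ?K (z - c) *\<^sub>R b0 (z - c)" for z
  have [measurable]: "u1 \<in> borel_measurable borel" "b1 \<in> borel_measurable borel"
    unfolding u1_def b1_def by measurable
  have ub1: "\<bar>u1 z\<bar> \<le> 1 \<and> norm (b1 z) \<le> M" for z
    using u0[of "z - c"] b0[of "z - c"] M0 by (auto simp: u1_def b1_def indicator_def)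
  have df1: "weak_div_free (\<lambda>z. (u1 z, u1 z *\<^sub>R b1 z))" "weak_div_free (\<lambda>z. (0, b1 z))"
  proof -
    have "(\<lambda>z. (u1 z, u1 z *\<^sub>R b1 z)) = (\<lambda>z. indicator ?K (z - c) *\<^sub>R (u0 (z - c), u0 (z - c) *\<^sub>R b0 (z - c)))"
      by (auto simp: u1_def b1_def indicator_def fun_eq_iff)
    then show "weak_div_free (\<lambda>z. (u1 z, u1 z *\<^sub>R b1 z))"
      using weak_div_free_translate[OF df0(1), of c] by simp
    have "(\<lambda>z. (0, b1 z)) = (\<lambda>z. indicator ?K (z - c) *\<^sub>R (0 :: real, b0 (z - c)))"
      by (auto simp: b1_def indicator_def fun_eq_iff)
    then show "weak_div_free (\<lambda>z. (0, b1 z))"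
      using weak_div_free_translate[OF df0(2), of c] by simp
  qed
  have "bounded (\<Omega> \<union> (+) c ` ?K)"
    by (intro bounded_Un[THEN iffD2] conjI \<Omega>(2) bounded_translation bounded_box)
  then obtain p q where pq: "\<Omega> \<union> (+) c ` ?K \<subseteq> cbox p q"
    using bounded_subset_cbox_symmetric by blast
  have out: "u z = 0 \<and> b z = 0 \<and> u1 z = 0 \<and> b1 z = 0" if "z \<notin> cbox p q" for z
  proof -
    have "z \<notin> \<Omega>" "z \<notin> (+) c ` ?K" using that pq by auto
    moreover have "z - c \<notin> ?K"
    proof
      assume "z - c \<in> ?K"
      then have "c + (z - c) \<in> (+) c ` ?K" by (rule imageI)
      with \<open>z \<notin> (+) c ` ?K\<close> show False by simp
    qed
    ultimately show ?thesis by (simp add: W0 u_def b_def u1_def b1_def)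
  qed
  \<comment> \<open>Only the density of the extra block is multiplied: for a fixed field the
    continuity equation is linear in the density.\<close>
  define U where "U n z = u z + real n * u1 z" for n z
  define B where "B z = b z + b1 z" for z
  have [measurable]: "U n \<in> borel_measurable borel" "B \<in> borel_measurable borel" for n
    unfolding U_def B_def by measurable
  \<comment> \<open>Disjoint supports exclude cross terms in the product of \<open>U n\<close> and
    \<open>B\<close>.\<close>
  have disj: "u z = 0 \<and> b z = 0 \<or> u1 z = 0 \<and> b1 z = 0" for z
    using away'[of z] by (cases "z - c \<in> ?K") (auto simp: W0 u_def b_def u1_def b1_def)
  have dfU: "weak_div_free (\<lambda>z. (U n z, U n z *\<^sub>R B z))" for n
  proof -
    have "weak_div_free (\<lambda>z. (u z, u z *\<^sub>R b z) + real n *\<^sub>R (u1 z, u1 z *\<^sub>R b1 z))"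
    proof (rule weak_div_free_add_scaled[OF df(1) df1(1), where a=p and b=q])
      show "bounded (range (\<lambda>z. (u z, u z *\<^sub>R b z)))" "bounded (range (\<lambda>z. (u1 z, u1 z *\<^sub>R b1 z)))"
        by (rule bounded_flux(1); use ub ub1 in blast)+
    qed (use out in \<open>simp_all add: zero_prod_def\<close>)
    moreover have "(u z, u z *\<^sub>R b z) + real n *\<^sub>R (u1 z, u1 z *\<^sub>R b1 z) = (U n z, U n z *\<^sub>R B z)" for z
      using disj[of z] by (auto simp: U_def B_def)
    ultimately show ?thesis by simp
  qed
  have dfB: "weak_div_free (\<lambda>z. (0, B z))"
  proof -
    have "weak_div_free (\<lambda>z. (0, b z) + 1 *\<^sub>R (0, b1 z))"
    proof (rule weak_div_free_add_scaled[OF df(2) df1(2), where a=p and b=q])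
      show "bounded (range (\<lambda>z. (0::real, b z)))" "bounded (range (\<lambda>z. (0::real, b1 z)))"
        by (rule bounded_flux(2)[of u b] bounded_flux(2)[of u1 b1]; use ub ub1 in blast)+
    qed (use out in \<open>simp_all add: zero_prod_def\<close>)
    then show ?thesis by (simp add: B_def)
  qed
  have energy: "AE t in lebesgue. t \<in> I \<longrightarrow> has_bochner_integral lebesgue (\<lambda>x. (U n (t, x))\<^sup>2) (E t)" for n
  proof -
    \<comment> \<open>The filling takes values of the block almost everywhere in
      \<open>\<Omega>\<close>, where the density is 1 or \<open>-1\<close>; Fubini for null sets
      then yields the slices.\<close>
    have "AE z in lborel. (u z)\<^sup>2 = indicator \<Omega> z"
      using W1
    proof eventually_elim
      case (elim z)
      show ?case
      proof (cases "z \<in> \<Omega>")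
        case True
        with elim obtain y where "W z = F y" by blast
        then show ?thesis using True u0[of y] by (auto simp: u_def F_def)
      qed (simp add: W0 u_def)
    qed
    then have "AE t in lborel. AE x in lborel. (u (t, x))\<^sup>2 = indicator \<Omega> (t, x)"
      unfolding lborel_prod[symmetric] by (rule lborel_pair.AE_pair)
    then have "AE t in lborel. t \<in> I \<longrightarrow> has_bochner_integral lebesgue (\<lambda>x. (U n (t, x))\<^sup>2) (E t)"
    proof eventually_elim
      case (elim t)
      show ?case
      proof
        assume t: "t \<in> I"
        have "U n (t, x) = u (t, x)" for x
          using away[of "(t, x)"] t by (auto simp: U_def u1_def indicator_def)
        moreover have "has_bochner_integral lborel (\<lambda>x. (u (t, x))\<^sup>2) (E t)"
          using \<Omega>(3)[OF t] elim
          by (subst has_bochner_integral_cong_AE[where g="\<lambda>x. indicator \<Omega> (t, x)"]) (auto intro: borel_measurable_has_bochner_integral)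
        ultimately show "has_bochner_integral lebesgue (\<lambda>x. (U n (t, x))\<^sup>2) (E t)"
          by (auto simp: has_bochner_integral_iff integrable_completion integral_completion)
      qed
    qed
    then show ?thesis by (rule AE_completion)
  qed
  have mem: "(ae_class (U n), ae_class B) \<in> ?S" for n
  proof -
    have "\<bar>U n z\<bar> \<le> 1 + real n * 1" for z
      unfolding U_def using ub[of z] ub1[of z]
      by (intro order_trans[OF abs_triangle_ineq] add_mono) (auto simp: abs_mult mult_left_le)
    then have "bounded (range (U n))" unfolding bounded_iff by auto
    moreover have "norm (B z) \<le> M + M" for z
      unfolding B_def using ub[of z] ub1[of z] by (intro order_trans[OF norm_triangle_ineq] add_mono) auto
    then have "bounded (range B)" unfolding bounded_iff by auto
    moreover have "compactly_supported (U n)" "compactly_supported B"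
      using out by (auto intro!: compactly_supported_if_zero_outside[where a=p and b=q] simp: U_def B_def)
    moreover have "distributional_continuity_eq (U n) B"
      by (rule distributional_continuity_eq_if_weak_div_free[OF _ _ dfU]) measurable
    moreover have "distributional_div_free B"
      by (rule distributional_div_free_if_weak_div_free[OF _ dfB]) measurable
    moreover have "U n \<in> borel_measurable lebesgue" "B \<in> borel_measurable lebesgue"
      by (auto intro: measurable_completion)
    ultimately show ?thesis using energy[of n] by blast
  qed
  \<comment> \<open>On the shifted block \<open>u1\<close> is 1 or \<open>-1\<close>, so different
    multiples differ at every point of it, and a nonempty open set is not null.\<close>
  have "inj (\<lambda>n. (ae_class (U n), ae_class B))"
  proof (rule injI)
    fix m n assume "(ae_class (U m), ae_class B) = (ae_class (U n), ae_class B)"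
    then have eq: "ae_class (U m) = ae_class (U n)" by simp
    have "U m \<in> ae_class (U m)" by (auto simp: ae_class_def intro: measurable_completion)
    then have "AE z in lebesgue. U m z = U n z" unfolding eq by (simp add: ae_class_def)
    then have AE: "AE z in lborel. U m z = U n z"
      using AE_completion_iff by (metis (mono_tags))
    show "m = n"
    proof (rule ccontr)
      assume "m \<noteq> n"
      have "AE z in lborel. z - c \<notin> ?K"
        using AE
      proof eventually_elim
        case (elim z)
        show ?case
        proof
          assume z: "z - c \<in> ?K"
          then have "u z = 0" using away'[of z] by (simp add: W0 u_def)
          then have "real m * u1 z = real n * u1 z" using elim by (simp add: U_def)
          moreover have "u1 z \<noteq> 0" using z u0[of "z - c"] by (auto simp: u1_def)
          ultimately show False using \<open>m \<noteq> n\<close> by simp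
        qed
      qed
      then have "AE z in lborel. z \<notin> (+) c ` ?K" by eventually_elim auto
      moreover have "open ((+) c ` ?K)" by (rule open_translation[OF open_box])
      ultimately have "(+) c ` ?K \<in> null_sets lborel" by (simp add: AE_iff_null_sets)
      then have "negligible ((+) c ` ?K)"
        by (simp add: negligible_iff_null_sets null_sets_completionI)
      then show False using open_not_negligible[OF \<open>open ((+) c ` ?K)\<close>] K by simp
    qed
  qed
  then have "infinite (range (\<lambda>n. (ae_class (U n), ae_class B)))" by (rule range_inj_infinite)
  moreover have "range (\<lambda>n. (ae_class (U n), ae_class B)) \<subseteq> ?S"
    by (rule image_subsetI) (rule mem)
  ultimately show ?thesis by (rule infinite_super[rotated])
qed

end
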